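(* Let $F$ be a finite graph and let $(G_n)_n$ be a sequence of finite graphs with $v(G_n)\to\infty$ converging to a graphon $W:\Omega^2\to[0,1]$ in the cut-distance. Then $\liminf_n \frac{\mathsf{til}(F,G_n)}{v(G_n)}\ge\mathsf{til}(F,W)$.
   Context: $(\Omega,\nu)$ is an atomless Borel probability space; a graphon is a symmetric measurable $W:\Omega^2\to[0,1]$. For a finite graph $G$, $\mathsf{til}(F,G)$ is the maximum number of pairwise vertex-disjoint (not necessarily induced) copies of $F$ in $G$. A graphon representation $W_G$ of $G$ with $V(G)=\{v_1,\dots,v_n\}$ is obtained by partitioning $\Omega$ into sets $\Omega_1,\dots,\Omega_n$ of measure $1/n$ and setting $W_G=1$ on $\Omega_i\times\Omega_j$ if $v_iv_j\in E(G)$ and $0$ otherwise. The cut-norm is $\|V\|_\square=\sup_{A,B}|\int_{A\times B}V|$, and the cut-distance is $\delta_\square(U,W)=\inf_\varphi\|U-W^\varphi\|_\square$ over invertible measure-preserving maps $\varphi:\Omega\to\Omega$, where $W^\varphi(x,y)=W(\varphi(x),\varphi(y))$; $G_n\to W$ means $\delta_\square(W_{G_n},W)\to0$. Let $F$ have vertex set $[k]$; $W^{\otimes F}(x_1,\dots,x_k)=\prod_{ij\in E(F),i<j}W(x_i,x_j)$, $\mathcal{F}_F(W)=\{W^{\otimes F}\neq0\}$. An $F$-tiling in $W$ is a measurable $\mathfrak{t}:\Omega^k\to[0,\infty)$ with $\{\mathfrak{t}\neq0\}\subset\mathcal{F}_F(W)$ such that for each $x\in\Omega$, $\sum_{\ell=1}^k\int\mathfrak{t}(x_1,\dots,x_{\ell-1},x,x_{\ell+1},\dots,x_k)\,\mathrm{d}\nu^{k-1}\le1$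 (integrating over all coordinates except the $\ell$-th); its size is $\int\mathfrak{t}\,\mathrm{d}\nu^k$, and $\mathsf{til}(F,W)$ is the supremum of sizes. *)

theory Defs
  imports "HOL-Probability.Probability"
begin

definition atomless_measure :: "'a measure \<Rightarrow> bool" where
  "atomless_measure M \<longleftrightarrow>
     (\<forall>A\<in>sets M. 0 < emeasure M A \<longrightarrow>
        (\<exists>B\<in>sets M. B \<subseteq> A \<and> 0 < emeasure M B \<and> emeasure M B < emeasure M A))"

definition graphon :: "'a measure \<Rightarrow> ('a \<Rightarrow> 'a \<Rightarrow> real) \<Rightarrow> bool" where
  "graphon M W \<longleftrightarrow>
     (\<lambda>(x, y). W x y) \<in> borel_measurable (M \<Otimes>\<^sub>M M) \<and>
     (\<forall>x\<in>space M. \<forall>y\<in>space M. W x y = W y x \<and> 0 \<le> W x y \<and> W x y \<le> 1)"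

definition fin_graph :: "nat \<Rightarrow> (nat \<Rightarrow> nat \<Rightarrow> bool) \<Rightarrow> bool" where
  "fin_graph n E \<longleftrightarrow> (\<forall>i j. E i j \<longrightarrow> i < n \<and> j < n \<and> i \<noteq> j \<and> E j i)"

definition is_copy ::
  "nat \<Rightarrow> (nat \<Rightarrow> nat \<Rightarrow> bool) \<Rightarrow> nat \<Rightarrow> (nat \<Rightarrow> nat \<Rightarrow> bool) \<Rightarrow> (nat \<Rightarrow> nat) \<Rightarrow> bool" where
  "is_copy k EF n EG f \<longleftrightarrow>
     inj_on f {..<k} \<and> f ` {..<k} \<subseteq> {..<n} \<and> (\<forall>a b. EF a b \<longrightarrow> EG (f a) (f b))"

definition til_graph ::
  "nat \<Rightarrow> (nat \<Rightarrow> nat \<Rightarrow> bool) \<Rightarrow> nat \<Rightarrow> (nat \<Rightarrow> nat \<Rightarrow> bool) \<Rightarrow> nat" where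
  "til_graph k EF n EG = Max {m. \<exists>f :: nat \<Rightarrow> nat \<Rightarrow> nat.
      (\<forall>i<m. is_copy k EF n EG (f i)) \<and>
      (\<forall>i<m. \<forall>j<m. i \<noteq> j \<longrightarrow> f i ` {..<k} \<inter> f j ` {..<k} = {})}"

definition graphon_rep ::
  "'a measure \<Rightarrow> nat \<Rightarrow> (nat \<Rightarrow> nat \<Rightarrow> bool) \<Rightarrow> ('a \<Rightarrow> 'a \<Rightarrow> real) \<Rightarrow> bool" where
  "graphon_rep M n E U \<longleftrightarrow>
     (\<exists>p :: 'a \<Rightarrow> nat. p \<in> measurable M (count_space UNIV) \<and>
        (\<forall>x\<in>space M. p x < n) \<and>
        (\<forall>i<n. measure M (p -` {i} \<inter> space M) = 1 / real n) \<and>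
        (\<forall>x\<in>space M. \<forall>y\<in>space M. U x y = (if E (p x) (p y) then 1 else 0)))"

definition cut_norm :: "'a measure \<Rightarrow> ('a \<Rightarrow> 'a \<Rightarrow> real) \<Rightarrow> real" where
  "cut_norm M V = (SUP AB \<in> sets M \<times> sets M.
      \<bar>\<integral>z. indicator (fst AB \<times> snd AB) z * V (fst z) (snd z) \<partial>(M \<Otimes>\<^sub>M M)\<bar>)"

definition invertible_mp :: "'a measure \<Rightarrow> ('a \<Rightarrow> 'a) \<Rightarrow> bool" where
  "invertible_mp M \<phi> \<longleftrightarrow>
     bij_betw \<phi> (space M) (space M) \<and>
     \<phi> \<in> measurable M M \<and> distr M M \<phi> = M \<and>
     inv_into (space M) \<phi> \<in> measurable M M \<and> distr M M (inv_into (space M) \<phi>) = M"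

definition cut_dist :: "'a measure \<Rightarrow> ('a \<Rightarrow> 'a \<Rightarrow> real) \<Rightarrow> ('a \<Rightarrow> 'a \<Rightarrow> real) \<Rightarrow> real" where
  "cut_dist M U W = (INF \<phi> \<in> {\<phi>. invertible_mp M \<phi>}.
      cut_norm M (\<lambda>x y. U x y - W (\<phi> x) (\<phi> y)))"

text \<open>Points of \<Omega>^k are (extensional) functions on {..<k}.\<close>
definition tensor_F :: "nat \<Rightarrow> (nat \<Rightarrow> nat \<Rightarrow> bool) \<Rightarrow> ('a \<Rightarrow> 'a \<Rightarrow> real) \<Rightarrow> (nat \<Rightarrow> 'a) \<Rightarrow> real" where
  "tensor_F k EF W x = (\<Prod>(i, j) \<in> {(i, j). i < j \<and> j < k \<and> EF i j}. W (x i) (x j))"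

definition F_tiling ::
  "'a measure \<Rightarrow> nat \<Rightarrow> (nat \<Rightarrow> nat \<Rightarrow> bool) \<Rightarrow> ('a \<Rightarrow> 'a \<Rightarrow> real) \<Rightarrow> ((nat \<Rightarrow> 'a) \<Rightarrow> real) \<Rightarrow> bool" where
  "F_tiling M k EF W t \<longleftrightarrow>
     t \<in> borel_measurable (PiM {..<k} (\<lambda>_. M)) \<and>
     (\<forall>x\<in>space (PiM {..<k} (\<lambda>_. M)). 0 \<le> t x) \<and>
     (\<forall>x\<in>space (PiM {..<k} (\<lambda>_. M)). t x \<noteq> 0 \<longrightarrow> tensor_F k EF W x \<noteq> 0) \<and>
     (\<forall>x\<in>space M. (\<Sum>l<k. \<integral>\<^sup>+ y. ennreal (t (y(l := x))) \<partial>(PiM ({..<k} - {l}) (\<lambda>_. M))) \<le> 1)"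

definition til_graphon ::
  "'a measure \<Rightarrow> nat \<Rightarrow> (nat \<Rightarrow> nat \<Rightarrow> bool) \<Rightarrow> ('a \<Rightarrow> 'a \<Rightarrow> real) \<Rightarrow> ennreal" where
  "til_graphon M k EF W = (SUP t \<in> {t. F_tiling M k EF W t}.
      \<integral>\<^sup>+ x. ennreal (t x) \<partial>(PiM {..<k} (\<lambda>_. M)))"

end

theory Submission
  imports Defs
begin

text \<open>
  Fix an \<open>F\<close>-tiling of \<open>W\<close>; by truncation it may be assumed bounded by \<open>C\<close> and supported where the
  tensor product exceeds some \<open>\<delta> > 0\<close>. Let \<open>p\<close> map each point to the vertex of \<open>G\<^sub>n\<close> whose part
  contains it. Because \<open>W\<close> is cut-norm close to a function of \<open>(p x, p y)\<close>, it is \<open>L\<^sup>1\<close>-close to the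
  average over the parts of a fixed step function. That average depends on a vertex only through its
  profile, the proportions of its part lying in the steps, so rounding profiles yields a partition of
  the vertices into a number of classes independent of \<open>n\<close>, on which \<open>W\<close> is almost a step function.
  The tiling then induces demands on the \<open>k\<close>-tuples of classes, and almost all of the demand sits on
  boxes where the tensor product of \<open>W\<close> is nearly a positive constant. Such a box is served greedily:
  as long as a positive proportion \<open>\<alpha>\<close> of every class is unused, the counting lemma finds another
  copy of \<open>F\<close>, and the degree constraint of the tiling guarantees this proportion when all demands are
  scaled by \<open>1 - \<alpha>\<close>.
\<close>

section \<open>The cut norm on functions\<close>

text \<open>Copies of \<open>F\<close> use whole vertices, so the boxes in which they are counted
  must be unions of parts of the graph, whereas the steps of \<open>W\<close> may cut through every
  part. Cut-norm closeness gives no L1 closeness of \<open>W\<close> to the graph; what survives is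
  that \<open>W\<close> changes little in L1 when it is averaged over the parts, because averaging
  does not change integrals against the graph. The number of boxes has to stay bounded for two
  reasons: each box loses up to one copy to rounding, and the counting lemma has an additive error,
  useless in a box whose measure may tend to 0. Hence boxes with a cell of measure below \<rho> are
  given up, and the error that the counting lemma tolerates contains the factor \<alpha> to the
  power \<open>k\<close>, since only a proportion \<alpha> of each cell may be left. This dictates
  the order of choice: \<delta>, \<open>C\<close> and \<xi> come with the tiling, \<alpha> and
  \<eta> depend on them, the classes on \<eta>, \<rho> on the number of classes, and the cut-norm
  bound \<epsilon> and the least order \<open>N0\<close> on all of these.\<close>

lemma (in prob_space) integrable_bounded_real:
  fixes f :: "'a \<Rightarrow> real"
    and B :: real
  assumes "f \<in> borel_measurable M" "\<And>x. x \<in> space M \<Longrightarrow> \<bar>f x\<bar> \<le> B"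
  shows "integrable M f"
  using assms by (intro integrable_const_bound[where B=B]) auto

context prob_space
begin

lemma prob_space_pair_self: "prob_space (M \<Otimes>\<^sub>M M)"
  by (intro prob_space_pair prob_space_axioms)

lemma integral_pair_iterated:
  fixes Z :: "'a \<times> 'a \<Rightarrow> real"
    and B :: real
  assumes [measurable]: "Z \<in> borel_measurable (M \<Otimes>\<^sub>M M)"
    and bd: "\<And>x y. x \<in> space M \<Longrightarrow> y \<in> space M \<Longrightarrow> \<bar>Z (x, y)\<bar> \<le> B"
  shows "(\<integral>z. Z z \<partial>(M \<Otimes>\<^sub>M M)) = (\<integral>x. (\<integral>y. Z (x, y) \<partial>M) \<partial>M)"
    and "(\<integral>z. Z z \<partial>(M \<Otimes>\<^sub>M M)) = (\<integral>y. (\<integral>x. Z (x, y) \<partial>M) \<partial>M)"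
proof -
  interpret MM: pair_sigma_finite M M ..
  have "integrable (M \<Otimes>\<^sub>M M) Z"
    using bd by (intro prob_space.integrable_bounded_real[OF prob_space_pair_self, where B=B])
      (auto simp: space_pair_measure)
  then show "(\<integral>z. Z z \<partial>(M \<Otimes>\<^sub>M M)) = (\<integral>x. (\<integral>y. Z (x, y) \<partial>M) \<partial>M)"
    and "(\<integral>z. Z z \<partial>(M \<Otimes>\<^sub>M M)) = (\<integral>y. (\<integral>x. Z (x, y) \<partial>M) \<partial>M)"
    using MM.integral_fst'[of Z] MM.integral_snd[of "\<lambda>x y. Z (x, y)"] by simp_all
qed

text \<open>By convention a non-integrable function has integral 0, a value that also obeys the
  bound. Inner integrals can thus be estimated without a measurability argument.\<close>

lemma abs_integral_le_bound:
  fixes h :: "'a \<Rightarrow> real"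
    and B :: real
  assumes "\<And>x. x \<in> space M \<Longrightarrow> \<bar>h x\<bar> \<le> B"
  shows "\<bar>\<integral>x. h x \<partial>M\<bar> \<le> B"
proof -
  have B: "0 \<le> B" using assms not_empty by fastforce
  show ?thesis
  proof (cases "integrable M h")
    case True
    have "(\<integral>x. h x \<partial>M) \<le> (\<integral>x. B \<partial>M)"
      using assms True by (intro integral_mono) (auto simp: abs_le_iff)
    moreover have "(\<integral>x. - B \<partial>M) \<le> (\<integral>x. h x \<partial>M)"
      using assms True by (intro integral_mono) (auto simp: abs_le_iff minus_le_iff)
    ultimately show ?thesis by (simp add: prob_space abs_le_iff)
  qed (use B in \<open>simp add: not_integrable_integral_eq\<close>)
qed

text \<open>The integral is linear in the weight \<open>f\<close>, so it is maximised by the extreme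
  weight that is 1 where \<open>h\<close> is positive and 0 elsewhere.\<close>

lemma weighted_integral_le_indicator:
  fixes h f :: "'a \<Rightarrow> real"
    and B :: real
  assumes [measurable]: "h \<in> borel_measurable M" "f \<in> borel_measurable M"
    and h: "\<And>x. x \<in> space M \<Longrightarrow> \<bar>h x\<bar> \<le> B"
    and f: "\<And>x. x \<in> space M \<Longrightarrow> 0 \<le> f x \<and> f x \<le> 1"
  shows "\<exists>A\<in>sets M. (\<integral>x. f x * h x \<partial>M) \<le> (\<integral>x. indicator A x * h x \<partial>M)"
proof
  let ?A = "{x \<in> space M. 0 < h x}"
  show "?A \<in> sets M" by measurable
  show "(\<integral>x. f x * h x \<partial>M) \<le> (\<integral>x. indicator ?A x * h x \<partial>M)"
  proof (rule integral_mono)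
    show "integrable M (\<lambda>x. f x * h x)"
      using h f by (intro integrable_bounded_real[where B="1 * B"]) (auto simp only: abs_mult intro!: mult_mono, auto)
    show "integrable M (\<lambda>x. indicator ?A x * h x)"
      using h by (intro integrable_bounded_real[where B="1 * B"]) (auto simp only: abs_mult intro!: mult_mono, auto)
    fix x assume "x \<in> space M"
    then show "f x * h x \<le> indicator ?A x * h x"
      using f[of x] mult_right_mono[of "f x" 1 "h x"] by (auto simp: indicator_def mult_nonneg_nonpos not_less)
  qed
qed

text \<open>The integral is bilinear in the two weights. With \<open>g\<close> fixed, Fubini turns
  it into a linear functional of \<open>f\<close>, and some indicator does at least as well; with
  that indicator fixed, the same applies to \<open>g\<close>. A bound tested on rectangles therefore
  passes to [0,1]-valued weights with the same constant.\<close>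

lemma cut_bound_functions_upper:
  fixes V :: "'a \<Rightarrow> 'a \<Rightarrow> real"
    and B \<epsilon> :: real and f g :: "'a \<Rightarrow> real"
  assumes [measurable]: "case_prod V \<in> borel_measurable (M \<Otimes>\<^sub>M M)"
    and V: "\<And>x y. x \<in> space M \<Longrightarrow> y \<in> space M \<Longrightarrow> \<bar>V x y\<bar> \<le> B"
    and cut: "\<And>A B. A \<in> sets M \<Longrightarrow> B \<in> sets M \<Longrightarrow>
      (\<integral>z. indicator A (fst z) * indicator B (snd z) * V (fst z) (snd z) \<partial>(M \<Otimes>\<^sub>M M)) \<le> \<epsilon>"
    and [measurable]: "f \<in> borel_measurable M" "g \<in> borel_measurable M"
    and f: "\<And>x. x \<in> space M \<Longrightarrow> 0 \<le> f x \<and> f x \<le> 1"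
    and g: "\<And>x. x \<in> space M \<Longrightarrow> 0 \<le> g x \<and> g x \<le> 1"
  shows "(\<integral>z. f (fst z) * g (snd z) * V (fst z) (snd z) \<partial>(M \<Otimes>\<^sub>M M)) \<le> \<epsilon>"
proof -
  have B0: "0 \<le> B" using V not_empty by fastforce
  have V'[measurable]: "(\<lambda>z. V (fst z) (snd z)) \<in> borel_measurable (M \<Otimes>\<^sub>M M)"
    using assms(1) by (simp add: case_prod_beta')
  have bd: "\<bar>a * b * V x y\<bar> \<le> B" if "x \<in> space M" "y \<in> space M" "0 \<le> a \<and> a \<le> 1" "0 \<le> b \<and> b \<le> 1" for a b :: real and x y
  proof -
    have "\<bar>a * b * V x y\<bar> = a * b * \<bar>V x y\<bar>" using that by (simp add: abs_mult)
    also have "\<dots> \<le> 1 * B" using V that B0 by (intro mult_mono mult_le_one) auto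
    finally show ?thesis by simp
  qed
  have bdA: "\<bar>indicator A x * b * V x y\<bar> \<le> B" if "x \<in> space M" "y \<in> space M" "0 \<le> b \<and> b \<le> 1"
    for A b x y using bd[of x y "indicator A x" b] that by (auto simp: indicator_def)
  have bdAC: "\<bar>indicator A x * indicator C y * V x y\<bar> \<le> B" if "x \<in> space M" "y \<in> space M"
    for A C x y using bdA[of x y "indicator C y" A] that by (auto simp: indicator_def)
  let ?h = "\<lambda>x. \<integral>y. g y * V x y \<partial>M"
  have hb: "\<bar>?h x\<bar> \<le> B" if "x \<in> space M" for x
    using bd[of x _ 1 "g _"] g that by (intro abs_integral_le_bound) auto
  obtain A where A[measurable]: "A \<in> sets M"
    and A1: "(\<integral>x. f x * ?h x \<partial>M) \<le> (\<integral>x. indicator A x * ?h x \<partial>M)"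
    using weighted_integral_le_indicator[of ?h f B] hb f by auto
  let ?h' = "\<lambda>y. \<integral>x. indicator A x * V x y \<partial>M"
  have hb': "\<bar>?h' y\<bar> \<le> B" if "y \<in> space M" for y
    using bd[of _ y "indicator A _" 1] that by (intro abs_integral_le_bound) (auto simp: indicator_def)
  obtain C where C[measurable]: "C \<in> sets M"
    and C1: "(\<integral>x. g x * ?h' x \<partial>M) \<le> (\<integral>x. indicator C x * ?h' x \<partial>M)"
    using weighted_integral_le_indicator[of ?h' g B] hb' g by auto
  have "(\<integral>z. f (fst z) * g (snd z) * V (fst z) (snd z) \<partial>(M \<Otimes>\<^sub>M M)) = (\<integral>x. f x * ?h x \<partial>M)"
    using bd f g by (subst integral_pair_iterated(1)[where B=B]) (auto simp: mult.assoc)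
  also have "\<dots> \<le> (\<integral>x. indicator A x * ?h x \<partial>M)" by (fact A1)
  also have "\<dots> = (\<integral>z. indicator A (fst z) * g (snd z) * V (fst z) (snd z) \<partial>(M \<Otimes>\<^sub>M M))"
    using bdA g by (subst integral_pair_iterated(1)[where B=B]) (auto simp: mult.assoc)
  also have "\<dots> = (\<integral>y. g y * ?h' y \<partial>M)"
    using bdA g by (subst integral_pair_iterated(2)[where B=B]) (auto simp: mult_ac simp flip: integral_mult_right_zero)
  also have "\<dots> \<le> (\<integral>y. indicator C y * ?h' y \<partial>M)" by (fact C1)
  also have "\<dots> = (\<integral>z. indicator A (fst z) * indicator C (snd z) * V (fst z) (snd z) \<partial>(M \<Otimes>\<^sub>M M))"
    using bdAC by (subst integral_pair_iterated(2)[where B=B]) (auto simp: mult_ac simp flip: integral_mult_right_zero)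
  also have "\<dots> \<le> \<epsilon>" by (rule cut) measurable
  finally show ?thesis .
qed

text \<open>The lower estimate is the upper one for \<open>- V\<close>.\<close>

lemma cut_bound_functions:
  fixes V :: "'a \<Rightarrow> 'a \<Rightarrow> real"
    and B \<epsilon> :: real and f g :: "'a \<Rightarrow> real"
  assumes V[measurable]: "case_prod V \<in> borel_measurable (M \<Otimes>\<^sub>M M)"
    and bd: "\<And>x y. x \<in> space M \<Longrightarrow> y \<in> space M \<Longrightarrow> \<bar>V x y\<bar> \<le> B"
    and cut: "\<And>A B. A \<in> sets M \<Longrightarrow> B \<in> sets M \<Longrightarrow>
      \<bar>\<integral>z. indicator A (fst z) * indicator B (snd z) * V (fst z) (snd z) \<partial>(M \<Otimes>\<^sub>M M)\<bar> \<le> \<epsilon>"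
    and fg: "f \<in> borel_measurable M" "g \<in> borel_measurable M"
      "\<And>x. x \<in> space M \<Longrightarrow> 0 \<le> f x \<and> f x \<le> 1" "\<And>x. x \<in> space M \<Longrightarrow> 0 \<le> g x \<and> g x \<le> 1"
  shows "\<bar>\<integral>z. f (fst z) * g (snd z) * V (fst z) (snd z) \<partial>(M \<Otimes>\<^sub>M M)\<bar> \<le> \<epsilon>"
proof (rule abs_leI)
  show "(\<integral>z. f (fst z) * g (snd z) * V (fst z) (snd z) \<partial>(M \<Otimes>\<^sub>M M)) \<le> \<epsilon>"
    by (rule cut_bound_functions_upper[OF V bd _ fg]) (use cut in \<open>auto simp: abs_le_iff\<close>)
  have "(\<integral>z. f (fst z) * g (snd z) * - V (fst z) (snd z) \<partial>(M \<Otimes>\<^sub>M M)) \<le> \<epsilon>"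
  proof (rule cut_bound_functions_upper[OF _ _ _ fg, where V = "\<lambda>x y. - V x y" and B=B])
    show "(\<lambda>(x, y). - V x y) \<in> borel_measurable (M \<Otimes>\<^sub>M M)"
      using borel_measurable_uminus[OF V] by (simp add: case_prod_beta')
  qed (use bd cut in \<open>auto simp: abs_le_iff\<close>)
  then show "- (\<integral>z. f (fst z) * g (snd z) * V (fst z) (snd z) \<partial>(M \<Otimes>\<^sub>M M)) \<le> \<epsilon>" by simp
qed

end

section \<open>Step functions on the square\<close>

context prob_space
begin

text \<open>Both coordinates share one labelling, and labels are natural numbers, so that a common
  refinement of two step functions has the same form.\<close>

definition step_functions :: "('a \<times> 'a \<Rightarrow> real) set" where
  "step_functions = {S. \<exists>(\<tau> :: 'a \<Rightarrow> nat) w. \<tau> \<in> M \<rightarrow>\<^sub>M count_space UNIV \<and> finite (\<tau> ` space M) \<and>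
     S = (\<lambda>z. w (\<tau> (fst z)) (\<tau> (snd z)))}"

text \<open>The kernel \<open>w\<close> is arbitrary: splitting over the countably many first labels
  leaves a function of the second label only, and every function on a discrete space is
  measurable.\<close>

lemma measurable_label_fun:
  fixes \<tau> :: "'a \<Rightarrow> 'b::countable" and \<sigma> :: "'a \<Rightarrow> 'c::countable" and w :: "'b \<Rightarrow> 'c \<Rightarrow> real"
  assumes [measurable]: "\<tau> \<in> M \<rightarrow>\<^sub>M count_space UNIV" "\<sigma> \<in> M \<rightarrow>\<^sub>M count_space UNIV"
  shows "(\<lambda>z. w (\<tau> (fst z)) (\<sigma> (snd z))) \<in> borel_measurable (M \<Otimes>\<^sub>M M)"
proof -
  have "(\<lambda>z. w i (\<sigma> (snd z))) \<in> borel_measurable (M \<Otimes>\<^sub>M M)" for i by measurable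
  then show ?thesis
    by (rule measurable_compose_countable[where f="\<lambda>i z. w i (\<sigma> (snd z))"]) measurable
qed

lemma step_functionsD:
  assumes "S \<in> step_functions"
  shows "S \<in> borel_measurable (M \<Otimes>\<^sub>M M)" "integrable (M \<Otimes>\<^sub>M M) S"
proof -
  from assms obtain \<tau> :: "'a \<Rightarrow> nat" and w where t: "\<tau> \<in> M \<rightarrow>\<^sub>M count_space UNIV" "finite (\<tau> ` space M)"
    and S: "S = (\<lambda>z. w (\<tau> (fst z)) (\<tau> (snd z)))"
    unfolding step_functions_def by auto
  show 1: "S \<in> borel_measurable (M \<Otimes>\<^sub>M M)"
    unfolding S by (rule measurable_label_fun[OF t(1) t(1)])
  let ?B = "Max ((\<lambda>(i, j). \<bar>w i j\<bar>) ` (\<tau> ` space M \<times> \<tau> ` space M))"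
  have 2: "\<bar>S z\<bar> \<le> ?B" if "z \<in> space (M \<Otimes>\<^sub>M M)" for z
    using t(2) that by (intro Max_ge) (force simp: S space_pair_measure)+
  show "integrable (M \<Otimes>\<^sub>M M) S"
    using 1 2 by (rule prob_space.integrable_bounded_real[OF prob_space_pair_self])
qed

text \<open>Pairing the two labels and encoding the pair as one natural number gives a common
  refinement, on which any pointwise operation acts through the values. Products, sums, multiples,
  constants and truncations are all instances.\<close>

lemma step_functions_combine:
  assumes "S \<in> step_functions" "T \<in> step_functions"
  shows "(\<lambda>z. f (S z) (T z)) \<in> step_functions"
proof -
  from assms obtain \<tau> \<sigma> :: "'a \<Rightarrow> nat" and v w
    where t[measurable]: "\<tau> \<in> M \<rightarrow>\<^sub>M count_space UNIV" "\<sigma> \<in> M \<rightarrow>\<^sub>M count_space UNIV"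
    and fin: "finite (\<tau> ` space M)" "finite (\<sigma> ` space M)"
    and S: "S = (\<lambda>z. w (\<tau> (fst z)) (\<tau> (snd z)))" and T: "T = (\<lambda>z. v (\<sigma> (fst z)) (\<sigma> (snd z)))"
    unfolding step_functions_def by auto
  let ?r = "\<lambda>x. prod_encode (\<tau> x, \<sigma> x)"
  have "(\<lambda>x. prod_encode (i, \<sigma> x)) \<in> M \<rightarrow>\<^sub>M count_space UNIV" for i by measurable
  then have "?r \<in> M \<rightarrow>\<^sub>M count_space UNIV"
    by (rule measurable_compose_countable[where f="\<lambda>i x. prod_encode (i, \<sigma> x)"]) (rule t)
  moreover have "finite (?r ` space M)"
    by (rule finite_subset[of _ "prod_encode ` (\<tau> ` space M \<times> \<sigma> ` space M)"]) (use fin in auto)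
  moreover have "\<exists>u. (\<lambda>z. f (S z) (T z)) = (\<lambda>z. u (?r (fst z)) (?r (snd z)))"
    by (rule exI[of _ "\<lambda>i j. f (w (fst (prod_decode i)) (fst (prod_decode j)))
      (v (snd (prod_decode i)) (snd (prod_decode j)))"]) (simp add: S T)
  ultimately show ?thesis unfolding step_functions_def by blast
qed

lemma step_functions_rectangle:
  assumes [measurable]: "A \<in> sets M" "B \<in> sets M"
  shows "(\<lambda>z. indicator A (fst z) * indicator B (snd z)) \<in> step_functions"
proof -
  have 1: "(\<lambda>x. if x \<in> C then 1 else 0 :: nat) \<in> M \<rightarrow>\<^sub>M count_space UNIV"
    if [measurable]: "C \<in> sets M" for C
    by measurable
  have "(\<lambda>z. indicator A (fst z)) \<in> step_functions"
    unfolding step_functions_def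
    by (intro CollectI exI[of _ "\<lambda>x. if x \<in> A then 1 else 0"] exI[of _ "\<lambda>i j. real i"] conjI 1)
      (auto intro: finite_subset[of _ "{0,1}"] simp: indicator_def)
  moreover have "(\<lambda>z. indicator B (snd z)) \<in> step_functions"
    unfolding step_functions_def
    by (intro CollectI exI[of _ "\<lambda>x. if x \<in> B then 1 else 0"] exI[of _ "\<lambda>i j. real j"] conjI 1)
      (auto intro: finite_subset[of _ "{0,1}"] simp: indicator_def)
  ultimately show ?thesis by (rule step_functions_combine)
qed

section \<open>Density of step functions in L1 of the square\<close>

definition step_approximable :: "('a \<times> 'a \<Rightarrow> real) \<Rightarrow> bool" where
  "step_approximable Z \<longleftrightarrow> integrable (M \<Otimes>\<^sub>M M) Z \<and>
    (\<forall>\<epsilon>>0::real. \<exists>S\<in>step_functions. (\<integral>z. \<bar>Z z - S z\<bar> \<partial>(M \<Otimes>\<^sub>M M)) \<le> \<epsilon>)"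

lemma step_approximableE:
  fixes \<epsilon> :: real
  assumes "step_approximable Z" "0 < \<epsilon>"
  obtains S where "S \<in> step_functions" "(\<integral>z. \<bar>Z z - S z\<bar> \<partial>(M \<Otimes>\<^sub>M M)) \<le> \<epsilon>"
  using assms unfolding step_approximable_def by blast

lemma step_approximable_step: "S \<in> step_functions \<Longrightarrow> step_approximable S"
  unfolding step_approximable_def
  by (auto dest: step_functionsD intro!: bexI[of _ S])

text \<open>Approximability is closed under L1 limits: half of the error is spent on
  \<open>Y\<close>, the other half on a step function close to \<open>Y\<close>.\<close>

lemma step_approximable_limit:
  assumes Z: "integrable (M \<Otimes>\<^sub>M M) Z"
    and ap: "\<And>\<epsilon>. 0 < \<epsilon> \<Longrightarrow> \<exists>Y. step_approximable Y \<and> (\<integral>z. \<bar>Z z - Y z\<bar> \<partial>(M \<Otimes>\<^sub>M M)) \<le> \<epsilon>"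
  shows "step_approximable Z"
  unfolding step_approximable_def
proof (intro conjI allI impI Z)
  fix \<epsilon> :: real assume "0 < \<epsilon>"
  then obtain Y where Y: "step_approximable Y" "(\<integral>z. \<bar>Z z - Y z\<bar> \<partial>(M \<Otimes>\<^sub>M M)) \<le> \<epsilon>/2"
    using ap[of "\<epsilon>/2"] by auto
  then obtain S where S: "S \<in> step_functions" "(\<integral>z. \<bar>Y z - S z\<bar> \<partial>(M \<Otimes>\<^sub>M M)) \<le> \<epsilon>/2"
    using \<open>0 < \<epsilon>\<close> step_approximableE[of Y "\<epsilon>/2"] by auto
  have i: "integrable (M \<Otimes>\<^sub>M M) Y" "integrable (M \<Otimes>\<^sub>M M) S"
    using Y S step_functionsD unfolding step_approximable_def by auto
  have "(\<integral>z. \<bar>Z z - S z\<bar> \<partial>(M \<Otimes>\<^sub>M M)) \<le> (\<integral>z. \<bar>Z z - Y z\<bar> + \<bar>Y z - S z\<bar> \<partial>(M \<Otimes>\<^sub>M M))"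
    using i Z by (intro integral_mono) auto
  also have "\<dots> = (\<integral>z. \<bar>Z z - Y z\<bar> \<partial>(M \<Otimes>\<^sub>M M)) + (\<integral>z. \<bar>Y z - S z\<bar> \<partial>(M \<Otimes>\<^sub>M M))"
    using i Z by (intro Bochner_Integration.integral_add) auto
  also have "\<dots> \<le> \<epsilon>" using Y S by simp
  finally show "\<exists>S\<in>step_functions. (\<integral>z. \<bar>Z z - S z\<bar> \<partial>(M \<Otimes>\<^sub>M M)) \<le> \<epsilon>" using S by auto
qed

lemma step_approximable_add:
  assumes "step_approximable Y" "step_approximable Z"
  shows "step_approximable (\<lambda>z. Y z + Z z)"
  unfolding step_approximable_def
proof (intro conjI allI impI)
  have i: "integrable (M \<Otimes>\<^sub>M M) Y" "integrable (M \<Otimes>\<^sub>M M) Z"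
    using assms unfolding step_approximable_def by auto
  then show "integrable (M \<Otimes>\<^sub>M M) (\<lambda>z. Y z + Z z)" by simp
  fix \<epsilon> :: real assume "0 < \<epsilon>"
  obtain S where S: "S \<in> step_functions" "(\<integral>z. \<bar>Y z - S z\<bar> \<partial>(M \<Otimes>\<^sub>M M)) \<le> \<epsilon>/2"
    using \<open>0 < \<epsilon>\<close> assms(1) step_approximableE[of Y "\<epsilon>/2"] by auto
  obtain T where T: "T \<in> step_functions" "(\<integral>z. \<bar>Z z - T z\<bar> \<partial>(M \<Otimes>\<^sub>M M)) \<le> \<epsilon>/2"
    using \<open>0 < \<epsilon>\<close> assms(2) step_approximableE[of Z "\<epsilon>/2"] by auto
  note ST = S T
  have i': "integrable (M \<Otimes>\<^sub>M M) S" "integrable (M \<Otimes>\<^sub>M M) T"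
    using ST step_functionsD by auto
  have "(\<integral>z. \<bar>Y z + Z z - (S z + T z)\<bar> \<partial>(M \<Otimes>\<^sub>M M)) \<le> (\<integral>z. \<bar>Y z - S z\<bar> + \<bar>Z z - T z\<bar> \<partial>(M \<Otimes>\<^sub>M M))"
    using i i' by (intro integral_mono) auto
  also have "\<dots> = (\<integral>z. \<bar>Y z - S z\<bar> \<partial>(M \<Otimes>\<^sub>M M)) + (\<integral>z. \<bar>Z z - T z\<bar> \<partial>(M \<Otimes>\<^sub>M M))"
    using i i' by (intro Bochner_Integration.integral_add) auto
  also have "\<dots> \<le> \<epsilon>" using ST by simp
  finally show "\<exists>S\<in>step_functions. (\<integral>z. \<bar>Y z + Z z - S z\<bar> \<partial>(M \<Otimes>\<^sub>M M)) \<le> \<epsilon>"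
    using step_functions_combine[OF ST(1,3), of "(+)"] by auto
qed

text \<open>A constant arises by combining two step functions with an operation that ignores its
  arguments; the empty rectangles are placeholders.\<close>

lemma step_approximable_const: "step_approximable (\<lambda>z. c)"
  by (rule step_approximable_step) (use step_functions_combine[OF step_functions_rectangle step_functions_rectangle,
        of "{}" "{}" "{}" "{}" "\<lambda>_ _. c"] in simp)

lemma step_approximable_cmult:
  assumes "step_approximable Z"
  shows "step_approximable (\<lambda>z. c * Z z)"
  unfolding step_approximable_def
proof (intro conjI allI impI)
  show "integrable (M \<Otimes>\<^sub>M M) (\<lambda>z. c * Z z)" using assms unfolding step_approximable_def by auto
  fix \<epsilon> :: real assume "0 < \<epsilon>"
  then have "0 < \<epsilon> / (\<bar>c\<bar> + 1)" by simp
  then obtain S where S: "S \<in> step_functions" "(\<integral>z. \<bar>Z z - S z\<bar> \<partial>(M \<Otimes>\<^sub>M M)) \<le> \<epsilon> / (\<bar>c\<bar> + 1)"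
    using assms step_approximableE by blast
  have "(\<integral>z. \<bar>c * Z z - c * S z\<bar> \<partial>(M \<Otimes>\<^sub>M M)) = \<bar>c\<bar> * (\<integral>z. \<bar>Z z - S z\<bar> \<partial>(M \<Otimes>\<^sub>M M))"
    by (simp add: abs_mult flip: right_diff_distrib)
  also have "\<dots> \<le> (\<bar>c\<bar> + 1) * (\<epsilon> / (\<bar>c\<bar> + 1))"
    using S by (intro mult_mono) auto
  finally show "\<exists>S\<in>step_functions. (\<integral>z. \<bar>c * Z z - S z\<bar> \<partial>(M \<Otimes>\<^sub>M M)) \<le> \<epsilon>"
    using step_functions_combine[OF S(1) S(1), of "\<lambda>a b. c * a"] by auto
qed

lemma step_approximable_sum:
  "finite I \<Longrightarrow> (\<And>i. i \<in> I \<Longrightarrow> step_approximable (Z i)) \<Longrightarrow> step_approximable (\<lambda>z. \<Sum>i\<in>I. Z i z)"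
  by (induction I rule: finite_induct) (auto intro: step_approximable_const step_approximable_add)

text \<open>Induction over the product sigma-algebra, which is generated by the intersection-stable
  family of rectangles. A complement is a difference of indicators, and a disjoint countable union
  is the L1 limit of its finite partial unions by countable additivity.\<close>

lemma step_approximable_indicator:
  assumes "Q \<in> sets (M \<Otimes>\<^sub>M M)"
  shows "step_approximable (indicator Q)"
proof -
  interpret MM: prob_space "M \<Otimes>\<^sub>M M" by (rule prob_space_pair_self)
  have Q: "Q \<in> sigma_sets (space M \<times> space M) {a \<times> b |a b. a \<in> sets M \<and> b \<in> sets M}"
    using assms by (simp add: sets_pair_measure)
  have P1: "{a \<times> b |a b. a \<in> sets M \<and> b \<in> sets M} \<subseteq> Pow (space M \<times> space M)"
    using sets.sets_into_space by fast
  have P2: "Int_stable {a \<times> b |a b. a \<in> sets M \<and> b \<in> sets M}"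
    by (rule Int_stable_pair_measure_generator)
  from Q show ?thesis
  proof (induction rule: sigma_sets_induct_disjoint[OF P2 P1, consumes 1, case_names basic empty compl union])
    case (basic A)
    then obtain a b where "A = a \<times> b" "a \<in> sets M" "b \<in> sets M" by auto
    then show ?case
      using step_approximable_step[OF step_functions_rectangle[of a b]]
      by (simp add: indicator_times)
  next
    case empty
    show ?case using step_approximable_const[of 0] by (simp add: indicator_def[abs_def])
  next
    case (compl A)
    have "step_approximable (\<lambda>z. indicator (space M \<times> space M) z + (-1) * indicator A z)"
      using compl step_approximable_step[OF step_functions_rectangle[of "space M" "space M"]]
      by (intro step_approximable_add step_approximable_cmult) (auto simp: indicator_times)
    moreover have "A \<subseteq> space M \<times> space M"
      using compl(1) sets.sets_into_space[of A "M \<Otimes>\<^sub>M M"] by (simp add: sets_pair_measure space_pair_measure)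
    then have "(\<lambda>z. indicator (space M \<times> space M) z + (-1) * indicator A z) = (indicator (space M \<times> space M - A) :: _ \<Rightarrow> real)"
      by (auto simp: fun_eq_iff split: split_indicator)
    ultimately show ?case by simp
  next
    case (union A)
    have A[measurable]: "A i \<in> sets (M \<Otimes>\<^sub>M M)" for i
      using union(2) by (auto simp: sets_pair_measure)
    have rA: "range A \<subseteq> sets (M \<Otimes>\<^sub>M M)" by (rule image_subsetI) (rule A)
    have lim: "(\<lambda>n. \<Sum>i<n. MM.prob (A i)) \<longlonglongrightarrow> MM.prob (\<Union>i. A i)"
      using MM.finite_measure_UNION[OF rA union(1)] unfolding sums_def .
    show ?case
    proof (rule step_approximable_limit)
      show "integrable (M \<Otimes>\<^sub>M M) (indicator (\<Union>i. A i) :: _ \<Rightarrow> real)"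
        by (intro MM.integrable_bounded_real[where B=1]) auto
      fix \<epsilon> :: real assume "0 < \<epsilon>"
      then obtain n where n: "\<bar>(\<Sum>i<n. MM.prob (A i)) - MM.prob (\<Union>i. A i)\<bar> < \<epsilon>"
        using lim unfolding LIMSEQ_iff by (metis order_refl real_norm_def)
      have d: "disjoint_family_on A {..<n}" using union(1) by (auto simp: disjoint_family_on_def)
      have s: "(\<Sum>i<n. indicator (A i) z) = (indicator (\<Union>i<n. A i) z :: real)" for z
        using d by (intro indicator_UN_disjoint[symmetric]) auto
      have pw: "(\<Sum>i<n. indicator (A i) z) \<le> (indicator (\<Union>i. A i) z :: real)" for z
        unfolding s by (auto split: split_indicator)
      have ind: "integrable (M \<Otimes>\<^sub>M M) (indicator C :: _ \<Rightarrow> real)" if "C \<in> sets (M \<Otimes>\<^sub>M M)" for C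
        using that by (intro MM.integrable_bounded_real[where B=1]) auto
      have "(\<integral>z. \<bar>indicator (\<Union>i. A i) z - (\<Sum>i<n. indicator (A i) z :: real)\<bar> \<partial>(M \<Otimes>\<^sub>M M)) =
        (\<integral>z. indicator (\<Union>i. A i) z - (\<Sum>i<n. indicator (A i) z) \<partial>(M \<Otimes>\<^sub>M M))"
        using pw by (intro Bochner_Integration.integral_cong) auto
      also have "\<dots> = MM.prob (\<Union>i. A i) - (\<Sum>i<n. MM.prob (A i))"
        using ind by (simp add: Bochner_Integration.integral_diff)
      also have "\<dots> \<le> \<epsilon>" using n by simp
      finally show "\<exists>Y. step_approximable Y \<and>
          (\<integral>z. \<bar>indicator (\<Union>i. A i) z - Y z\<bar> \<partial>(M \<Otimes>\<^sub>M M)) \<le> \<epsilon>"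
        using union(3) by (intro exI[of _ "\<lambda>z. \<Sum>i<n. indicator (A i) z"] conjI step_approximable_sum) auto
    qed
  qed
qed

text \<open>Rounding \<open>Z\<close> down to multiples of 1/(L+1) changes it by at most 1/(L+1)
  everywhere, and the rounded function is a finite combination of indicators of level sets.\<close>

lemma step_approximable_unit_interval:
  assumes [measurable]: "Z \<in> borel_measurable (M \<Otimes>\<^sub>M M)"
    and Z: "\<And>z. z \<in> space (M \<Otimes>\<^sub>M M) \<Longrightarrow> 0 \<le> Z z \<and> Z z \<le> 1"
  shows "step_approximable Z"
proof (rule step_approximable_limit)
  interpret MM: prob_space "M \<Otimes>\<^sub>M M" by (rule prob_space_pair_self)
  show "integrable (M \<Otimes>\<^sub>M M) Z" by (rule MM.integrable_bounded_real[where B=1]) (use Z in auto)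
  fix \<epsilon> :: real assume "0 < \<epsilon>"
  then obtain L where L: "1 / real (Suc L) < \<epsilon>" using nat_approx_posE by metis
  let ?L = "real (Suc L)"
  \<comment> \<open>The index reaches \<open>Suc L\<close> itself because \<open>Z\<close> may take
    the value 1.\<close>
  let ?Y = "\<lambda>z. \<Sum>j\<le>Suc L. (real j / ?L) * indicator {z \<in> space (M \<Otimes>\<^sub>M M). \<lfloor>?L * Z z\<rfloor> = int j} z"
  have Y: "?Y z = \<lfloor>?L * Z z\<rfloor> / ?L" if z: "z \<in> space (M \<Otimes>\<^sub>M M)" for z
  proof -
    have "0 \<le> ?L * Z z" using Z[OF z] by (intro mult_nonneg_nonneg of_nat_0_le_iff) auto
    then have b1: "0 \<le> \<lfloor>?L * Z z\<rfloor>" by (simp only: zero_le_floor)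
    have "?L * Z z \<le> ?L * 1" using Z[OF z] by (intro mult_left_mono of_nat_0_le_iff) auto
    then have b2: "\<lfloor>?L * Z z\<rfloor> \<le> int (Suc L)" by (metis floor_mono floor_of_nat mult.right_neutral)
    note b = b1 b2
    have "?Y z = (\<Sum>j\<le>Suc L. if j = nat \<lfloor>?L * Z z\<rfloor> then real j / ?L else 0)"
      using b z by (intro sum.cong) (auto simp: indicator_def simp del: of_nat_Suc)
    also have "\<dots> = \<lfloor>?L * Z z\<rfloor> / ?L"
      using b by (subst sum.delta) (auto simp: nat_le_iff simp del: of_nat_Suc)
    finally show ?thesis .
  qed
  have "step_approximable ?Y"
    by (intro step_approximable_sum step_approximable_cmult step_approximable_indicator) auto
  moreover have "(\<integral>z. \<bar>Z z - ?Y z\<bar> \<partial>(M \<Otimes>\<^sub>M M)) \<le> \<epsilon>"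
  proof -
    have "\<bar>\<bar>Z z - ?Y z\<bar>\<bar> \<le> 1 / ?L" if z: "z \<in> space (M \<Otimes>\<^sub>M M)" for z
    proof -
      have "\<bar>?L * Z z - \<lfloor>?L * Z z\<rfloor>\<bar> \<le> 1" by linarith
      then have "\<bar>?L * Z z - \<lfloor>?L * Z z\<rfloor>\<bar> / ?L \<le> 1 / ?L" by (intro divide_right_mono) auto
      moreover have "Z z - \<lfloor>?L * Z z\<rfloor> / ?L = (?L * Z z - \<lfloor>?L * Z z\<rfloor>) / ?L"
        by (simp add: diff_divide_distrib del: of_nat_Suc)
      ultimately show ?thesis unfolding Y[OF z] by (simp del: of_nat_Suc)
    qed
    then have "\<bar>\<integral>z. \<bar>Z z - ?Y z\<bar> \<partial>(M \<Otimes>\<^sub>M M)\<bar> \<le> 1 / ?L"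
      by (rule MM.abs_integral_le_bound)
    then show ?thesis using L by linarith
  qed
  ultimately show "\<exists>Y. step_approximable Y \<and> (\<integral>z. \<bar>Z z - Y z\<bar> \<partial>(M \<Otimes>\<^sub>M M)) \<le> \<epsilon>" by blast
qed

lemma step_approximation:
  fixes Z :: "'a \<times> 'a \<Rightarrow> real"
    and \<epsilon> :: real
  assumes [measurable]: "Z \<in> borel_measurable (M \<Otimes>\<^sub>M M)"
    and Z: "\<And>z. z \<in> space (M \<Otimes>\<^sub>M M) \<Longrightarrow> 0 \<le> Z z \<and> Z z \<le> 1" and "0 < \<epsilon>"
  shows "\<exists>(m::nat) \<tau> w. \<tau> \<in> M \<rightarrow>\<^sub>M count_space UNIV \<and> (\<forall>x\<in>space M. \<tau> x < m) \<and>
    (\<forall>i j. 0 \<le> w i j \<and> w i j \<le> 1) \<and>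
    (\<integral>z. \<bar>Z z - w (\<tau> (fst z)) (\<tau> (snd z))\<bar> \<partial>(M \<Otimes>\<^sub>M M)) \<le> \<epsilon>"
proof -
  interpret MM: prob_space "M \<Otimes>\<^sub>M M" by (rule prob_space_pair_self)
  obtain S where S: "S \<in> step_functions" "(\<integral>z. \<bar>Z z - S z\<bar> \<partial>(M \<Otimes>\<^sub>M M)) \<le> \<epsilon>"
    using step_approximable_unit_interval[of Z] assms unfolding step_approximable_def by blast
  obtain \<tau> :: "'a \<Rightarrow> nat" and w where t: "\<tau> \<in> M \<rightarrow>\<^sub>M count_space UNIV" "finite (\<tau> ` space M)"
    and Sw: "S = (\<lambda>z. w (\<tau> (fst z)) (\<tau> (snd z)))"
    using S(1) unfolding step_functions_def by auto
  obtain m where m: "\<forall>x\<in>space M. \<tau> x < m"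
    using t(2) unfolding finite_nat_set_iff_bounded by auto
  \<comment> \<open>As \<open>Z\<close> lies in [0,1], clamping the values to [0,1] brings them no
    further from \<open>Z\<close>; it makes the weights admissible for the averaging
    estimates.\<close>
  let ?w = "\<lambda>i j. max 0 (min 1 (w i j))"
  have st: "(\<lambda>z. max 0 (min 1 (S z))) \<in> step_functions"
    using step_functions_combine[OF S(1) S(1), of "\<lambda>a b. max 0 (min 1 a)"] .
  have "(\<integral>z. \<bar>Z z - max 0 (min 1 (S z))\<bar> \<partial>(M \<Otimes>\<^sub>M M)) \<le> (\<integral>z. \<bar>Z z - S z\<bar> \<partial>(M \<Otimes>\<^sub>M M))"
  proof (rule integral_mono)
    have "integrable (M \<Otimes>\<^sub>M M) Z" by (rule MM.integrable_bounded_real[where B=1]) (use Z in auto)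
    then show "integrable (M \<Otimes>\<^sub>M M) (\<lambda>z. \<bar>Z z - max 0 (min 1 (S z))\<bar>)" "integrable (M \<Otimes>\<^sub>M M) (\<lambda>z. \<bar>Z z - S z\<bar>)"
      using step_functionsD(2)[OF S(1)] step_functionsD(2)[OF st] by auto
  qed (use Z in fastforce)
  also have "\<dots> \<le> \<epsilon>" by (fact S)
  finally have "(\<integral>z. \<bar>Z z - ?w (\<tau> (fst z)) (\<tau> (snd z))\<bar> \<partial>(M \<Otimes>\<^sub>M M)) \<le> \<epsilon>" by (simp add: Sw)
  then show ?thesis using t m by (intro exI[of _ m] exI[of _ \<tau>] exI[of _ ?w]) auto
qed

end

section \<open>Step functions aligned with an equipartition\<close>

context prob_space
begin

lemma integral_rectangle:
  assumes [measurable]: "A \<in> sets M" "B \<in> sets M"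
  shows "(\<integral>z. indicator A (fst z) * indicator B (snd z) \<partial>(M \<Otimes>\<^sub>M M)) = prob A * prob B"
proof -
  have "(\<integral>z. indicator A (fst z) * indicator B (snd z) \<partial>(M \<Otimes>\<^sub>M M)) =
    (\<integral>z. indicator (A \<times> B) z \<partial>(M \<Otimes>\<^sub>M M) :: real)"
    by (intro Bochner_Integration.integral_cong) (auto simp: indicator_times)
  also have "\<dots> = measure (M \<Otimes>\<^sub>M M) (A \<times> B)"
    by (simp add: sets.Int_space_eq2)
  also have "\<dots> = prob A * prob B"
    by (simp add: measure_def emeasure_pair_measure_Times enn2real_mult)
  finally show ?thesis .
qed

text \<open>A finite labelling makes the integrand a finite combination of rectangle indicators.
  Labels will be vertices, or pairs of a vertex and a step.\<close>

lemma integral_label_pair: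
  fixes \<sigma> :: "'a \<Rightarrow> 'b::countable" and G :: "'b \<Rightarrow> 'b \<Rightarrow> real"
  assumes [measurable]: "\<sigma> \<in> M \<rightarrow>\<^sub>M count_space UNIV"
    and F: "\<And>x. x \<in> space M \<Longrightarrow> \<sigma> x \<in> F" "finite F"
  shows "(\<integral>z. G (\<sigma> (fst z)) (\<sigma> (snd z)) \<partial>(M \<Otimes>\<^sub>M M)) =
    (\<Sum>a\<in>F. \<Sum>b\<in>F. G a b * (prob {x \<in> space M. \<sigma> x = a} * prob {x \<in> space M. \<sigma> x = b}))"
proof -
  interpret MM: prob_space "M \<Otimes>\<^sub>M M" by (rule prob_space_pair_self)
  let ?I = "\<lambda>a. indicator {x \<in> space M. \<sigma> x = a} :: 'a \<Rightarrow> real"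
  have S[measurable]: "{x \<in> space M. \<sigma> x = a} \<in> sets M" for a by measurable
  have i: "integrable (M \<Otimes>\<^sub>M M) (\<lambda>z. ?I a (fst z) * ?I b (snd z))" for a b
    by (rule MM.integrable_bounded_real[where B=1]) (auto simp: indicator_def)
  have pw: "G (\<sigma> (fst z)) (\<sigma> (snd z)) = (\<Sum>a\<in>F. \<Sum>b\<in>F. G a b * (?I a (fst z) * ?I b (snd z)))"
    if "z \<in> space (M \<Otimes>\<^sub>M M)" for z
  proof -
    have z: "fst z \<in> space M" "snd z \<in> space M" using that by (auto simp: space_pair_measure)
    have "(\<Sum>a\<in>F. \<Sum>b\<in>F. G a b * (?I a (fst z) * ?I b (snd z))) =
      (\<Sum>a\<in>F. \<Sum>b\<in>F. if b = \<sigma> (snd z) then if a = \<sigma> (fst z) then G a b else 0 else 0)"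
      using z by (intro sum.cong) (auto simp: indicator_def)
    also have "\<dots> = G (\<sigma> (fst z)) (\<sigma> (snd z))"
      using z F by (simp add: sum.delta)
    finally show ?thesis ..
  qed
  have "(\<integral>z. G (\<sigma> (fst z)) (\<sigma> (snd z)) \<partial>(M \<Otimes>\<^sub>M M)) =
    (\<integral>z. (\<Sum>a\<in>F. \<Sum>b\<in>F. G a b * (?I a (fst z) * ?I b (snd z))) \<partial>(M \<Otimes>\<^sub>M M))"
    by (intro Bochner_Integration.integral_cong refl pw)
  also have "\<dots> = (\<Sum>a\<in>F. \<Sum>b\<in>F. G a b * (\<integral>z. ?I a (fst z) * ?I b (snd z) \<partial>(M \<Otimes>\<^sub>M M)))"
    using i by (simp add: Bochner_Integration.integral_sum)
  finally show ?thesis by (simp add: integral_rectangle)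
qed

text \<open>The functions \<open>f\<close> are either indicators of a measurable partition or its averages over the
  vertex fibres.\<close>

lemma cut_bound_step:
  fixes V :: "'a \<Rightarrow> 'a \<Rightarrow> real" and f :: "nat \<Rightarrow> 'a \<Rightarrow> real"
    and \<epsilon> :: real
  assumes V[measurable]: "case_prod V \<in> borel_measurable (M \<Otimes>\<^sub>M M)"
    and bd: "\<And>x y. x \<in> space M \<Longrightarrow> y \<in> space M \<Longrightarrow> \<bar>V x y\<bar> \<le> 1"
    and cut: "\<And>A B. A \<in> sets M \<Longrightarrow> B \<in> sets M \<Longrightarrow>
      \<bar>\<integral>z. indicator A (fst z) * indicator B (snd z) * V (fst z) (snd z) \<partial>(M \<Otimes>\<^sub>M M)\<bar> \<le> \<epsilon>"
    and f[measurable]: "\<And>i. f i \<in> borel_measurable M"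
    and f01: "\<And>i x. i < m \<Longrightarrow> x \<in> space M \<Longrightarrow> 0 \<le> f i x \<and> f i x \<le> 1"
    and w: "\<And>i j. 0 \<le> w i j \<and> w i j \<le> (1::real)"
  shows "\<bar>\<integral>z. V (fst z) (snd z) * (\<Sum>i<m. \<Sum>j<m. w i j * f i (fst z) * f j (snd z)) \<partial>(M \<Otimes>\<^sub>M M)\<bar> \<le> (real m)\<^sup>2 * \<epsilon>"
proof -
  interpret MM: prob_space "M \<Otimes>\<^sub>M M" by (rule prob_space_pair_self)
  have V'[measurable]: "(\<lambda>z. V (fst z) (snd z)) \<in> borel_measurable (M \<Otimes>\<^sub>M M)"
    using V by (simp add: case_prod_beta')
  let ?T = "\<lambda>i j z. f i (fst z) * f j (snd z) * V (fst z) (snd z)"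
  have i: "integrable (M \<Otimes>\<^sub>M M) (?T i j)" if "i < m" "j < m" for i j
  proof (rule MM.integrable_bounded_real[where B=1])
    fix z assume "z \<in> space (M \<Otimes>\<^sub>M M)"
    then have z: "fst z \<in> space M" "snd z \<in> space M" by (auto simp: space_pair_measure)
    have "\<bar>?T i j z\<bar> = f i (fst z) * f j (snd z) * \<bar>V (fst z) (snd z)\<bar>"
      using f01 that z by (simp add: abs_mult)
    also have "\<dots> \<le> 1" using f01 that z bd by (intro mult_le_one mult_nonneg_nonneg) auto
    finally show "\<bar>?T i j z\<bar> \<le> 1" .
  qed measurable
  have "(\<integral>z. V (fst z) (snd z) * (\<Sum>i<m. \<Sum>j<m. w i j * f i (fst z) * f j (snd z)) \<partial>(M \<Otimes>\<^sub>M M)) =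
    (\<integral>z. (\<Sum>i<m. \<Sum>j<m. w i j * ?T i j z) \<partial>(M \<Otimes>\<^sub>M M))"
    by (simp add: sum_distrib_left mult_ac)
  also have "\<dots> = (\<Sum>i<m. \<Sum>j<m. w i j * (\<integral>z. ?T i j z \<partial>(M \<Otimes>\<^sub>M M)))"
    using i by (subst Bochner_Integration.integral_sum, force intro: Bochner_Integration.integrable_sum integrable_mult_right,
        intro sum.cong refl, subst Bochner_Integration.integral_sum, auto)
  also have "\<bar>\<dots>\<bar> \<le> (\<Sum>i<m. \<Sum>j<m. \<epsilon>)"
  proof (intro order.trans[OF sum_abs] sum_mono)
    fix i j assume ij: "i \<in> {..<m}" "j \<in> {..<m}"
    have "\<bar>\<integral>z. ?T i j z \<partial>(M \<Otimes>\<^sub>M M)\<bar> \<le> \<epsilon>"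
      by (rule cut_bound_functions[OF V bd cut]) (use f01 ij in auto)
    then have "w i j * \<bar>\<integral>z. ?T i j z \<partial>(M \<Otimes>\<^sub>M M)\<bar> \<le> 1 * \<epsilon>"
      using w by (intro mult_mono) auto
    then show "\<bar>w i j * (\<integral>z. ?T i j z \<partial>(M \<Otimes>\<^sub>M M))\<bar> \<le> \<epsilon>" using w by (simp add: abs_mult)
  qed
  finally show ?thesis by (simp add: power2_eq_square)
qed

end

section \<open>Averages of step functions over the parts of an equipartition\<close>

locale equipartition = prob_space M for M :: "'a measure" +
  fixes p :: "'a \<Rightarrow> nat" and N :: nat
  assumes p_measurable[measurable]: "p \<in> M \<rightarrow>\<^sub>M count_space UNIV"
    and p_less: "\<And>x. x \<in> space M \<Longrightarrow> p x < N"
    and prob_fibre: "\<And>v. v < N \<Longrightarrow> prob {x \<in> space M. p x = v} = 1 / N"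
begin

lemma N_pos: "0 < N"
  using not_empty p_less by fastforce

text \<open>Every part has measure 1/N, so the factor \<open>N\<close> turns this into the
  conditional probability of step \<open>i\<close> given part \<open>v\<close>.\<close>

definition profile :: "('a \<Rightarrow> nat) \<Rightarrow> nat \<Rightarrow> nat \<Rightarrow> real" where
  "profile \<tau> v i = N * prob {x \<in> space M. p x = v \<and> \<tau> x = i}"

lemma profile_nonneg: "0 \<le> profile \<tau> v i"
  by (simp add: profile_def)

text \<open>The mean of the step function over the product of the parts of \<open>u\<close> and
  \<open>v\<close>, that is, its conditional expectation given the two vertices.\<close>

definition averaged :: "('a \<Rightarrow> nat) \<Rightarrow> nat \<Rightarrow> (nat \<Rightarrow> nat \<Rightarrow> real) \<Rightarrow> nat \<Rightarrow> nat \<Rightarrow> real" where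
  "averaged \<tau> m w u v = (\<Sum>i<m. \<Sum>j<m. w i j * profile \<tau> u i * profile \<tau> v j)"

context
  fixes \<tau> :: "'a \<Rightarrow> nat" and m :: nat
  assumes \<tau>[measurable]: "\<tau> \<in> M \<rightarrow>\<^sub>M count_space UNIV" and \<tau>_less: "\<And>x. x \<in> space M \<Longrightarrow> \<tau> x < m"
begin

lemma sum_profile:
  assumes "v < N" shows "(\<Sum>i<m. profile \<tau> v i) = 1"
proof -
  have "prob {x \<in> space M. p x = v} = (\<Sum>i<m. prob {x \<in> space M. p x = v \<and> \<tau> x = i})"
  proof (subst finite_measure_finite_Union[symmetric])
    show "(\<lambda>i. {x \<in> space M. p x = v \<and> \<tau> x = i}) ` {..<m} \<subseteq> events" by auto
    show "disjoint_family_on (\<lambda>i. {x \<in> space M. p x = v \<and> \<tau> x = i}) {..<m}"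
      by (auto simp: disjoint_family_on_def)
    show "prob {x \<in> space M. p x = v} = prob (\<Union>i<m. {x \<in> space M. p x = v \<and> \<tau> x = i})"
      using \<tau>_less by (intro arg_cong[where f=prob]) auto
  qed simp
  then have "(\<Sum>i<m. prob {x \<in> space M. p x = v \<and> \<tau> x = i}) = 1 / N"
    using prob_fibre[OF assms] by simp
  then show ?thesis using N_pos by (simp add: profile_def flip: sum_distrib_left)
qed

lemma profile_le_1: "v < N \<Longrightarrow> i < m \<Longrightarrow> profile \<tau> v i \<le> 1"
  using member_le_sum[of i "{..<m}" "profile \<tau> v"] sum_profile[of v] profile_nonneg by auto

end

context
  fixes \<tau> :: "'a \<Rightarrow> nat" and m :: nat and w :: "nat \<Rightarrow> nat \<Rightarrow> real"
  assumes \<tau>[measurable]: "\<tau> \<in> M \<rightarrow>\<^sub>M count_space UNIV" and \<tau>_less: "\<And>x. x \<in> space M \<Longrightarrow> \<tau> x < m"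
    and w01: "\<And>i j. 0 \<le> w i j \<and> w i j \<le> 1"
begin

text \<open>The sums are bounded by 1 rather than equal to 1, so that profiles which have been
  rounded down are covered as well.\<close>

lemma bilinear_01:
  fixes r s :: "nat \<Rightarrow> real"
  assumes "\<And>i. i < m \<Longrightarrow> 0 \<le> r i" "\<And>i. i < m \<Longrightarrow> 0 \<le> s i" "(\<Sum>i<m. r i) \<le> 1" "(\<Sum>i<m. s i) \<le> 1"
  shows "0 \<le> (\<Sum>i<m. \<Sum>j<m. w i j * r i * s j) \<and> (\<Sum>i<m. \<Sum>j<m. w i j * r i * s j) \<le> 1"
proof
  show "0 \<le> (\<Sum>i<m. \<Sum>j<m. w i j * r i * s j)"
    using assms w01 by (intro sum_nonneg mult_nonneg_nonneg) auto
  have "(\<Sum>i<m. \<Sum>j<m. w i j * r i * s j) \<le> (\<Sum>i<m. \<Sum>j<m. r i * s j)"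
    using assms w01 by (intro sum_mono mult_right_mono mult_left_le_one_le) auto
  also have "\<dots> = (\<Sum>i<m. r i) * (\<Sum>i<m. s i)" by (simp add: sum_product)
  also have "\<dots> \<le> 1" using assms by (intro mult_le_one sum_nonneg) auto
  finally show "(\<Sum>i<m. \<Sum>j<m. w i j * r i * s j) \<le> 1" .
qed

lemma averaged_01: "u < N \<Longrightarrow> v < N \<Longrightarrow> 0 \<le> averaged \<tau> m w u v \<and> averaged \<tau> m w u v \<le> 1"
  unfolding averaged_def by (rule bilinear_01) (auto simp: profile_nonneg sum_profile[OF \<tau> \<tau>_less])

text \<open>The projection property of conditional expectation. Refining the labels to pairs of
  vertex and step makes both sides finite sums, and summing out the two steps with the vertices
  fixed produces \<open>averaged\<close>.\<close>

lemma integral_averaged: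
  fixes h :: "nat \<Rightarrow> nat \<Rightarrow> real"
  shows "(\<integral>z. h (p (fst z)) (p (snd z)) * w (\<tau> (fst z)) (\<tau> (snd z)) \<partial>(M \<Otimes>\<^sub>M M)) =
    (\<integral>z. h (p (fst z)) (p (snd z)) * averaged \<tau> m w (p (fst z)) (p (snd z)) \<partial>(M \<Otimes>\<^sub>M M))"
proof -
  let ?s = "\<lambda>x. (p x, \<tau> x)"
  let ?q = "\<lambda>u i. prob {x \<in> space M. p x = u \<and> \<tau> x = i}"
  have s: "?s \<in> M \<rightarrow>\<^sub>M count_space UNIV"
  proof -
    have "(\<lambda>x. (i, \<tau> x)) \<in> M \<rightarrow>\<^sub>M count_space UNIV" for i :: nat by measurable
    then show ?thesis
      by (rule measurable_compose_countable[where f="\<lambda>i x. (i, \<tau> x)"]) (rule p_measurable)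
  qed
  have q: "?q u i = profile \<tau> u i / N" for u i using N_pos by (simp add: profile_def)
  have "(\<integral>z. h (p (fst z)) (p (snd z)) * w (\<tau> (fst z)) (\<tau> (snd z)) \<partial>(M \<Otimes>\<^sub>M M)) =
    (\<Sum>a\<in>{..<N} \<times> {..<m}. \<Sum>b\<in>{..<N} \<times> {..<m}. h (fst a) (fst b) * w (snd a) (snd b) *
      (prob {x \<in> space M. ?s x = a} * prob {x \<in> space M. ?s x = b}))"
    using integral_label_pair[OF s, of "{..<N} \<times> {..<m}" "\<lambda>a b. h (fst a) (fst b) * w (snd a) (snd b)"]
      p_less \<tau>_less by simp
  also have "\<dots> = (\<Sum>u<N. \<Sum>i<m. \<Sum>v<N. \<Sum>j<m. h u v * w i j * (?q u i * ?q v j))"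
    by (simp only: sum.cartesian_product' fst_conv snd_conv prod.inject)
  also have "\<dots> = (\<Sum>u<N. \<Sum>v<N. \<Sum>i<m. \<Sum>j<m. h u v * w i j * (?q u i * ?q v j))"
    by (intro sum.cong refl sum.swap)
  also have "\<dots> = (\<Sum>u<N. \<Sum>v<N. h u v * averaged \<tau> m w u v * (1 / N * (1 / N)))"
    by (intro sum.cong refl) (simp add: q averaged_def sum_distrib_left sum_distrib_right mult_ac)
  also have "\<dots> = (\<Sum>u<N. \<Sum>v<N. h u v * averaged \<tau> m w u v *
      (prob {x \<in> space M. p x = u} * prob {x \<in> space M. p x = v}))"
    by (intro sum.cong refl) (simp add: prob_fibre)
  also have "\<dots> = (\<integral>z. h (p (fst z)) (p (snd z)) * averaged \<tau> m w (p (fst z)) (p (snd z)) \<partial>(M \<Otimes>\<^sub>M M))"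
    using integral_label_pair[OF p_measurable, of "{..<N}" "\<lambda>u v. h u v * averaged \<tau> m w u v"] p_less by simp
  finally show ?thesis .
qed

end
text \<open>Against functions of \<open>(p x, p y)\<close> the averaged step function integrates like the original one,
  so the squared \<open>L\<^sup>2\<close> distance of the two is the integral of their difference against the step function.
  Up to the given errors this is the integral of \<open>W - u\<close> against two step functions, which the cut
  norm controls.\<close>

lemma averaged_L1:
  fixes W :: "'a \<Rightarrow> 'a \<Rightarrow> real" and u :: "nat \<Rightarrow> nat \<Rightarrow> real"
    and c \<epsilon> \<eta> :: real
  assumes \<tau>[measurable]: "\<tau> \<in> M \<rightarrow>\<^sub>M count_space UNIV" and \<tau>_less: "\<And>x. x \<in> space M \<Longrightarrow> \<tau> x < (m::nat)"
    and w01: "\<And>i j. 0 \<le> w i j \<and> w i j \<le> (1::real)"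
    and W[measurable]: "case_prod W \<in> borel_measurable (M \<Otimes>\<^sub>M M)"
    and W01: "\<And>x y. x \<in> space M \<Longrightarrow> y \<in> space M \<Longrightarrow> 0 \<le> W x y \<and> W x y \<le> 1"
    and u01: "\<And>i j. 0 \<le> u i j \<and> u i j \<le> 1"
    and cut: "\<And>A B. A \<in> sets M \<Longrightarrow> B \<in> sets M \<Longrightarrow>
      \<bar>\<integral>z. indicator A (fst z) * indicator B (snd z) * (u (p (fst z)) (p (snd z)) - W (fst z) (snd z)) \<partial>(M \<Otimes>\<^sub>M M)\<bar> \<le> \<epsilon>"
    and approx: "(\<integral>z. \<bar>W (fst z) (snd z) - w (\<tau> (fst z)) (\<tau> (snd z))\<bar> \<partial>(M \<Otimes>\<^sub>M M)) \<le> \<eta>"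
    and c: "0 < c" "2 * \<eta> + 2 * (real m)\<^sup>2 * \<epsilon> \<le> c\<^sup>2"
  shows "(\<integral>z. \<bar>w (\<tau> (fst z)) (\<tau> (snd z)) - averaged \<tau> m w (p (fst z)) (p (snd z))\<bar> \<partial>(M \<Otimes>\<^sub>M M)) \<le> c"
proof -
  interpret MM: prob_space "M \<Otimes>\<^sub>M M" by (rule prob_space_pair_self)
  define Wz where "Wz = (\<lambda>z. W (fst z) (snd z))"
  define Uz where "Uz = (\<lambda>z. u (p (fst z)) (p (snd z)))"
  define Sz where "Sz = (\<lambda>z. w (\<tau> (fst z)) (\<tau> (snd z)))"
  define Bz where "Bz = (\<lambda>z. averaged \<tau> m w (p (fst z)) (p (snd z)))"
  have meas[measurable]: "Wz \<in> borel_measurable (M \<Otimes>\<^sub>M M)" "Uz \<in> borel_measurable (M \<Otimes>\<^sub>M M)"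
    "Sz \<in> borel_measurable (M \<Otimes>\<^sub>M M)" "Bz \<in> borel_measurable (M \<Otimes>\<^sub>M M)"
    using W measurable_label_fun[OF \<tau> \<tau>] measurable_label_fun[OF p_measurable p_measurable]
    by (simp_all add: Wz_def Uz_def Sz_def Bz_def case_prod_beta')
  have r: "0 \<le> Wz z \<and> Wz z \<le> 1" "0 \<le> Uz z \<and> Uz z \<le> 1" "0 \<le> Sz z \<and> Sz z \<le> 1" "0 \<le> Bz z \<and> Bz z \<le> 1"
    if "z \<in> space (M \<Otimes>\<^sub>M M)" for z
    using that W01 u01 w01 averaged_01[OF \<tau> \<tau>_less w01] p_less
    by (auto simp: Wz_def Uz_def Sz_def Bz_def space_pair_measure)
  have int: "integrable (M \<Otimes>\<^sub>M M) (\<lambda>z. X z * Y z)"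
    if "X \<in> {Wz, Uz, Sz, Bz}" "Y \<in> {Wz, Uz, Sz, Bz}" for X Y
  proof (rule MM.integrable_bounded_real[where B=1])
    show "(\<lambda>z. X z * Y z) \<in> borel_measurable (M \<Otimes>\<^sub>M M)" using that by auto
    fix z assume z: "z \<in> space (M \<Otimes>\<^sub>M M)"
    have "0 \<le> X z \<and> X z \<le> 1" "0 \<le> Y z \<and> Y z \<le> 1" using that r[OF z] by auto
    then show "\<bar>X z * Y z\<bar> \<le> 1" by (auto simp: abs_mult intro: mult_le_one)
  qed
  have int1: "integrable (M \<Otimes>\<^sub>M M) X" if "X \<in> {Wz, Uz, Sz, Bz}" for X
    using that r by (intro MM.integrable_bounded_real[where B=1]) auto
  let ?I = "\<lambda>X Y. \<integral>z. X z * Y z \<partial>(M \<Otimes>\<^sub>M M)"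
  \<comment> \<open>The choice \<open>h = u\<close> lets the averaged function replace the step
    function against the graph; the choice \<open>h = averaged \<tau> m w\<close> makes
    \<open>Sz - Bz\<close> orthogonal to \<open>Bz\<close>.\<close>
  have av: "?I Uz Sz = ?I Uz Bz" "?I Bz Sz = ?I Bz Bz"
    unfolding Uz_def Sz_def Bz_def
    by (rule integral_averaged[where h=u, OF \<tau>]; use \<tau>_less w01 in simp)
      (rule integral_averaged[where h="averaged \<tau> m w", OF \<tau>]; use \<tau>_less w01 in simp)
  have V: "case_prod (\<lambda>x y. u (p x) (p y) - W x y) \<in> borel_measurable (M \<Otimes>\<^sub>M M)"
    using meas(1,2) by (simp add: Wz_def Uz_def case_prod_beta')
  have bd: "\<bar>u (p x) (p y) - W x y\<bar> \<le> 1" if "x \<in> space M" "y \<in> space M" for x y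
    using u01[of "p x" "p y"] W01[OF that] by (auto simp: abs_le_iff)
  \<comment> \<open>The indicators of the steps reassemble \<open>Sz\<close>, so this tests the cut
    norm against \<open>Sz\<close> itself; further down the profiles give the same test against
    \<open>Bz\<close>.\<close>
  have "\<bar>\<integral>z. (u (p (fst z)) (p (snd z)) - W (fst z) (snd z)) *
      (\<Sum>i<m. \<Sum>j<m. w i j * indicator {x \<in> space M. \<tau> x = i} (fst z) * indicator {x \<in> space M. \<tau> x = j} (snd z)) \<partial>(M \<Otimes>\<^sub>M M)\<bar>
      \<le> (real m)\<^sup>2 * \<epsilon>"
    by (rule cut_bound_step[OF V bd cut]) (use w01 in \<open>auto simp: indicator_def\<close>)
  also have "(\<integral>z. (u (p (fst z)) (p (snd z)) - W (fst z) (snd z)) *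
      (\<Sum>i<m. \<Sum>j<m. w i j * indicator {x \<in> space M. \<tau> x = i} (fst z) * indicator {x \<in> space M. \<tau> x = j} (snd z)) \<partial>(M \<Otimes>\<^sub>M M))
      = (\<integral>z. Uz z * Sz z - Wz z * Sz z \<partial>(M \<Otimes>\<^sub>M M))"
  proof (intro Bochner_Integration.integral_cong refl)
    fix z assume "z \<in> space (M \<Otimes>\<^sub>M M)"
    then have z: "fst z \<in> space M" "snd z \<in> space M" by (auto simp: space_pair_measure)
    have "(\<Sum>i<m. \<Sum>j<m. w i j * indicator {x \<in> space M. \<tau> x = i} (fst z) * indicator {x \<in> space M. \<tau> x = j} (snd z)) =
      (\<Sum>i<m. \<Sum>j<m. if j = \<tau> (snd z) then if i = \<tau> (fst z) then w i j else 0 else 0)"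
      using z by (intro sum.cong) (auto simp: indicator_def)
    also have "\<dots> = Sz z" using z \<tau>_less by (simp add: Sz_def sum.delta)
    finally show "(u (p (fst z)) (p (snd z)) - W (fst z) (snd z)) *
      (\<Sum>i<m. \<Sum>j<m. w i j * indicator {x \<in> space M. \<tau> x = i} (fst z) * indicator {x \<in> space M. \<tau> x = j} (snd z)) =
      Uz z * Sz z - Wz z * Sz z" by (simp add: Uz_def Wz_def left_diff_distrib)
  qed
  also have "\<dots> = ?I Uz Sz - ?I Wz Sz" using int by (intro Bochner_Integration.integral_diff) auto
  finally have D1: "\<bar>?I Uz Sz - ?I Wz Sz\<bar> \<le> (real m)\<^sup>2 * \<epsilon>" .
  have "\<bar>\<integral>z. (u (p (fst z)) (p (snd z)) - W (fst z) (snd z)) *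
      (\<Sum>i<m. \<Sum>j<m. w i j * profile \<tau> (p (fst z)) i * profile \<tau> (p (snd z)) j) \<partial>(M \<Otimes>\<^sub>M M)\<bar>
      \<le> (real m)\<^sup>2 * \<epsilon>"
    by (rule cut_bound_step[OF V bd cut, where f="\<lambda>i x. profile \<tau> (p x) i"])
      (use w01 p_less profile_nonneg profile_le_1[OF \<tau> \<tau>_less] in auto)
  also have "(\<integral>z. (u (p (fst z)) (p (snd z)) - W (fst z) (snd z)) *
      (\<Sum>i<m. \<Sum>j<m. w i j * profile \<tau> (p (fst z)) i * profile \<tau> (p (snd z)) j) \<partial>(M \<Otimes>\<^sub>M M))
      = (\<integral>z. Uz z * Bz z - Wz z * Bz z \<partial>(M \<Otimes>\<^sub>M M))"
    by (simp add: Uz_def Wz_def Bz_def averaged_def left_diff_distrib)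
  also have "\<dots> = ?I Uz Bz - ?I Wz Bz" using int by (intro Bochner_Integration.integral_diff) auto
  finally have D2: "\<bar>?I Uz Bz - ?I Wz Bz\<bar> \<le> (real m)\<^sup>2 * \<epsilon>" .
  have close: "\<bar>?I Sz X - ?I Wz X\<bar> \<le> \<eta>" if X: "X \<in> {Sz, Bz}" for X
  proof -
    have "?I Sz X - ?I Wz X = (\<integral>z. Sz z * X z - Wz z * X z \<partial>(M \<Otimes>\<^sub>M M))"
      using int X by (intro Bochner_Integration.integral_diff[symmetric]) auto
    also have "\<bar>\<dots>\<bar> \<le> (\<integral>z. \<bar>Sz z * X z - Wz z * X z\<bar> \<partial>(M \<Otimes>\<^sub>M M))" by (rule integral_abs_bound)
    also have "\<dots> \<le> (\<integral>z. \<bar>Wz z - Sz z\<bar> \<partial>(M \<Otimes>\<^sub>M M))"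
    proof (rule integral_mono)
      fix z assume z: "z \<in> space (M \<Otimes>\<^sub>M M)"
      have "\<bar>Sz z * X z - Wz z * X z\<bar> = \<bar>Wz z - Sz z\<bar> * X z"
        using r[OF z] X by (auto simp: abs_mult abs_minus_commute simp flip: left_diff_distrib)
      also have "\<dots> \<le> \<bar>Wz z - Sz z\<bar>" using r[OF z] X by (intro mult_left_le) auto
      finally show "\<bar>Sz z * X z - Wz z * X z\<bar> \<le> \<bar>Wz z - Sz z\<bar>" .
    qed (use int int1 X in auto)
    also have "\<dots> \<le> \<eta>" using approx by (simp add: Wz_def Sz_def)
    finally show ?thesis .
  qed
  have com: "?I Sz Bz = ?I Bz Sz" by (simp add: mult.commute)
  have "(\<integral>z. (Sz z - Bz z)\<^sup>2 \<partial>(M \<Otimes>\<^sub>M M)) = (\<integral>z. Sz z * Sz z - Bz z * Sz z - Bz z * Sz z + Bz z * Bz z \<partial>(M \<Otimes>\<^sub>M M))"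
    by (intro Bochner_Integration.integral_cong refl) (simp add: power2_eq_square algebra_simps)
  also have "\<dots> = ?I Sz Sz - ?I Bz Sz - ?I Bz Sz + ?I Bz Bz"
    using int by simp
  also have "\<dots> = ?I Sz Sz - ?I Sz Bz" using av com by simp
  \<comment> \<open>The chain runs from \<open>?I Sz Sz\<close> through \<open>?I Wz Sz\<close>,
    \<open>?I Uz Sz\<close> = \<open>?I Uz Bz\<close> and \<open>?I Wz Bz\<close> to
    \<open>?I Sz Bz\<close>. The two outer links cost \<eta> each by \<open>close\<close>, the two
    inner ones m^2 \<epsilon> each by the cut norm.\<close>
  also have "\<dots> \<le> 2 * \<eta> + 2 * (real m)\<^sup>2 * \<epsilon>"
    using D1 D2 close[of Sz] close[of Bz] av(1) by (simp add: abs_le_iff)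
  also have "\<dots> \<le> c\<^sup>2" by (fact c)
  finally have sq: "(\<integral>z. (Sz z - Bz z)\<^sup>2 \<partial>(M \<Otimes>\<^sub>M M)) \<le> c\<^sup>2" .
  have isq: "integrable (M \<Otimes>\<^sub>M M) (\<lambda>z. (Sz z - Bz z)\<^sup>2)"
    using int by (simp add: power2_eq_square left_diff_distrib right_diff_distrib)
  \<comment> \<open>The inequality d \<le> d^2/(2c) + c/2 for d \<ge> 0 takes the place of
    Cauchy-Schwarz and yields exactly \<open>c\<close>.\<close>
  have "(\<integral>z. \<bar>Sz z - Bz z\<bar> \<partial>(M \<Otimes>\<^sub>M M)) \<le> (\<integral>z. (Sz z - Bz z)\<^sup>2 / (2 * c) + c / 2 \<partial>(M \<Otimes>\<^sub>M M))"
  proof (rule integral_mono)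
    fix z
    have "2 * c * \<bar>Sz z - Bz z\<bar> \<le> (Sz z - Bz z)\<^sup>2 + c\<^sup>2"
      using sum_squares_bound[of c "\<bar>Sz z - Bz z\<bar>"] by simp
    then show "\<bar>Sz z - Bz z\<bar> \<le> (Sz z - Bz z)\<^sup>2 / (2 * c) + c / 2"
      using c(1) by (simp add: field_simps power2_eq_square)
  qed (use isq int1 in auto)
  also have "\<dots> = (\<integral>z. (Sz z - Bz z)\<^sup>2 \<partial>(M \<Otimes>\<^sub>M M)) / (2 * c) + c / 2"
    using isq by (simp add: MM.prob_space)
  also have "\<dots> \<le> c\<^sup>2 / (2 * c) + c / 2"
    using sq c(1) by (intro add_right_mono divide_right_mono) auto
  also have "\<dots> = c" using c(1) by (simp add: power2_eq_square)
  finally show ?thesis by (simp add: Sz_def Bz_def)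
qed

end

section \<open>Rounding profiles to finitely many vertex classes\<close>

lemma abs_mult_diff_le:
  fixes a b c d :: real
  assumes "0 \<le> a" "a \<le> 1" "0 \<le> d" "d \<le> 1"
  shows "\<bar>a * b - c * d\<bar> \<le> \<bar>a - c\<bar> + \<bar>b - d\<bar>"
proof -
  have "a * b - c * d = a * (b - d) + (a - c) * d" by (simp add: algebra_simps)
  also have "\<bar>\<dots>\<bar> \<le> a * \<bar>b - d\<bar> + \<bar>a - c\<bar> * d"
    using assms by (intro order.trans[OF abs_triangle_ineq]) (simp add: abs_mult)
  also have "\<dots> \<le> 1 * \<bar>b - d\<bar> + \<bar>a - c\<bar> * 1"
    using assms by (intro add_mono mult_mono) auto
  finally show ?thesis by simp
qed

text \<open>The class of a vertex is the list of numerators of its profile rounded down to multiples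
  of 1/L. There are (L+1)^m lists of this kind, whatever \<open>N\<close> is, and each of the m^2
  terms of \<open>averaged\<close> moves by at most 2/L.\<close>

lemma (in equipartition) averaged_rounding:
  assumes \<tau>: "\<tau> \<in> M \<rightarrow>\<^sub>M count_space UNIV" and \<tau>_less: "\<And>x. x \<in> space M \<Longrightarrow> \<tau> x < (m::nat)"
    and w01: "\<And>i j. 0 \<le> w i j \<and> w i j \<le> (1::real)" and L: "0 < (L::nat)"
  shows "\<exists>cls (w' :: nat list \<Rightarrow> nat list \<Rightarrow> real).
    (\<forall>v<N. cls v \<in> {xs. set xs \<subseteq> {..L} \<and> length xs = m}) \<and> (\<forall>a b. 0 \<le> w' a b \<and> w' a b \<le> 1) \<and>
    (\<forall>u<N. \<forall>v<N. \<bar>averaged \<tau> m w u v - w' (cls u) (cls v)\<bar> \<le> 2 * (real m)\<^sup>2 / L)"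
proof -
  define cls where "cls v = map (\<lambda>i. nat \<lfloor>L * profile \<tau> v i\<rfloor>) [0..<m]" for v
  define w0 where "w0 = (\<lambda>xs ys. \<Sum>i<m. \<Sum>j<m. w i j * (real (xs ! i) / L) * (real (ys ! j) / L))"
  have pr: "0 \<le> profile \<tau> v i" "v < N \<Longrightarrow> i < m \<Longrightarrow> profile \<tau> v i \<le> 1"
    "v < N \<Longrightarrow> (\<Sum>i<m. profile \<tau> v i) = 1" for v i
    using profile_le_1[OF \<tau> \<tau>_less] sum_profile[OF \<tau> \<tau>_less] profile_nonneg by auto
  have nth: "real (cls v ! i) = of_int \<lfloor>L * profile \<tau> v i\<rfloor>" if "i < m" for i v
    using that pr(1)[of v i] by (simp add: cls_def)
  have b: "0 \<le> real (cls v ! i) / L \<and> real (cls v ! i) / L \<le> profile \<tau> v i \<and> profile \<tau> v i - real (cls v ! i) / L \<le> 1 / L"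
    if "i < m" for i v
  proof -
    let ?t = "L * profile \<tau> v i"
    have "\<lfloor>?t\<rfloor> \<le> ?t" "?t - \<lfloor>?t\<rfloor> \<le> 1" by linarith+
    then have "\<lfloor>?t\<rfloor> / L \<le> ?t / L" "(?t - \<lfloor>?t\<rfloor>) / L \<le> 1 / L"
      using L by (intro divide_right_mono; simp)+
    then have "\<lfloor>?t\<rfloor> / L \<le> profile \<tau> v i" "profile \<tau> v i - \<lfloor>?t\<rfloor> / L \<le> 1 / L"
      using L by (simp_all add: diff_divide_distrib)
    moreover have "0 \<le> \<lfloor>?t\<rfloor> / L" using pr(1)[of v i] by simp
    ultimately show ?thesis unfolding nth[OF that] by blast
  qed
  have c1: "cls v \<in> {xs. set xs \<subseteq> {..L} \<and> length xs = m}" if "v < N" for v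
  proof -
    have "nat \<lfloor>L * profile \<tau> v i\<rfloor> \<le> L" if "i < m" for i
    proof -
      have "real L * profile \<tau> v i \<le> real L * 1" using pr(2)[OF \<open>v < N\<close> that] by (intro mult_left_mono) auto
      then have "\<lfloor>L * profile \<tau> v i\<rfloor> \<le> int L" by (metis floor_mono floor_of_nat mult.right_neutral)
      then show ?thesis by simp
    qed
    then show ?thesis by (auto simp: cls_def)
  qed
  have c2: "0 \<le> w0 (cls u) (cls v) \<and> w0 (cls u) (cls v) \<le> 1" if "u < N" "v < N" for u v
  proof -
    have "(\<Sum>i<m. real (cls v ! i) / L) \<le> 1" if "v < N" for v
      using sum_mono[of "{..<m}" "\<lambda>i. real (cls v ! i) / L" "profile \<tau> v"] b pr(3)[OF that] by auto
    then show ?thesis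
      unfolding w0_def using that b by (intro bilinear_01[OF \<tau> \<tau>_less w01]) auto
  qed
  have c3: "\<bar>averaged \<tau> m w u v - w0 (cls u) (cls v)\<bar> \<le> 2 * (real m)\<^sup>2 / L" if uv: "u < N" "v < N" for u v
  proof -
    have eq: "averaged \<tau> m w u v - w0 (cls u) (cls v) =
      (\<Sum>i<m. \<Sum>j<m. w i j * (profile \<tau> u i * profile \<tau> v j - (real (cls u ! i) / L) * (real (cls v ! j) / L)))"
      unfolding averaged_def w0_def sum_subtractf[symmetric]
      by (intro sum.cong refl) (simp add: right_diff_distrib)
    have le: "\<bar>averaged \<tau> m w u v - w0 (cls u) (cls v)\<bar> \<le> (\<Sum>i<m. \<Sum>j<m. 2 / L)"
      unfolding eq
    proof (intro order.trans[OF sum_abs] sum_mono)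
      fix i j assume ij: "i \<in> {..<m}" "j \<in> {..<m}"
      let ?d = "\<bar>profile \<tau> u i * profile \<tau> v j - (real (cls u ! i) / L) * (real (cls v ! j) / L)\<bar>"
      have i: "i < m" and j: "j < m" using ij by auto
      have p1: "profile \<tau> u i \<le> 1" "profile \<tau> v j \<le> 1" using pr(2)[OF uv(1) i] pr(2)[OF uv(2) j] .
      have "?d \<le> \<bar>profile \<tau> u i - real (cls u ! i) / L\<bar> + \<bar>profile \<tau> v j - real (cls v ! j) / L\<bar>"
        by (rule abs_mult_diff_le) (use b[OF i, of u] b[OF j, of v] p1 in linarith)+
      also have "\<dots> \<le> 1 / L + 1 / L" using b[OF i, of u] b[OF j, of v] by linarith
      finally have d: "?d \<le> 2 / L" by simp
      have "w i j * ?d \<le> 1 * (2 / L)" using w01[of i j] d by (intro mult_mono) auto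
      then show "\<bar>w i j * (profile \<tau> u i * profile \<tau> v j - (real (cls u ! i) / L) * (real (cls v ! j) / L))\<bar> \<le> 2 / L"
        using w01[of i j] by (simp add: abs_mult)
    qed
    have "(\<Sum>i<m. \<Sum>j<m. 2 / real L) = 2 * (real m)\<^sup>2 / L" by (simp add: power2_eq_square)
    with le show ?thesis by (simp only:)
  qed
  \<comment> \<open>Lists that come from no vertex may give values outside [0,1]; clamping enforces
    the bound for all arguments and leaves the realised pairs of classes unchanged.\<close>
  define w' where "w' = (\<lambda>a b. max 0 (min 1 (w0 a b)))"
  have "w' (cls u) (cls v) = w0 (cls u) (cls v)" if "u < N" "v < N" for u v
    using c2[OF that] by (simp add: w'_def)
  moreover have "0 \<le> w' a b \<and> w' a b \<le> 1" for a b by (simp add: w'_def)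
  ultimately show ?thesis
    using c1 c3 by (intro exI[of _ cls] exI[of _ w'] conjI allI impI) simp_all
qed

text \<open>The number of classes is bounded before \<open>N\<close> and \<open>p\<close> are known.\<close>

lemma (in prob_space) aligned_approximation:
  fixes W :: "'a \<Rightarrow> 'a \<Rightarrow> real"
    and \<eta> :: real
  assumes W[measurable]: "case_prod W \<in> borel_measurable (M \<Otimes>\<^sub>M M)"
    and W01: "\<And>x y. x \<in> space M \<Longrightarrow> y \<in> space M \<Longrightarrow> 0 \<le> W x y \<and> W x y \<le> 1"
    and \<eta>: "0 < \<eta>"
  shows "\<exists>(K :: nat list set) \<epsilon>. finite K \<and> 0 < \<epsilon> \<and>
    (\<forall>p N u. equipartition M p N \<longrightarrow> (\<forall>i j. 0 \<le> u i j \<and> u i j \<le> 1) \<longrightarrow>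
      (\<forall>A\<in>sets M. \<forall>B\<in>sets M.
        \<bar>\<integral>z. indicator A (fst z) * indicator B (snd z) * (u (p (fst z)) (p (snd z)) - W (fst z) (snd z)) \<partial>(M \<Otimes>\<^sub>M M)\<bar> \<le> \<epsilon>) \<longrightarrow>
      (\<exists>cls w. (\<forall>v<N. cls v \<in> K) \<and> (\<forall>a b. 0 \<le> w a b \<and> w a b \<le> 1) \<and>
        (\<integral>z. \<bar>W (fst z) (snd z) - w (cls (p (fst z))) (cls (p (snd z)))\<bar> \<partial>(M \<Otimes>\<^sub>M M)) \<le> \<eta>))"
proof -
  interpret MM: prob_space "M \<Otimes>\<^sub>M M" by (rule prob_space_pair_self)
  \<comment> \<open>Three errors are added at the end, each at most \<open>c\<close>: step
    approximation, averaging and rounding.\<close>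
  define c where "c = \<eta> / 4"
  have c: "0 < c" using \<eta> by (simp add: c_def)
  \<comment> \<open>The bound c^2/4 serves the L2 estimate, in which \<eta>1 counts twice and may
    use half of c^2; the bound \<open>c\<close> serves the final triangle inequality.\<close>
  define \<eta>1 where "\<eta>1 = min (c\<^sup>2 / 4) c"
  have \<eta>1: "0 < \<eta>1" "\<eta>1 \<le> c" "2 * \<eta>1 \<le> c\<^sup>2 / 2" using c by (auto simp: \<eta>1_def)
  have Wm[measurable]: "(\<lambda>z. W (fst z) (snd z)) \<in> borel_measurable (M \<Otimes>\<^sub>M M)"
    using W by (simp add: case_prod_beta')
  have "0 \<le> W (fst z) (snd z) \<and> W (fst z) (snd z) \<le> 1" if "z \<in> space (M \<Otimes>\<^sub>M M)" for z
    using that W01 by (auto simp: space_pair_measure)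
  then have "\<exists>(m::nat) \<tau> w. \<tau> \<in> M \<rightarrow>\<^sub>M count_space UNIV \<and> (\<forall>x\<in>space M. \<tau> x < m) \<and>
    (\<forall>i j. 0 \<le> w i j \<and> w i j \<le> 1) \<and>
    (\<integral>z. \<bar>W (fst z) (snd z) - w (\<tau> (fst z)) (\<tau> (snd z))\<bar> \<partial>(M \<Otimes>\<^sub>M M)) \<le> \<eta>1"
    by (intro step_approximation Wm \<eta>1(1))
  then obtain m \<tau> w where \<tau>1: "\<tau> \<in> M \<rightarrow>\<^sub>M count_space UNIV" "\<forall>x\<in>space M. \<tau> x < (m::nat)"
    and w1: "\<forall>i j. 0 \<le> w i j \<and> w i j \<le> (1::real)"
    and ap: "(\<integral>z. \<bar>W (fst z) (snd z) - w (\<tau> (fst z)) (\<tau> (snd z))\<bar> \<partial>(M \<Otimes>\<^sub>M M)) \<le> \<eta>1"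
    by (elim exE conjE)
  have \<tau>: "\<tau> \<in> M \<rightarrow>\<^sub>M count_space UNIV" "\<And>x. x \<in> space M \<Longrightarrow> \<tau> x < m"
    and w: "\<And>i j. 0 \<le> w i j \<and> w i j \<le> 1"
    using \<tau>1 w1 by simp_all
  \<comment> \<open>The other half of c^2 pays for 2 m^2 \<epsilon>; the \<open>+ 1\<close> keeps
    the denominator positive.\<close>
  define \<epsilon> where "\<epsilon> = c\<^sup>2 / (4 * ((real m)\<^sup>2 + 1))"
  have \<epsilon>: "0 < \<epsilon>" using c by (simp add: \<epsilon>_def add_nonneg_pos)
  have "(real m)\<^sup>2 / ((real m)\<^sup>2 + 1) \<le> 1" by (simp add: add_nonneg_pos)
  then have "(real m)\<^sup>2 / ((real m)\<^sup>2 + 1) * (c\<^sup>2 / 2) \<le> 1 * (c\<^sup>2 / 2)" by (intro mult_right_mono) auto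
  moreover have "2 * (real m)\<^sup>2 * \<epsilon> = (real m)\<^sup>2 / ((real m)\<^sup>2 + 1) * (c\<^sup>2 / 2)"
    unfolding \<epsilon>_def by (simp add: divide_simps add_nonneg_pos)
  ultimately have "2 * (real m)\<^sup>2 * \<epsilon> \<le> c\<^sup>2 / 2" by linarith
  then have cond: "2 * \<eta>1 + 2 * (real m)\<^sup>2 * \<epsilon> \<le> c\<^sup>2" using \<eta>1(3) by linarith
  obtain L :: nat where L: "2 * (real m)\<^sup>2 / c < L" using reals_Archimedean2 by blast
  have "0 \<le> 2 * (real m)\<^sup>2 / c" using c by simp
  then have L0: "0 < L" using L by linarith
  have L1: "2 * (real m)\<^sup>2 / L \<le> c" using L L0 c by (simp add: field_simps)
  show ?thesis
  proof (intro exI[of _ "{xs. set xs \<subseteq> {..L} \<and> length xs = m}"] exI[of _ \<epsilon>] conjI allI impI)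
    fix p :: "'a \<Rightarrow> nat" and N u
    assume "equipartition M p N" and u1: "\<forall>i j. 0 \<le> u i j \<and> u i j \<le> (1::real)"
      and cut1: "\<forall>A\<in>sets M. \<forall>B\<in>sets M.
      \<bar>\<integral>z. indicator A (fst z) * indicator B (snd z) * (u (p (fst z)) (p (snd z)) - W (fst z) (snd z)) \<partial>(M \<Otimes>\<^sub>M M)\<bar> \<le> \<epsilon>"
    have u: "0 \<le> u i j \<and> u i j \<le> 1" for i j using u1 by blast
    have cut: "\<bar>\<integral>z. indicator A (fst z) * indicator B (snd z) * (u (p (fst z)) (p (snd z)) - W (fst z) (snd z)) \<partial>(M \<Otimes>\<^sub>M M)\<bar> \<le> \<epsilon>"
      if "A \<in> sets M" "B \<in> sets M" for A B using cut1 that by blast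
    from \<open>equipartition M p N\<close>
    interpret equipartition M p N .
    have "\<exists>cls (w' :: nat list \<Rightarrow> nat list \<Rightarrow> real).
    (\<forall>v<N. cls v \<in> {xs. set xs \<subseteq> {..L} \<and> length xs = m}) \<and> (\<forall>a b. 0 \<le> w' a b \<and> w' a b \<le> 1) \<and>
    (\<forall>u<N. \<forall>v<N. \<bar>averaged \<tau> m w u v - w' (cls u) (cls v)\<bar> \<le> 2 * (real m)\<^sup>2 / L)"
      by (rule averaged_rounding) (use \<tau> w L0 in auto)
    then obtain cls w' where cw: "\<forall>v<N. cls v \<in> {xs. set xs \<subseteq> {..L} \<and> length xs = m}"
      "\<forall>a b. 0 \<le> w' a b \<and> w' a b \<le> (1::real)"
      "\<forall>u<N. \<forall>v<N. \<bar>averaged \<tau> m w u v - w' (cls u) (cls v)\<bar> \<le> 2 * (real m)\<^sup>2 / L"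
      by (elim exE conjE)
    let ?W = "\<lambda>z. W (fst z) (snd z)" and ?S = "\<lambda>z. w (\<tau> (fst z)) (\<tau> (snd z))"
    let ?A = "\<lambda>z. averaged \<tau> m w (p (fst z)) (p (snd z))"
    let ?C = "\<lambda>z. w' (cls (p (fst z))) (cls (p (snd z)))"
    have m[measurable]: "?S \<in> borel_measurable (M \<Otimes>\<^sub>M M)" "?A \<in> borel_measurable (M \<Otimes>\<^sub>M M)"
      "?C \<in> borel_measurable (M \<Otimes>\<^sub>M M)"
      using measurable_label_fun[OF \<tau>(1) \<tau>(1)] measurable_label_fun[OF p_measurable p_measurable, of "averaged \<tau> m w"]
        measurable_label_fun[OF p_measurable p_measurable, of "\<lambda>a b. w' (cls a) (cls b)"] by simp_all
    have r: "0 \<le> ?W z \<and> ?W z \<le> 1" "0 \<le> ?S z \<and> ?S z \<le> 1" "0 \<le> ?A z \<and> ?A z \<le> 1" "0 \<le> ?C z \<and> ?C z \<le> 1"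
      "\<bar>?A z - ?C z\<bar> \<le> c" if "z \<in> space (M \<Otimes>\<^sub>M M)" for z
    proof -
      have z: "fst z \<in> space M" "snd z \<in> space M" using that by (auto simp: space_pair_measure)
      then show "0 \<le> ?W z \<and> ?W z \<le> 1" "0 \<le> ?S z \<and> ?S z \<le> 1" "0 \<le> ?A z \<and> ?A z \<le> 1" "0 \<le> ?C z \<and> ?C z \<le> 1"
        using W01 w averaged_01[OF \<tau> w] p_less cw(2) by simp_all
      have "\<bar>?A z - ?C z\<bar> \<le> 2 * (real m)\<^sup>2 / L" using cw(3) p_less z by blast
      then show "\<bar>?A z - ?C z\<bar> \<le> c" using L1 by linarith
    qed
    have i: "integrable (M \<Otimes>\<^sub>M M) ?W" "integrable (M \<Otimes>\<^sub>M M) ?S" "integrable (M \<Otimes>\<^sub>M M) ?A" "integrable (M \<Otimes>\<^sub>M M) ?C"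
      using r by (intro MM.integrable_bounded_real[where B=1]; simp)+
    have "(\<integral>z. \<bar>?W z - ?C z\<bar> \<partial>(M \<Otimes>\<^sub>M M)) \<le> (\<integral>z. \<bar>?W z - ?S z\<bar> + \<bar>?S z - ?A z\<bar> + c \<partial>(M \<Otimes>\<^sub>M M))"
    proof (rule integral_mono)
      fix z assume "z \<in> space (M \<Otimes>\<^sub>M M)"
      then show "\<bar>?W z - ?C z\<bar> \<le> \<bar>?W z - ?S z\<bar> + \<bar>?S z - ?A z\<bar> + c" using r(5)[of z] by linarith
    qed (use i in auto)
    also have "\<dots> = (\<integral>z. \<bar>?W z - ?S z\<bar> \<partial>(M \<Otimes>\<^sub>M M)) + (\<integral>z. \<bar>?S z - ?A z\<bar> \<partial>(M \<Otimes>\<^sub>M M)) + c"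
      using i by (simp add: MM.prob_space)
    also have "\<dots> \<le> \<eta>1 + c + c"
    proof -
      have "(\<integral>z. \<bar>?S z - ?A z\<bar> \<partial>(M \<Otimes>\<^sub>M M)) \<le> c"
        by (rule averaged_L1[where W=W and u=u and \<epsilon>=\<epsilon> and \<eta>=\<eta>1]; (rule \<tau> w W W01 u cut ap c cond; assumption?))
      then show ?thesis using ap by linarith
    qed
    also have "\<dots> \<le> \<eta>" using \<eta>1 c by (simp add: c_def)
    finally show "\<exists>cls w. (\<forall>v<N. cls v \<in> {xs. set xs \<subseteq> {..L} \<and> length xs = m}) \<and> (\<forall>a b. 0 \<le> w a b \<and> w a b \<le> 1) \<and>
        (\<integral>z. \<bar>W (fst z) (snd z) - w (cls (p (fst z))) (cls (p (snd z)))\<bar> \<partial>(M \<Otimes>\<^sub>M M)) \<le> \<eta>"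
      using cw(1,2) by blast
  next
    show "finite {xs. set xs \<subseteq> {..L} \<and> length xs = m}" by (rule finite_lists_length_eq) simp
  qed (rule \<epsilon>)
qed

section \<open>Product spaces and the counting lemma\<close>

context prob_space
begin

abbreviation Pi_space :: "nat set \<Rightarrow> (nat \<Rightarrow> 'a) measure" where
  "Pi_space I \<equiv> PiM I (\<lambda>_. M)"

lemma prob_space_Pi_space: "prob_space (Pi_space I)"
  by (intro prob_space_PiM prob_space_axioms)

lemma product_sigma_finite_self: "product_sigma_finite (\<lambda>_::nat. M)"
  by (simp add: product_sigma_finite_def sigma_finite_measure_axioms)

text \<open>Measurability and the bound of the inner integral are recorded so that the lemma applies
  to its own output when a second coordinate is removed.\<close>

lemma integral_Pi_space_insert:
  fixes f :: "(nat \<Rightarrow> 'a) \<Rightarrow> real"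
    and B :: real
  assumes J: "finite J" "i \<notin> J"
    and f: "f \<in> borel_measurable (Pi_space (insert i J))"
    and bd: "\<And>x. x \<in> space (Pi_space (insert i J)) \<Longrightarrow> \<bar>f x\<bar> \<le> B"
  shows "(\<integral>x. f x \<partial>Pi_space (insert i J)) = (\<integral>y. \<integral>a. f (y(i := a)) \<partial>M \<partial>Pi_space J)"
    and "(\<lambda>y. \<integral>a. f (y(i := a)) \<partial>M) \<in> borel_measurable (Pi_space J)"
    and "\<And>y. y \<in> space (Pi_space J) \<Longrightarrow> \<bar>\<integral>a. f (y(i := a)) \<partial>M\<bar> \<le> B"
proof -
  interpret product_sigma_finite "\<lambda>_::nat. M" by (rule product_sigma_finite_self)
  interpret P: prob_space "Pi_space (insert i J)" by (rule prob_space_Pi_space)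
  show "(\<integral>x. f x \<partial>Pi_space (insert i J)) = (\<integral>y. \<integral>a. f (y(i := a)) \<partial>M \<partial>Pi_space J)"
    by (rule product_integral_insert[OF J]) (rule P.integrable_bounded_real[OF f bd])
  have "(\<lambda>(y, a). f (y(i := a))) \<in> borel_measurable (Pi_space J \<Otimes>\<^sub>M M)"
    using measurable_compose[OF measurable_add_dim[of i J "\<lambda>_. M"] f] by (simp add: case_prod_beta')
  then show "(\<lambda>y. \<integral>a. f (y(i := a)) \<partial>M) \<in> borel_measurable (Pi_space J)"
    by (rule borel_measurable_lebesgue_integral)
  fix y assume "y \<in> space (Pi_space J)"
  then show "\<bar>\<integral>a. f (y(i := a)) \<partial>M\<bar> \<le> B"
    by (intro abs_integral_le_bound bd) (auto simp: space_PiM PiE_iff extensional_def)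
qed

text \<open>Isolates two coordinates in one integral over the square, where cut-norm bounds are
  available while the other coordinates stay frozen.\<close>

lemma integral_Pi_space_two:
  fixes f :: "(nat \<Rightarrow> 'a) \<Rightarrow> real"
    and B :: real
  assumes J: "finite J" "i \<notin> J" "j \<notin> J" "i \<noteq> j"
    and f: "f \<in> borel_measurable (Pi_space (insert i (insert j J)))"
    and bd: "\<And>x. x \<in> space (Pi_space (insert i (insert j J))) \<Longrightarrow> \<bar>f x\<bar> \<le> B"
  shows "(\<integral>x. f x \<partial>Pi_space (insert i (insert j J))) =
      (\<integral>y. \<integral>z. f (y(j := snd z, i := fst z)) \<partial>(M \<Otimes>\<^sub>M M) \<partial>Pi_space J)"
proof -
  have *: "finite (insert j J)" "i \<notin> insert j J" using J by auto
  note A = integral_Pi_space_insert[OF * f bd]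
  have "(\<integral>x. f x \<partial>Pi_space (insert i (insert j J))) =
      (\<integral>y. \<integral>a. f (y(i := a)) \<partial>M \<partial>Pi_space (insert j J))"
    by (rule A(1))
  also have "\<dots> = (\<integral>y. \<integral>b. \<integral>a. f (y(j := b, i := a)) \<partial>M \<partial>M \<partial>Pi_space J)"
    by (rule integral_Pi_space_insert(1)[OF J(1) J(3) A(2) A(3)])
  also have "\<dots> = (\<integral>y. \<integral>z. f (y(j := snd z, i := fst z)) \<partial>(M \<Otimes>\<^sub>M M) \<partial>Pi_space J)"
  proof (intro Bochner_Integration.integral_cong refl)
    fix y assume y: "y \<in> space (Pi_space J)"
    have "(\<lambda>z. y(j := snd z)) \<in> M \<Otimes>\<^sub>M M \<rightarrow>\<^sub>M Pi_space (insert j J)"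
      using y by (intro measurable_fun_upd[where J=J]) auto
    then have "(\<lambda>z. y(j := snd z, i := fst z)) \<in> M \<Otimes>\<^sub>M M \<rightarrow>\<^sub>M Pi_space (insert i (insert j J))"
      by (rule measurable_fun_upd[rotated]) auto
    then have m: "(\<lambda>z. f (y(j := snd z, i := fst z))) \<in> borel_measurable (M \<Otimes>\<^sub>M M)"
      using f by (rule measurable_compose)
    have "\<bar>f (y(j := b, i := a))\<bar> \<le> B" if "a \<in> space M" "b \<in> space M" for a b
      using that y by (intro bd) (auto simp: space_PiM PiE_iff extensional_def)
    then show "(\<integral>b. \<integral>a. f (y(j := b, i := a)) \<partial>M \<partial>M) = (\<integral>z. f (y(j := snd z, i := fst z)) \<partial>(M \<Otimes>\<^sub>M M))"
      by (subst integral_pair_iterated(2)[OF m, of B]) auto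
  qed
  finally show ?thesis .
qed

lemma integral_Pi_space_marginal:
  fixes g :: "'a \<times> 'a \<Rightarrow> real"
    and B :: real
  assumes I: "finite I" "i \<in> I" "j \<in> I" "i \<noteq> j"
    and g[measurable]: "g \<in> borel_measurable (M \<Otimes>\<^sub>M M)"
    and bd: "\<And>a b. a \<in> space M \<Longrightarrow> b \<in> space M \<Longrightarrow> \<bar>g (a, b)\<bar> \<le> B"
  shows "(\<integral>x. g (x i, x j) \<partial>Pi_space I) = (\<integral>z. g z \<partial>(M \<Otimes>\<^sub>M M))"
proof -
  define J where "J = I - {i, j}"
  have J: "finite J" "i \<notin> J" "j \<notin> J" "i \<noteq> j" and IJ: "I = insert i (insert j J)"
    using I by (auto simp: J_def)
  interpret P: prob_space "Pi_space J" by (rule prob_space_Pi_space)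
  have m: "(\<lambda>x. g (x i, x j)) \<in> borel_measurable (Pi_space I)"
    using I by measurable
  have "(\<integral>x. g (x i, x j) \<partial>Pi_space I) = (\<integral>y. \<integral>z. g z \<partial>(M \<Otimes>\<^sub>M M) \<partial>Pi_space J)"
    using integral_Pi_space_two[OF J m[unfolded IJ], of B] bd J
    by (simp add: IJ[symmetric] space_PiM PiE_iff) (use I in \<open>auto simp: PiE_iff\<close>)
  then show ?thesis by (simp add: P.prob_space)
qed

lemma cut_bound_Pi_space:
  fixes V :: "'a \<Rightarrow> 'a \<Rightarrow> real" and \<Phi> \<Psi> :: "(nat \<Rightarrow> 'a) \<Rightarrow> real"
    and \<epsilon> :: real
  assumes I: "finite I" "i \<in> I" "j \<in> I" "i \<noteq> j"
    and V[measurable]: "case_prod V \<in> borel_measurable (M \<Otimes>\<^sub>M M)"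
    and bd: "\<And>x y. x \<in> space M \<Longrightarrow> y \<in> space M \<Longrightarrow> \<bar>V x y\<bar> \<le> 1"
    and cut: "\<And>A B. A \<in> sets M \<Longrightarrow> B \<in> sets M \<Longrightarrow>
      \<bar>\<integral>z. indicator A (fst z) * indicator B (snd z) * V (fst z) (snd z) \<partial>(M \<Otimes>\<^sub>M M)\<bar> \<le> \<epsilon>"
    and \<Phi>[measurable]: "\<Phi> \<in> borel_measurable (Pi_space I)"
    and \<Psi>[measurable]: "\<Psi> \<in> borel_measurable (Pi_space I)"
    and \<Phi>01: "\<And>x. x \<in> space (Pi_space I) \<Longrightarrow> 0 \<le> \<Phi> x \<and> \<Phi> x \<le> 1"
    and \<Psi>01: "\<And>x. x \<in> space (Pi_space I) \<Longrightarrow> 0 \<le> \<Psi> x \<and> \<Psi> x \<le> 1"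
    and \<Phi>j: "\<And>x b. \<Phi> (x(j := b)) = \<Phi> x"
    and \<Psi>i: "\<And>x a. \<Psi> (x(i := a)) = \<Psi> x"
  shows "\<bar>\<integral>x. \<Phi> x * \<Psi> x * V (x i) (x j) \<partial>Pi_space I\<bar> \<le> \<epsilon>"
proof -
  define J where "J = I - {i, j}"
  have J: "finite J" "i \<notin> J" "j \<notin> J" "i \<noteq> j" and IJ: "I = insert i (insert j J)"
    using I by (auto simp: J_def)
  interpret P: prob_space "Pi_space J" by (rule prob_space_Pi_space)
  \<comment> \<open>A filler for the coordinate on which \<Phi> or \<Psi> does not depend; it turns
    each of them into a function of one variable.\<close>
  obtain x0 where x0: "x0 \<in> space M" using not_empty by auto
  have V'[measurable]: "(\<lambda>x. V (x i) (x j)) \<in> borel_measurable (Pi_space I)"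
    using measurable_compose[of "\<lambda>x. (x i, x j)" "Pi_space I" _ "case_prod V", OF _ V] I by simp
  have m: "(\<lambda>x. \<Phi> x * \<Psi> x * V (x i) (x j)) \<in> borel_measurable (Pi_space I)" by measurable
  have b: "\<bar>\<Phi> x * \<Psi> x * V (x i) (x j)\<bar> \<le> 1" if x: "x \<in> space (Pi_space I)" for x
  proof -
    have "x i \<in> space M" "x j \<in> space M" using x I by (auto simp: space_PiM)
    then show ?thesis using \<Phi>01[OF x] \<Psi>01[OF x] bd[of "x i" "x j"]
      by (auto simp: abs_mult intro!: mult_le_one)
  qed
  have "(\<integral>x. \<Phi> x * \<Psi> x * V (x i) (x j) \<partial>Pi_space I) =
    (\<integral>y. \<integral>z. \<Phi> (y(j := x0, i := fst z)) * \<Psi> (y(j := snd z, i := x0)) * V (fst z) (snd z) \<partial>(M \<Otimes>\<^sub>M M) \<partial>Pi_space J)"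
  proof -
    have A: "\<Phi> (y(j := b, i := a)) = \<Phi> (y(j := x0, i := a))" for y a b
      using \<Phi>j[of "y(i := a)" b] \<Phi>j[of "y(i := a)" x0] J(4) by (simp add: fun_upd_twist)
    have B: "\<Psi> (y(j := b, i := a)) = \<Psi> (y(j := b, i := x0))" for y a b
      using \<Psi>i[of "y(j := b)" a] \<Psi>i[of "y(j := b)" x0] by simp
    have "(\<integral>x. \<Phi> x * \<Psi> x * V (x i) (x j) \<partial>Pi_space I) =
      (\<integral>y. \<integral>z. \<Phi> (y(j := snd z, i := fst z)) * \<Psi> (y(j := snd z, i := fst z)) * V (fst z) (snd z) \<partial>(M \<Otimes>\<^sub>M M) \<partial>Pi_space J)"
      using integral_Pi_space_two[OF J m[unfolded IJ] b[unfolded IJ]] J by (simp add: IJ[symmetric])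
    also have "\<dots> = (\<integral>y. \<integral>z. \<Phi> (y(j := x0, i := fst z)) * \<Psi> (y(j := snd z, i := x0)) * V (fst z) (snd z) \<partial>(M \<Otimes>\<^sub>M M) \<partial>Pi_space J)"
      by (intro Bochner_Integration.integral_cong refl arg_cong2[where f="(*)"] A B)
    finally show ?thesis .
  qed
  also have "\<bar>\<dots>\<bar> \<le> \<epsilon>"
  proof (rule P.abs_integral_le_bound)
    fix y assume y: "y \<in> space (Pi_space J)"
    have u1: "(\<lambda>a. y(j := x0)) \<in> M \<rightarrow>\<^sub>M Pi_space (insert j J)" "(\<lambda>b. y(j := b)) \<in> M \<rightarrow>\<^sub>M Pi_space (insert j J)"
      using y x0 by (intro measurable_fun_upd[where J=J]; simp)+
    have u2: "(\<lambda>a. y(j := x0, i := a)) \<in> M \<rightarrow>\<^sub>M Pi_space I" "(\<lambda>b. y(j := b, i := x0)) \<in> M \<rightarrow>\<^sub>M Pi_space I"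
      unfolding IJ using x0 by (intro measurable_fun_upd[OF _ u1(1)] measurable_fun_upd[OF _ u1(2)]; simp)+
    have sp: "y(j := b, i := a) \<in> space (Pi_space I)" if "a \<in> space M" "b \<in> space M" for a b
      using that y unfolding IJ by (auto simp: space_PiM PiE_iff extensional_def)
    show "\<bar>\<integral>z. \<Phi> (y(j := x0, i := fst z)) * \<Psi> (y(j := snd z, i := x0)) * V (fst z) (snd z) \<partial>(M \<Otimes>\<^sub>M M)\<bar> \<le> \<epsilon>"
      by (rule cut_bound_functions[OF V bd cut measurable_compose[OF u2(1) \<Phi>] measurable_compose[OF u2(2) \<Psi>]])
        (use \<Phi>01 \<Psi>01 sp x0 in auto)
  qed
  finally show ?thesis .
qed

lemma integral_Pi_space_rectangle:
  assumes "finite I" and [measurable]: "\<And>l. l \<in> I \<Longrightarrow> Q l \<in> sets M"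
  shows "(\<integral>x. (\<Prod>l\<in>I. indicator (Q l) (x l)) \<partial>Pi_space I) = (\<Prod>l\<in>I. prob (Q l))"
proof -
  interpret product_sigma_finite "\<lambda>_::nat. M" by (rule product_sigma_finite_self)
  have "(\<integral>x. (\<Prod>l\<in>I. indicator (Q l) (x l)) \<partial>Pi_space I) = (\<Prod>l\<in>I. \<integral>a. indicator (Q l) a \<partial>M :: real)"
    by (intro product_integral_prod assms(1) integrable_bounded_real[where B=1] borel_measurable_indicator assms(2)) auto
  also have "\<dots> = (\<Prod>l\<in>I. prob (Q l))"
    using assms by (intro prod.cong) (auto simp: sets.Int_space_eq2)
  finally show ?thesis .
qed

section \<open>Products over the edges of \<open>F\<close> and how they depend on the kernel\<close>

lemma Pi_space_component: "x \<in> space (Pi_space I) \<Longrightarrow> i \<in> I \<Longrightarrow> x i \<in> space M"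
  by (auto simp: space_PiM)

text \<open>Each edge has a kernel of its own, so that hybrid products, in which some edges carry
  the graph and others \<open>W\<close>, are covered.\<close>

definition edge_prod :: "(nat \<times> nat) set \<Rightarrow> (nat \<times> nat \<Rightarrow> 'a \<Rightarrow> 'a \<Rightarrow> real) \<Rightarrow> (nat \<Rightarrow> 'a) \<Rightarrow> real" where
  "edge_prod E Z x = (\<Prod>e\<in>E. Z e (x (fst e)) (x (snd e)))"

lemma edge_prod_measurable:
  assumes "finite E" "E \<subseteq> I \<times> I" and Z: "\<And>e. e \<in> E \<Longrightarrow> case_prod (Z e) \<in> borel_measurable (M \<Otimes>\<^sub>M M)"
  shows "edge_prod E Z \<in> borel_measurable (Pi_space I)"
  unfolding edge_prod_def
proof (rule borel_measurable_prod)
  fix e assume e: "e \<in> E"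
  then have "fst e \<in> I" "snd e \<in> I" using assms(2) by auto
  then have "(\<lambda>x. (x (fst e), x (snd e))) \<in> Pi_space I \<rightarrow>\<^sub>M M \<Otimes>\<^sub>M M" by measurable
  from measurable_compose[OF this Z[OF e]]
  show "(\<lambda>x. Z e (x (fst e)) (x (snd e))) \<in> borel_measurable (Pi_space I)" by simp
qed

lemma edge_prod_01:
  assumes "E \<subseteq> I \<times> I" "x \<in> space (Pi_space I)"
    and Z: "\<And>e a b. e \<in> E \<Longrightarrow> a \<in> space M \<Longrightarrow> b \<in> space M \<Longrightarrow> 0 \<le> Z e a b \<and> Z e a b \<le> 1"
  shows "0 \<le> edge_prod E Z x \<and> edge_prod E Z x \<le> 1"
proof -
  have "0 \<le> Z e (x (fst e)) (x (snd e)) \<and> Z e (x (fst e)) (x (snd e)) \<le> 1" if "e \<in> E" for e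
    using that assms(1,2) by (intro Z Pi_space_component[of x I]) auto
  then show ?thesis unfolding edge_prod_def by (auto intro: prod_nonneg prod_le_1)
qed

text \<open>The edges are switched from \<open>W\<close> to \<open>U\<close> one at a time, at a
  cost of \<epsilon> each. Edges have their smaller endpoint first, so \<open>(i, j)\<close> is the
  only one joining \<open>i\<close> and \<open>j\<close>: the other factors at \<open>i\<close> do
  not involve \<open>j\<close>, and the rest does not involve \<open>i\<close>. This is the product
  form that the cut norm can test. The sets \<open>Q\<close> permit counting inside a prescribed
  sub-box.\<close>

lemma counting_lemma:
  fixes U W :: "'a \<Rightarrow> 'a \<Rightarrow> real"
    and \<epsilon> :: real
  assumes E: "finite E" "E \<subseteq> {(i, j). i < j \<and> j < k}"
    and U: "case_prod U \<in> borel_measurable (M \<Otimes>\<^sub>M M)" and W: "case_prod W \<in> borel_measurable (M \<Otimes>\<^sub>M M)"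
    and U01: "\<And>x y. x \<in> space M \<Longrightarrow> y \<in> space M \<Longrightarrow> 0 \<le> U x y \<and> U x y \<le> 1"
    and W01: "\<And>x y. x \<in> space M \<Longrightarrow> y \<in> space M \<Longrightarrow> 0 \<le> W x y \<and> W x y \<le> 1"
    and cut: "\<And>A B. A \<in> sets M \<Longrightarrow> B \<in> sets M \<Longrightarrow>
      \<bar>\<integral>z. indicator A (fst z) * indicator B (snd z) * (U (fst z) (snd z) - W (fst z) (snd z)) \<partial>(M \<Otimes>\<^sub>M M)\<bar> \<le> \<epsilon>"
    and Q[measurable]: "\<And>l. Q l \<in> sets M"
  shows "\<bar>(\<integral>x. (\<Prod>l<k. indicator (Q l) (x l)) * edge_prod E (\<lambda>_. U) x \<partial>Pi_space {..<k}) -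
     (\<integral>x. (\<Prod>l<k. indicator (Q l) (x l)) * edge_prod E (\<lambda>_. W) x \<partial>Pi_space {..<k})\<bar> \<le> real (card E) * \<epsilon>"
proof -
  interpret P: prob_space "Pi_space {..<k}" by (rule prob_space_Pi_space)
  have EI: "E \<subseteq> {..<k} \<times> {..<k}" using E(2) by auto
  \<comment> \<open>The hybrid kernel: edges in \<open>S\<close> already carry \<open>U\<close>, the
    others still carry \<open>W\<close>.\<close>
  define Z where "Z S e = (if e \<in> S then U else W)" for S :: "(nat \<times> nat) set" and e
  have Zm: "case_prod (Z S e) \<in> borel_measurable (M \<Otimes>\<^sub>M M)" for S e using U W by (simp add: Z_def)
  have Z01: "0 \<le> Z S e a b \<and> Z S e a b \<le> 1" if "a \<in> space M" "b \<in> space M" for S e a b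
    using U01[OF that] W01[OF that] by (simp add: Z_def)
  define T where "T S x = (\<Prod>l<k. indicator (Q l) (x l)) * edge_prod E (Z S) x" for S and x :: "nat \<Rightarrow> 'a"
  have ind01: "0 \<le> (\<Prod>l\<in>L. indicator (Q l) (x l) :: real) \<and> (\<Prod>l\<in>L. indicator (Q l) (x l) :: real) \<le> 1"
    for L and x :: "nat \<Rightarrow> 'a" by (auto intro: prod_nonneg prod_le_1)
  have indm: "(\<lambda>x. \<Prod>l\<in>L. indicator (Q l) (x l) :: real) \<in> borel_measurable (Pi_space {..<k})" if "L \<subseteq> {..<k}" for L
    using that by (intro borel_measurable_prod measurable_compose[OF measurable_component_singleton]) auto
  have Ti: "integrable (Pi_space {..<k}) (T S)" for S
  proof (rule P.integrable_bounded_real[where B=1])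
    show "T S \<in> borel_measurable (Pi_space {..<k})"
      unfolding T_def by (intro borel_measurable_times indm edge_prod_measurable E EI Zm) auto
    fix x assume "x \<in> space (Pi_space {..<k})"
    then show "\<bar>T S x\<bar> \<le> 1"
      using ind01[of x "{..<k}"] edge_prod_01[OF EI, of x "Z S"] Z01
      unfolding T_def by (auto simp: abs_mult intro!: mult_le_one)
  qed
  have main: "\<bar>(\<integral>x. T S x \<partial>Pi_space {..<k}) - (\<integral>x. T {} x \<partial>Pi_space {..<k})\<bar> \<le> real (card S) * \<epsilon>"
    if "finite S" "S \<subseteq> E" for S
    using that
  proof (induction S rule: finite_induct)
    case (insert e S)
    obtain i j where e: "e = (i, j)" by force
    have ij: "i < j" "j < k" "(i, j) \<in> E" using insert E(2) e by auto
    define E1 where "E1 = {f \<in> E - {e}. fst f = i \<or> snd f = i}"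
    define E2 where "E2 = {f \<in> E - {e}. fst f \<noteq> i \<and> snd f \<noteq> i}"
    \<comment> \<open>\<Phi> collects all factors at \<open>i\<close> except the switched edge,
      \<Psi> all factors that avoid \<open>i\<close>, including those at \<open>j\<close>.\<close>
    define \<Phi> where "\<Phi> x = indicator (Q i) (x i) * edge_prod E1 (Z S) x" for x
    define \<Psi> where "\<Psi> x = (\<Prod>l\<in>{..<k} - {i}. indicator (Q l) (x l)) * edge_prod E2 (Z S) x" for x
    have split: "edge_prod E (Z R) x = Z R e (x i) (x j) * (edge_prod E1 (Z S) x * edge_prod E2 (Z S) x)"
      if R: "R \<in> {S, insert e S}" for R x
    proof -
      have "edge_prod E (Z R) x = Z R e (x i) (x j) * edge_prod (E - {e}) (Z R) x"
        unfolding edge_prod_def using E(1) ij(3) e by (subst prod.remove[of E e]) auto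
      also have "edge_prod (E - {e}) (Z R) x = edge_prod (E - {e}) (Z S) x"
        unfolding edge_prod_def using R by (intro prod.cong) (auto simp: Z_def)
      also have "E - {e} = E1 \<union> E2" by (auto simp: E1_def E2_def)
      also have "edge_prod (E1 \<union> E2) (Z S) x = edge_prod E1 (Z S) x * edge_prod E2 (Z S) x"
        unfolding edge_prod_def using E(1) by (intro prod.union_disjoint) (auto simp: E1_def E2_def)
      finally show ?thesis .
    qed
    have isplit: "(\<Prod>l<k. indicator (Q l) (x l) :: real) = indicator (Q i) (x i) * (\<Prod>l\<in>{..<k} - {i}. indicator (Q l) (x l))" for x
      using ij by (intro prod.remove) auto
    have diff: "T (insert e S) x - T S x = \<Phi> x * \<Psi> x * (U (x i) (x j) - W (x i) (x j))" for x
    proof -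
      have "Z (insert e S) e = U" "Z S e = W" using insert(2) by (auto simp: Z_def)
      then show ?thesis
        unfolding T_def \<Phi>_def \<Psi>_def isplit[of x] by (simp add: split algebra_simps)
    qed
    have E12: "E1 \<subseteq> {..<k} \<times> {..<k}" "E2 \<subseteq> {..<k} \<times> {..<k}" "finite E1" "finite E2"
      using EI E(1) by (auto simp: E1_def E2_def)
    have "(\<integral>x. T (insert e S) x \<partial>Pi_space {..<k}) - (\<integral>x. T S x \<partial>Pi_space {..<k}) =
      (\<integral>x. \<Phi> x * \<Psi> x * (U (x i) (x j) - W (x i) (x j)) \<partial>Pi_space {..<k})"
      using Ti by (simp add: diff flip: Bochner_Integration.integral_diff)
    moreover have "\<bar>\<integral>x. \<Phi> x * \<Psi> x * (U (x i) (x j) - W (x i) (x j)) \<partial>Pi_space {..<k}\<bar> \<le> \<epsilon>"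
    proof (rule cut_bound_Pi_space[where V = "\<lambda>a b. U a b - W a b"])
      show "(\<lambda>(a, b). U a b - W a b) \<in> borel_measurable (M \<Otimes>\<^sub>M M)"
        using borel_measurable_diff[OF U W] by (simp add: case_prod_beta')
      show "\<bar>U x y - W x y\<bar> \<le> 1" if "x \<in> space M" "y \<in> space M" for x y
        using U01[OF that] W01[OF that] by (auto simp: abs_le_iff)
      show "\<Phi> \<in> borel_measurable (Pi_space {..<k})"
        unfolding \<Phi>_def using indm[of "{i}"] ij
        by (intro borel_measurable_times edge_prod_measurable E12 Zm) auto
      show "\<Psi> \<in> borel_measurable (Pi_space {..<k})"
        unfolding \<Psi>_def by (intro borel_measurable_times edge_prod_measurable indm E12 Zm) auto
      show "0 \<le> \<Phi> x \<and> \<Phi> x \<le> 1" if "x \<in> space (Pi_space {..<k})" for x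
        using edge_prod_01[OF E12(1) that, of "Z S"] Z01 unfolding \<Phi>_def
        by (auto simp: indicator_def)
      show "0 \<le> \<Psi> x \<and> \<Psi> x \<le> 1" if "x \<in> space (Pi_space {..<k})" for x
        using edge_prod_01[OF E12(2) that, of "Z S"] Z01 ind01[of x "{..<k} - {i}"] unfolding \<Psi>_def
        by (auto intro!: mult_le_one)
      show "\<Phi> (x(j := b)) = \<Phi> x" for x b
      proof -
        have "fst f \<noteq> j \<and> snd f \<noteq> j" if "f \<in> E1" for f
          using that E(2) ij e by (cases f) (auto simp: E1_def)
        then show ?thesis unfolding \<Phi>_def edge_prod_def using ij by (auto intro!: prod.cong)
      qed
      show "\<Psi> (x(i := a)) = \<Psi> x" for x a
        unfolding \<Psi>_def edge_prod_def by (auto simp: E2_def intro!: prod.cong arg_cong2[where f="(*)"])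
    qed (use ij cut in auto)
    moreover have "\<bar>(\<integral>x. T S x \<partial>Pi_space {..<k}) - (\<integral>x. T {} x \<partial>Pi_space {..<k})\<bar> \<le> real (card S) * \<epsilon>"
      using insert by simp
    moreover have "real (card (insert e S)) * \<epsilon> = real (card S) * \<epsilon> + \<epsilon>"
      using insert(1,2) by (simp add: algebra_simps)
    ultimately show ?case by linarith
  qed simp
  have "edge_prod E (Z E) x = edge_prod E (\<lambda>_. U) x" "edge_prod E (Z {}) x = edge_prod E (\<lambda>_. W) x" for x
    by (auto simp: edge_prod_def Z_def intro!: prod.cong)
  then show ?thesis using main[OF E(1)] by (simp add: T_def)
qed

text \<open>L1 closeness allows a pointwise comparison: for factors in [0,1] the products differ by
  at most the sum of the differences of the factors. Each of these involves two distinct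
  coordinates, whose joint law is that of the square.\<close>

lemma integral_abs_edge_prod_diff:
  fixes U W :: "'a \<Rightarrow> 'a \<Rightarrow> real"
    and \<eta> :: real
  assumes E: "finite E" "E \<subseteq> {(i, j). i < j \<and> j < k}"
    and U: "case_prod U \<in> borel_measurable (M \<Otimes>\<^sub>M M)" and W: "case_prod W \<in> borel_measurable (M \<Otimes>\<^sub>M M)"
    and U01: "\<And>x y. x \<in> space M \<Longrightarrow> y \<in> space M \<Longrightarrow> 0 \<le> U x y \<and> U x y \<le> 1"
    and W01: "\<And>x y. x \<in> space M \<Longrightarrow> y \<in> space M \<Longrightarrow> 0 \<le> W x y \<and> W x y \<le> 1"
    and L1: "(\<integral>z. \<bar>U (fst z) (snd z) - W (fst z) (snd z)\<bar> \<partial>(M \<Otimes>\<^sub>M M)) \<le> \<eta>"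
  shows "(\<integral>x. \<bar>edge_prod E (\<lambda>_. U) x - edge_prod E (\<lambda>_. W) x\<bar> \<partial>Pi_space {..<k}) \<le> real (card E) * \<eta>"
proof -
  interpret P: prob_space "Pi_space {..<k}" by (rule prob_space_Pi_space)
  have EI: "E \<subseteq> {..<k} \<times> {..<k}" using E(2) by auto
  let ?D = "\<lambda>z. \<bar>U (fst z) (snd z) - W (fst z) (snd z)\<bar>"
  have Dm: "?D \<in> borel_measurable (M \<Otimes>\<^sub>M M)"
    using borel_measurable_diff[OF U W] by (simp add: case_prod_beta')
  have Db: "\<bar>?D (a, b)\<bar> \<le> 1" if "a \<in> space M" "b \<in> space M" for a b
    using U01[OF that] W01[OF that] by (auto simp: abs_le_iff)
  have sp: "x (fst e) \<in> space M" "x (snd e) \<in> space M" if "e \<in> E" "x \<in> space (Pi_space {..<k})" for e x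
    using that EI by (auto intro!: Pi_space_component[of x "{..<k}"])
  have Di: "integrable (Pi_space {..<k}) (\<lambda>x. ?D (x (fst e), x (snd e)))" if "e \<in> E" for e
  proof (rule P.integrable_bounded_real[where B=1])
    have "fst e \<in> {..<k}" "snd e \<in> {..<k}" using that EI by auto
    then have "(\<lambda>x. (x (fst e), x (snd e))) \<in> Pi_space {..<k} \<rightarrow>\<^sub>M M \<Otimes>\<^sub>M M" by measurable
    from measurable_compose[OF this Dm]
    show "(\<lambda>x. ?D (x (fst e), x (snd e))) \<in> borel_measurable (Pi_space {..<k})" by simp
  qed (use Db sp[OF that] in blast)
  have ei: "integrable (Pi_space {..<k}) (edge_prod E (\<lambda>_. Y))"
    if "case_prod Y \<in> borel_measurable (M \<Otimes>\<^sub>M M)" "\<And>x y. x \<in> space M \<Longrightarrow> y \<in> space M \<Longrightarrow> 0 \<le> Y x y \<and> Y x y \<le> 1" for Y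
    using edge_prod_01[OF EI, of _ "\<lambda>_. Y"] that
    by (intro P.integrable_bounded_real[where B=1] edge_prod_measurable E EI) (auto simp: abs_le_iff)
  have "(\<integral>x. \<bar>edge_prod E (\<lambda>_. U) x - edge_prod E (\<lambda>_. W) x\<bar> \<partial>Pi_space {..<k}) \<le>
    (\<integral>x. (\<Sum>e\<in>E. ?D (x (fst e), x (snd e))) \<partial>Pi_space {..<k})"
  proof (rule integral_mono)
    fix x assume x: "x \<in> space (Pi_space {..<k})"
    have "norm ((\<Prod>e\<in>E. U (x (fst e)) (x (snd e))) - (\<Prod>e\<in>E. W (x (fst e)) (x (snd e)))) \<le>
      (\<Sum>e\<in>E. norm (U (x (fst e)) (x (snd e)) - W (x (fst e)) (x (snd e))))"
      using sp x U01 W01 by (intro norm_prod_diff) auto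
    then show "\<bar>edge_prod E (\<lambda>_. U) x - edge_prod E (\<lambda>_. W) x\<bar> \<le> (\<Sum>e\<in>E. ?D (x (fst e), x (snd e)))"
      by (simp add: edge_prod_def)
  next
    show "integrable (Pi_space {..<k}) (\<lambda>x. \<bar>edge_prod E (\<lambda>_. U) x - edge_prod E (\<lambda>_. W) x\<bar>)"
      by (intro integrable_abs Bochner_Integration.integrable_diff ei U W U01 W01)
    show "integrable (Pi_space {..<k}) (\<lambda>x. \<Sum>e\<in>E. ?D (x (fst e), x (snd e)))"
      by (intro Bochner_Integration.integrable_sum Di)
  qed
  also have "\<dots> = (\<Sum>e\<in>E. \<integral>x. ?D (x (fst e), x (snd e)) \<partial>Pi_space {..<k})"
    by (rule Bochner_Integration.integral_sum) (rule Di)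
  also have "\<dots> \<le> (\<Sum>e\<in>E. \<eta> :: real)"
  proof (rule sum_mono)
    fix e assume e: "e \<in> E"
    have "(\<integral>x. ?D (x (fst e), x (snd e)) \<partial>Pi_space {..<k}) = (\<integral>z. ?D z \<partial>(M \<Otimes>\<^sub>M M))"
      using e E(2) by (intro integral_Pi_space_marginal[where B=1] Dm Db) auto
    then show "(\<integral>x. ?D (x (fst e), x (snd e)) \<partial>Pi_space {..<k}) \<le> \<eta>" using L1 by simp
  qed
  finally show ?thesis by simp
qed

text \<open>The degree condition is integrated over \<open>A\<close>, and Tonelli rejoins the
  coordinate \<open>l\<close> with the others. For a cell this becomes the capacity constraint on
  the demands; for the whole space it bounds \<open>k\<close> times the size of the tiling by
  1.\<close>

lemma tiling_integral_le:
  fixes t :: "(nat \<Rightarrow> 'a) \<Rightarrow> real"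
    and C :: real
  assumes t[measurable]: "t \<in> borel_measurable (Pi_space {..<k})"
    and t0: "\<And>x. x \<in> space (Pi_space {..<k}) \<Longrightarrow> 0 \<le> t x"
    and tb: "\<And>x. x \<in> space (Pi_space {..<k}) \<Longrightarrow> t x \<le> C"
    and deg: "\<And>x. x \<in> space M \<Longrightarrow>
      (\<Sum>l<k. \<integral>\<^sup>+ y. ennreal (t (y(l := x))) \<partial>Pi_space ({..<k} - {l})) \<le> 1"
    and A[measurable]: "A \<in> sets M"
  shows "(\<Sum>l<k. \<integral>x. indicator A (x l) * t x \<partial>Pi_space {..<k}) \<le> prob A"
proof -
  interpret product_sigma_finite "\<lambda>_::nat. M" by (rule product_sigma_finite_self)
  interpret P: prob_space "Pi_space {..<k}" by (rule prob_space_Pi_space)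
  have m: "(\<lambda>x. indicator A (x l) * t x) \<in> borel_measurable (Pi_space {..<k})" if "l < k" for l
    using that by (intro borel_measurable_times t measurable_compose[OF measurable_component_singleton]) auto
  have i: "integrable (Pi_space {..<k}) (\<lambda>x. indicator A (x l) * t x)" if "l < k" for l
    using t0 tb by (intro P.integrable_bounded_real[where B="\<bar>C\<bar>"] m that) (force simp: indicator_def)
  have nn: "ennreal (\<integral>x. indicator A (x l) * t x \<partial>Pi_space {..<k}) =
    (\<integral>\<^sup>+ a. indicator A a * (\<integral>\<^sup>+ y. ennreal (t (y(l := a))) \<partial>Pi_space ({..<k} - {l})) \<partial>M)" if l: "l < k" for l
  proof -
    have kl: "insert l ({..<k} - {l}) = {..<k}" using l by auto
    have me: "(\<lambda>x. ennreal (indicator A (x l) * t x)) \<in> borel_measurable (Pi_space {..<k})"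
      using m[OF l] by simp
    have "ennreal (\<integral>x. indicator A (x l) * t x \<partial>Pi_space {..<k}) =
      (\<integral>\<^sup>+ x. ennreal (indicator A (x l) * t x) \<partial>Pi_space {..<k})"
      using t0 by (intro nn_integral_eq_integral[symmetric] i l) auto
    also have "\<dots> = (\<integral>\<^sup>+ a. \<integral>\<^sup>+ y. ennreal (indicator A ((y(l := a)) l) * t (y(l := a))) \<partial>Pi_space ({..<k} - {l}) \<partial>M)"
      by (rule product_nn_integral_insert_rev[of "{..<k} - {l}" l, unfolded kl]) (use me in auto)
    also have "\<dots> = (\<integral>\<^sup>+ a. indicator A a * (\<integral>\<^sup>+ y. ennreal (t (y(l := a))) \<partial>Pi_space ({..<k} - {l})) \<partial>M)"
      by (intro nn_integral_cong) (auto simp: indicator_def)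
    finally show ?thesis .
  qed
  have tm: "(\<lambda>a. \<integral>\<^sup>+ y. ennreal (t (y(l := a))) \<partial>Pi_space ({..<k} - {l})) \<in> borel_measurable M" if l: "l < k" for l
  proof -
    interpret Q: prob_space "Pi_space ({..<k} - {l})" by (rule prob_space_Pi_space)
    have "(\<lambda>z. (snd z)(l := fst z)) \<in> M \<Otimes>\<^sub>M Pi_space ({..<k} - {l}) \<rightarrow>\<^sub>M Pi_space {..<k}"
      using l by (intro measurable_fun_upd[where J="{..<k} - {l}"]) auto
    from measurable_compose[OF this t]
    have [measurable]: "(\<lambda>(a, y). ennreal (t (y(l := a)))) \<in> borel_measurable (M \<Otimes>\<^sub>M Pi_space ({..<k} - {l}))"
      by (simp add: case_prod_beta')
    show ?thesis by (rule Q.borel_measurable_nn_integral) measurable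
  qed
  have "ennreal (\<Sum>l<k. \<integral>x. indicator A (x l) * t x \<partial>Pi_space {..<k}) =
    (\<Sum>l<k. ennreal (\<integral>x. indicator A (x l) * t x \<partial>Pi_space {..<k}))"
    using t0 by (intro sum_ennreal[symmetric] Bochner_Integration.integral_nonneg) auto
  also have "\<dots> = (\<integral>\<^sup>+ a. (\<Sum>l<k. indicator A a * (\<integral>\<^sup>+ y. ennreal (t (y(l := a))) \<partial>Pi_space ({..<k} - {l}))) \<partial>M)"
    using tm by (subst nn_integral_sum) (auto simp: nn)
  also have "\<dots> \<le> (\<integral>\<^sup>+ a. indicator A a \<partial>M)"
    using deg by (intro nn_integral_mono) (auto simp: indicator_def)
  also have "\<dots> = ennreal (prob A)" by (simp add: emeasure_eq_measure)
  finally show ?thesis by simp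
qed

end

section \<open>Greedy tilings\<close>

text \<open>\<open>Max\<close> is meaningful on a finite set only. Since \<open>k\<close> is at
  least 1, disjoint copies have distinct images of the vertex 0, so there are at most
  \<open>n\<close> of them.\<close>

lemma til_graph_geI:
  fixes f :: "nat \<Rightarrow> nat \<Rightarrow> nat"
  assumes "k \<ge> 1" and copies: "\<And>i. i < m \<Longrightarrow> is_copy k EF n EG (f i)"
    and disj: "\<And>i j. i < m \<Longrightarrow> j < m \<Longrightarrow> i \<noteq> j \<Longrightarrow> f i ` {..<k} \<inter> f j ` {..<k} = {}"
  shows "m \<le> til_graph k EF n EG"
proof -
  let ?T = "{m. \<exists>f :: nat \<Rightarrow> nat \<Rightarrow> nat.
      (\<forall>i<m. is_copy k EF n EG (f i)) \<and>
      (\<forall>i<m. \<forall>j<m. i \<noteq> j \<longrightarrow> f i ` {..<k} \<inter> f j ` {..<k} = {})}"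
  have "m \<le> n" if m: "m \<in> ?T" for m
  proof -
    obtain f :: "nat \<Rightarrow> nat \<Rightarrow> nat" where f: "\<forall>i<m. is_copy k EF n EG (f i)"
      "\<forall>i<m. \<forall>j<m. i \<noteq> j \<longrightarrow> f i ` {..<k} \<inter> f j ` {..<k} = {}"
      using m by auto
    have 0: "0 \<in> {..<k}" using assms(1) by simp
    have "inj_on (\<lambda>i. f i 0) {..<m}"
    proof (rule inj_onI, rule ccontr)
      fix i j assume "i \<in> {..<m}" "j \<in> {..<m}" and eq: "f i 0 = f j 0" and "i \<noteq> j"
      then have "f i ` {..<k} \<inter> f j ` {..<k} = {}" using f(2) by simp
      moreover have "f i 0 \<in> f i ` {..<k}" using 0 by (rule imageI)
      moreover have "f i 0 \<in> f j ` {..<k}" unfolding eq using 0 by (rule imageI)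
      ultimately show False by blast
    qed
    moreover have "(\<lambda>i. f i 0) ` {..<m} \<subseteq> {..<n}"
      using f(1) 0 unfolding is_copy_def by blast
    ultimately have "card {..<m} \<le> card {..<n}" by (intro card_inj_on_le) auto
    then show ?thesis by simp
  qed
  then have "finite ?T" by (intro finite_subset[of ?T "{..n}"]) auto
  moreover have "m \<in> ?T" using copies disj by blast
  ultimately show ?thesis unfolding til_graph_def by (rule Max_ge)
qed

text \<open>Each list entry requests a copy with prescribed classes. The last conjunct of the
  conclusion is the invariant: the used vertices of a class never outnumber the requests made for
  it, so if the total load respects the capacities, \<open>ext\<close> is applicable at every
  stage.\<close>

lemma greedy_embedding:
  fixes cls :: "nat \<Rightarrow> 'c" and bs :: "(nat \<Rightarrow> 'c) list" and cap :: "'c \<Rightarrow> real"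
  assumes ext: "\<And>S \<beta>. \<beta> \<in> set bs \<Longrightarrow> S \<subseteq> {..<n} \<Longrightarrow> (\<And>c. real (card {v \<in> S. cls v = c}) \<le> cap c) \<Longrightarrow>
      \<exists>g. is_copy k EF n EG g \<and> g ` {..<k} \<inter> S = {} \<and> (\<forall>l<k. cls (g l) = \<beta> l)"
    and load: "\<And>c. (\<Sum>\<beta>\<leftarrow>bs. real (card {l. l < k \<and> \<beta> l = c})) \<le> cap c"
  shows "\<exists>f. (\<forall>i<length bs. is_copy k EF n EG (f i)) \<and>
    (\<forall>i<length bs. \<forall>j<length bs. i \<noteq> j \<longrightarrow> f i ` {..<k} \<inter> f j ` {..<k} = {}) \<and>
    (\<forall>c. real (card {v \<in> (\<Union>i<length bs. f i ` {..<k}). cls v = c}) \<le> (\<Sum>\<beta>\<leftarrow>bs. real (card {l. l < k \<and> \<beta> l = c})))"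
  using assms
proof (induction bs)
  case (Cons \<beta> bs)
  have "(\<Sum>\<beta>\<leftarrow>bs. real (card {l. l < k \<and> \<beta> l = c})) \<le> cap c" for c
    using Cons.prems(2)[of c] by simp
  then have "\<exists>f. (\<forall>i<length bs. is_copy k EF n EG (f i)) \<and>
    (\<forall>i<length bs. \<forall>j<length bs. i \<noteq> j \<longrightarrow> f i ` {..<k} \<inter> f j ` {..<k} = {}) \<and>
    (\<forall>c. real (card {v \<in> (\<Union>i<length bs. f i ` {..<k}). cls v = c}) \<le> (\<Sum>\<beta>\<leftarrow>bs. real (card {l. l < k \<and> \<beta> l = c})))"
    by (intro Cons.IH Cons.prems(1)) auto
  then obtain f where f: "\<forall>i<length bs. is_copy k EF n EG (f i)"
    "\<forall>i<length bs. \<forall>j<length bs. i \<noteq> j \<longrightarrow> f i ` {..<k} \<inter> f j ` {..<k} = {}"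
    "\<forall>c. real (card {v \<in> (\<Union>i<length bs. f i ` {..<k}). cls v = c}) \<le> (\<Sum>\<beta>\<leftarrow>bs. real (card {l. l < k \<and> \<beta> l = c}))"
    by (elim exE conjE)
  define S where "S = (\<Union>i<length bs. f i ` {..<k})"
  have S: "S \<subseteq> {..<n}" using f(1) by (auto simp: S_def is_copy_def)
  have fS: "finite S" by (simp add: S_def)
  have S3: "real (card {v \<in> S. cls v = c}) \<le> (\<Sum>\<beta>\<leftarrow>bs. real (card {l. l < k \<and> \<beta> l = c}))" for c
    using f(3) unfolding S_def by (rule spec)
  have "real (card {v \<in> S. cls v = c}) \<le> cap c" for c
    using S3[of c] Cons.prems(2)[of c] by simp
  then obtain g where g: "is_copy k EF n EG g" "g ` {..<k} \<inter> S = {}" "\<forall>l<k. cls (g l) = \<beta> l"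
    using Cons.prems(1)[of \<beta> S, OF _ S] by fastforce
  let ?f = "f(length bs := g)"
  have U: "(\<Union>i<length (\<beta> # bs). ?f i ` {..<k}) = S \<union> g ` {..<k}"
  proof -
    have "(\<Union>i<length bs. ?f i ` {..<k}) = S" unfolding S_def by (intro SUP_cong) auto
    then show ?thesis by (simp add: lessThan_Suc Un_commute del: fun_upd_apply) simp
  qed
  show ?case
  proof (intro exI[of _ ?f] conjI allI impI)
    fix i assume "i < length (\<beta> # bs)"
    then show "is_copy k EF n EG (?f i)" using f(1) g(1) by (auto simp: less_Suc_eq)
  next
    fix i j assume ij: "i < length (\<beta> # bs)" "j < length (\<beta> # bs)" "i \<noteq> j"
    have "f i ` {..<k} \<inter> g ` {..<k} = {}" if "i < length bs" for i
      using that g(2) unfolding S_def by blast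
    then show "?f i ` {..<k} \<inter> ?f j ` {..<k} = {}"
      using f(2) ij by (auto simp: less_Suc_eq simp del: Int_iff) blast+
  next
    fix c
    have "{v \<in> S \<union> g ` {..<k}. cls v = c} = {v \<in> S. cls v = c} \<union> g ` {l. l < k \<and> \<beta> l = c}"
      using g(3) by auto
    then have "card {v \<in> S \<union> g ` {..<k}. cls v = c} \<le> card {v \<in> S. cls v = c} + card (g ` {l. l < k \<and> \<beta> l = c})"
      by (simp add: card_Un_le)
    also have "\<dots> \<le> card {v \<in> S. cls v = c} + card {l. l < k \<and> \<beta> l = c}"
      by (intro add_left_mono card_image_le) auto
    finally show "real (card {v \<in> (\<Union>i<length (\<beta> # bs). ?f i ` {..<k}). cls v = c})
      \<le> (\<Sum>\<beta>\<leftarrow>\<beta> # bs. real (card {l. l < k \<and> \<beta> l = c}))"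
      unfolding U using S3[of c] by simp
  qed
qed auto

lemma sum_list_concat_replicate:
  fixes g :: "'b \<Rightarrow> real"
  assumes "distinct gs"
  shows "(\<Sum>\<beta>\<leftarrow>concat (map (\<lambda>\<beta>. replicate (m \<beta>) \<beta>) gs). g \<beta>) = (\<Sum>\<beta>\<in>set gs. real (m \<beta>) * g \<beta>)"
  using assms by (induction gs) (auto simp: sum_list_replicate)

section \<open>Boxes: products of vertex classes\<close>

locale classified_partition = equipartition +
  fixes cls :: "nat \<Rightarrow> 'c" and K :: "'c set" and k :: nat
  assumes finite_K: "finite K" and cls_in: "\<And>v. v < N \<Longrightarrow> cls v \<in> K"
begin

definition cell :: "'c \<Rightarrow> 'a set" where
  "cell c = {x \<in> space M. cls (p x) = c}"

definition box_indicator :: "(nat \<Rightarrow> 'c) \<Rightarrow> (nat \<Rightarrow> 'a) \<Rightarrow> real" where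
  "box_indicator \<beta> x = (\<Prod>l<k. indicator (cell (\<beta> l)) (x l))"

text \<open>Restriction to \<open>{..<k}\<close> makes the value extensional, hence an element of
  the finite set \<open>boxes\<close>.\<close>

definition box_of :: "(nat \<Rightarrow> 'a) \<Rightarrow> nat \<Rightarrow> 'c" where
  "box_of x = (\<lambda>l\<in>{..<k}. cls (p (x l)))"

abbreviation boxes :: "(nat \<Rightarrow> 'c) set" where
  "boxes \<equiv> PiE {..<k} (\<lambda>_. K)"

lemma finite_boxes: "finite boxes"
  by (intro finite_PiE finite_K) auto

lemma label_sets[measurable]: "{x \<in> space M. P (p x)} \<in> sets M"
  by measurable

lemma cell_sets[measurable]: "cell c \<in> sets M"
  unfolding cell_def by (rule label_sets)

lemma prob_label:
  assumes "A \<subseteq> {..<N}"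
  shows "prob {x \<in> space M. p x \<in> A} = card A / N"
proof -
  have "prob {x \<in> space M. p x \<in> A} = prob (\<Union>v\<in>A. {x \<in> space M. p x = v})"
    by (intro arg_cong[where f=prob]) auto
  also have "\<dots> = (\<Sum>v\<in>A. prob {x \<in> space M. p x = v})"
    using assms by (intro finite_measure_finite_Union) (auto simp: disjoint_family_on_def intro: finite_subset)
  also have "\<dots> = (\<Sum>v\<in>A. 1 / N)"
    using assms by (intro sum.cong prob_fibre) auto
  finally show ?thesis by simp
qed

lemma box_of_in: "x \<in> space (Pi_space {..<k}) \<Longrightarrow> box_of x \<in> boxes"
  using cls_in p_less by (auto simp: box_of_def space_PiM)

lemma box_indicator_eq:
  assumes x: "x \<in> space (Pi_space {..<k})" and "\<beta> \<in> boxes"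
  shows "box_indicator \<beta> x = (if \<beta> = box_of x then 1 else 0)"
proof (cases "\<forall>l<k. cls (p (x l)) = \<beta> l")
  case True
  then have "\<beta> = box_of x" using assms(2) by (auto simp: box_of_def PiE_def extensional_def fun_eq_iff)
  moreover have "box_indicator \<beta> x = 1"
    using True Pi_space_component[OF x] by (auto simp: box_indicator_def cell_def indicator_def)
  ultimately show ?thesis by simp
next
  case False
  then obtain l where "l < k" "cls (p (x l)) \<noteq> \<beta> l" by auto
  then have "\<beta> \<noteq> box_of x" "box_indicator \<beta> x = 0"
    by (auto simp: box_of_def box_indicator_def cell_def indicator_def)
  then show ?thesis by simp
qed

lemma box_indicator_01: "0 \<le> box_indicator \<beta> x \<and> box_indicator \<beta> x \<le> 1"
  unfolding box_indicator_def by (auto intro: prod_nonneg prod_le_1)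

lemma box_indicator_measurable[measurable]: "box_indicator \<beta> \<in> borel_measurable (Pi_space {..<k})"
  unfolding box_indicator_def[abs_def]
  by (intro borel_measurable_prod measurable_compose[OF measurable_component_singleton]) auto

lemma integral_box_indicator: "(\<integral>x. box_indicator \<beta> x \<partial>Pi_space {..<k}) = (\<Prod>l<k. prob (cell (\<beta> l)))"
  unfolding box_indicator_def by (rule integral_Pi_space_rectangle) auto

lemma integrable_box:
  fixes f :: "(nat \<Rightarrow> 'a) \<Rightarrow> real" and B :: real
  assumes [measurable]: "f \<in> borel_measurable (Pi_space {..<k})"
    and f: "\<And>x. x \<in> space (Pi_space {..<k}) \<Longrightarrow> \<bar>f x\<bar> \<le> B"
  shows "integrable (Pi_space {..<k}) (\<lambda>x. box_indicator \<beta> x * f x)"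
proof (rule prob_space.integrable_bounded_real[OF prob_space_Pi_space, where B=B])
  fix x assume x: "x \<in> space (Pi_space {..<k})"
  have "\<bar>box_indicator \<beta> x * f x\<bar> = box_indicator \<beta> x * \<bar>f x\<bar>" using box_indicator_01 by (simp add: abs_mult)
  also have "\<dots> \<le> 1 * B" using box_indicator_01 f[OF x] by (intro mult_mono) auto
  finally show "\<bar>box_indicator \<beta> x * f x\<bar> \<le> B" by simp
qed measurable

text \<open>Every point lies in exactly one box. The weight \<phi> will be 1 to obtain total masses,
  and the multiplicity of a class in the box to obtain degrees.\<close>

lemma sum_boxes:
  fixes f :: "(nat \<Rightarrow> 'a) \<Rightarrow> real" and \<phi> :: "(nat \<Rightarrow> 'c) \<Rightarrow> real"
    and B :: real
  assumes f[measurable]: "f \<in> borel_measurable (Pi_space {..<k})"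
    and fb: "\<And>x. x \<in> space (Pi_space {..<k}) \<Longrightarrow> \<bar>f x\<bar> \<le> B"
  shows "(\<Sum>\<beta>\<in>boxes. (\<integral>x. box_indicator \<beta> x * f x \<partial>Pi_space {..<k}) * \<phi> \<beta>) =
    (\<integral>x. \<phi> (box_of x) * f x \<partial>Pi_space {..<k})"
proof -
  have "(\<Sum>\<beta>\<in>boxes. (\<integral>x. box_indicator \<beta> x * f x \<partial>Pi_space {..<k}) * \<phi> \<beta>) =
    (\<integral>x. (\<Sum>\<beta>\<in>boxes. box_indicator \<beta> x * f x * \<phi> \<beta>) \<partial>Pi_space {..<k})"
    using integrable_box[OF f fb] by (subst Bochner_Integration.integral_sum) auto
  also have "\<dots> = (\<integral>x. \<phi> (box_of x) * f x \<partial>Pi_space {..<k})"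
  proof (intro Bochner_Integration.integral_cong refl)
    fix x assume x: "x \<in> space (Pi_space {..<k})"
    have "(\<Sum>\<beta>\<in>boxes. box_indicator \<beta> x * f x * \<phi> \<beta>) = (\<Sum>\<beta>\<in>boxes. if \<beta> = box_of x then \<phi> (box_of x) * f x else 0)"
      using x by (intro sum.cong) (auto simp: box_indicator_eq)
    also have "\<dots> = \<phi> (box_of x) * f x" using finite_boxes box_of_in[OF x] by (simp add: sum.delta)
    finally show "(\<Sum>\<beta>\<in>boxes. box_indicator \<beta> x * f x * \<phi> \<beta>) = \<phi> (box_of x) * f x" .
  qed
  finally show ?thesis .
qed

text \<open>There are \<open>N\<close> pairs of equal vertices, each of probability 1/N^2.\<close>

lemma prob_same_fibre:
  "(\<integral>z. indicator {z. p (fst z) = p (snd z)} z \<partial>(M \<Otimes>\<^sub>M M)) = 1 / real N"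
proof -
  have "(\<integral>z. indicator {z. p (fst z) = p (snd z)} z \<partial>(M \<Otimes>\<^sub>M M)) =
    (\<integral>z. (\<lambda>a b. of_bool (a = b)) (p (fst z)) (p (snd z)) \<partial>(M \<Otimes>\<^sub>M M) :: real)"
    by (intro Bochner_Integration.integral_cong) (auto simp: indicator_def)
  also have "\<dots> = (\<Sum>a<N. \<Sum>b<N. of_bool (a = b) * (prob {x \<in> space M. p x = a} * prob {x \<in> space M. p x = b}))"
    by (rule integral_label_pair[OF p_measurable]) (auto simp: p_less)
  also have "\<dots> = (\<Sum>a<N. \<Sum>b<N. if a = b then (1 / N) * (1 / N) else 0)"
    by (intro sum.cong refl) (auto simp: prob_fibre)
  also have "\<dots> = 1 / N" using N_pos by simp
  finally show ?thesis .
qed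

text \<open>Removing \<open>S\<close> leaves at least a proportion \<open>\<alpha>\<close> of each cell. Since the error in the box is
  small relative to the measure of the box, the sub-box that is left still has positive \<open>F\<close>-density
  in \<open>W\<close>, hence in the graph; the term \<open>k\<^sup>2 / N\<close> accounts for degenerate (non-injective) copies.\<close>

lemma box_extension:
  fixes W :: "'a \<Rightarrow> 'a \<Rightarrow> real" and w :: "'c \<Rightarrow> 'c \<Rightarrow> real"
    and \<alpha> \<delta> \<epsilon> \<rho> :: real
  assumes EF: "fin_graph k EF" and EG: "fin_graph N EG"
    and E_def: "E = {(i, j). i < j \<and> j < k \<and> EF i j}"
    and W: "case_prod W \<in> borel_measurable (M \<Otimes>\<^sub>M M)"
    and W01: "\<And>x y. x \<in> space M \<Longrightarrow> y \<in> space M \<Longrightarrow> 0 \<le> W x y \<and> W x y \<le> 1"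
    and w01: "\<And>a b. 0 \<le> w a b \<and> w a b \<le> 1"
    and cut: "\<And>A B. A \<in> sets M \<Longrightarrow> B \<in> sets M \<Longrightarrow>
      \<bar>\<integral>z. indicator A (fst z) * indicator B (snd z) * (of_bool (EG (p (fst z)) (p (snd z))) - W (fst z) (snd z)) \<partial>(M \<Otimes>\<^sub>M M)\<bar> \<le> \<epsilon>"
    and \<beta>1: "\<delta> / 2 \<le> (\<Prod>e\<in>E. w (\<beta> (fst e)) (\<beta> (snd e)))"
    and \<beta>2: "(\<integral>x. box_indicator \<beta> x * \<bar>edge_prod E (\<lambda>_. W) x - edge_prod E (\<lambda>_ a b. w (cls (p a)) (cls (p b))) x\<bar> \<partial>Pi_space {..<k})
      \<le> (\<delta> * \<alpha> ^ k / 4) * (\<Prod>l<k. prob (cell (\<beta> l)))"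
    and \<beta>3: "\<And>l. l < k \<Longrightarrow> \<rho> \<le> prob (cell (\<beta> l))"
    and pos: "0 < \<delta>" "0 < \<alpha>" "0 < \<rho>"
    and small: "real (card E) * \<epsilon> + (real k)\<^sup>2 / N < \<delta> * \<alpha> ^ k / 4 * \<rho> ^ k"
    and S: "S \<subseteq> {..<N}" "\<And>c. real (card {v \<in> S. cls v = c}) \<le> (1 - \<alpha>) * N * prob (cell c)"
  shows "\<exists>g. is_copy k EF N EG g \<and> g ` {..<k} \<inter> S = {} \<and> (\<forall>l<k. cls (g l) = \<beta> l)"
proof -
  interpret P: prob_space "Pi_space {..<k}" by (rule prob_space_Pi_space)
  define H where "H = edge_prod E (\<lambda>_. W)"
  define H2 where "H2 = edge_prod E (\<lambda>_ a b. w (cls (p a)) (cls (p b)))"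
  define U where "U a b = (of_bool (EG (p a) (p b)) :: real)" for a b
  define HU where "HU = edge_prod E (\<lambda>_. U)"
  define Q where "Q l = {x \<in> space M. p x \<notin> S \<and> cls (p x) = \<beta> l}" for l
  define R where "R x = (\<Prod>l<k. indicator (Q l) (x l) :: real)" for x
  have E: "finite E" "E \<subseteq> {(i, j). i < j \<and> j < k}" "E \<subseteq> {..<k} \<times> {..<k}"
    unfolding E_def by (auto intro: finite_subset[of _ "{..<k} \<times> {..<k}"])
  have Qm[measurable]: "Q l \<in> sets M" for l unfolding Q_def by measurable
  have Um: "case_prod U \<in> borel_measurable (M \<Otimes>\<^sub>M M)"
    using measurable_label_fun[OF p_measurable p_measurable, of "\<lambda>a b. of_bool (EG a b)"]
    by (simp add: U_def case_prod_beta')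
  have wm: "(\<lambda>(a, b). w (cls (p a)) (cls (p b))) \<in> borel_measurable (M \<Otimes>\<^sub>M M)"
    using measurable_label_fun[OF p_measurable p_measurable, of "\<lambda>a b. w (cls a) (cls b)"]
    by (simp add: case_prod_beta')
  have Hm[measurable]: "H \<in> borel_measurable (Pi_space {..<k})" "H2 \<in> borel_measurable (Pi_space {..<k})"
    "HU \<in> borel_measurable (Pi_space {..<k})"
    unfolding H_def H2_def HU_def by (intro edge_prod_measurable E W Um wm)+
  have H01: "0 \<le> H x \<and> H x \<le> 1" "0 \<le> H2 x \<and> H2 x \<le> 1" "0 \<le> HU x \<and> HU x \<le> 1"
    if "x \<in> space (Pi_space {..<k})" for x
    unfolding H_def H2_def HU_def using E(3) that by (intro edge_prod_01; use W01 w01 in \<open>simp add: U_def\<close>)+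
  have Rm[measurable]: "R \<in> borel_measurable (Pi_space {..<k})"
    unfolding R_def[abs_def] by (intro borel_measurable_prod measurable_compose[OF measurable_component_singleton]) auto
  have R01: "0 \<le> R x \<and> R x \<le> 1" for x unfolding R_def by (auto intro: prod_nonneg prod_le_1)
  have Ri: "integrable (Pi_space {..<k}) (\<lambda>x. R x * f x)"
    if [measurable]: "f \<in> borel_measurable (Pi_space {..<k})" and f: "\<And>x. x \<in> space (Pi_space {..<k}) \<Longrightarrow> \<bar>f x\<bar> \<le> 1" for f
    using R01 f by (intro P.integrable_bounded_real[where B=1]) (auto simp: abs_mult intro: mult_le_one)
  have RQ: "R x \<le> box_indicator \<beta> x" for x
    unfolding R_def box_indicator_def by (intro prod_mono) (auto simp: Q_def cell_def indicator_def)
  have R1: "R x = 0 \<or> (\<forall>l<k. x l \<in> Q l)" for x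
    by (auto simp: R_def indicator_def)
  \<comment> \<open>On the sub-box all classes are those of \<beta>, so the step product is constant
    there.\<close>
  have RH2: "R x * H2 x = R x * (\<Prod>e\<in>E. w (\<beta> (fst e)) (\<beta> (snd e)))" for x
  proof (cases "R x = 0")
    case False
    then have "x l \<in> Q l" if "l < k" for l using R1[of x] that by auto
    then have "cls (p (x l)) = \<beta> l" if "l < k" for l using that by (auto simp: Q_def)
    then have "H2 x = (\<Prod>e\<in>E. w (\<beta> (fst e)) (\<beta> (snd e)))"
      unfolding H2_def edge_prod_def using E(3) by (intro prod.cong) auto
    then show ?thesis by simp
  qed simp
  have probQ: "\<alpha> * prob (cell (\<beta> l)) \<le> prob (Q l)" for l
  proof -
    have "prob (cell (\<beta> l)) \<le> prob (Q l \<union> {x \<in> space M. p x \<in> {v \<in> S. cls v = \<beta> l}})"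
      by (intro finite_measure_mono) (auto simp: cell_def Q_def)
    also have "\<dots> \<le> prob (Q l) + prob {x \<in> space M. p x \<in> {v \<in> S. cls v = \<beta> l}}"
      by (intro measure_Un_le) auto
    also have "prob {x \<in> space M. p x \<in> {v \<in> S. cls v = \<beta> l}} = card {v \<in> S. cls v = \<beta> l} / N"
      using S(1) by (intro prob_label) auto
    also have "\<dots> \<le> ((1 - \<alpha>) * N * prob (cell (\<beta> l))) / N"
      using S(2) by (intro divide_right_mono) auto
    finally have "prob (cell (\<beta> l)) \<le> prob (Q l) + (1 - \<alpha>) * prob (cell (\<beta> l))" using N_pos by simp
    then show ?thesis by (simp add: algebra_simps)
  qed
  let ?\<mu> = "\<Prod>l<k. prob (cell (\<beta> l))" and ?h = "\<Prod>e\<in>E. w (\<beta> (fst e)) (\<beta> (snd e))"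
  have \<mu>: "\<rho> ^ k \<le> ?\<mu>"
    using prod_mono[of "{..<k}" "\<lambda>_. \<rho>" "\<lambda>l. prob (cell (\<beta> l))"] \<beta>3 pos by auto
  have "\<alpha> ^ k * ?\<mu> = (\<Prod>l<k. \<alpha> * prob (cell (\<beta> l)))" by (simp add: prod.distrib)
  also have "\<dots> \<le> (\<Prod>l<k. prob (Q l))" using probQ pos by (intro prod_mono) auto
  also have "\<dots> = (\<integral>x. R x \<partial>Pi_space {..<k})"
    unfolding R_def by (rule integral_Pi_space_rectangle[symmetric]) auto
  finally have muR: "\<alpha> ^ k * ?\<mu> \<le> (\<integral>x. R x \<partial>Pi_space {..<k})" .
  have "\<delta> / 2 * (\<alpha> ^ k * ?\<mu>) \<le> ?h * (\<integral>x. R x \<partial>Pi_space {..<k})"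
    using \<beta>1 muR pos w01 by (intro mult_mono mult_nonneg_nonneg prod_nonneg) auto
  also have "\<dots> = (\<integral>x. R x * H2 x \<partial>Pi_space {..<k})"
    unfolding RH2 by simp
  \<comment> \<open>The error on the sub-box is at most that on the whole box. By the second
    hypothesis on \<beta> the latter consumes at most half of the main term.\<close>
  also have "\<dots> \<le> (\<integral>x. R x * H x + box_indicator \<beta> x * \<bar>H x - H2 x\<bar> \<partial>Pi_space {..<k})"
  proof (rule integral_mono)
    have HH: "\<bar>\<bar>H x - H2 x\<bar>\<bar> \<le> 1" if "x \<in> space (Pi_space {..<k})" for x using H01[OF that] by auto
    show "integrable (Pi_space {..<k}) (\<lambda>x. R x * H2 x)" using H01 by (intro Ri) auto
    have "integrable (Pi_space {..<k}) (\<lambda>x. R x * H x)" using H01 by (intro Ri) auto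
    moreover have "integrable (Pi_space {..<k}) (\<lambda>x. box_indicator \<beta> x * \<bar>H x - H2 x\<bar>)"
      by (rule integrable_box[OF _ HH]) measurable
    ultimately show "integrable (Pi_space {..<k}) (\<lambda>x. R x * H x + box_indicator \<beta> x * \<bar>H x - H2 x\<bar>)" by simp
    fix x
    have "R x * (H2 x - H x) \<le> R x * \<bar>H x - H2 x\<bar>" using R01 by (intro mult_left_mono) auto
    also have "\<dots> \<le> box_indicator \<beta> x * \<bar>H x - H2 x\<bar>" using RQ by (intro mult_right_mono) auto
    finally show "R x * H2 x \<le> R x * H x + box_indicator \<beta> x * \<bar>H x - H2 x\<bar>" by (simp add: algebra_simps)
  qed
  also have "\<dots> = (\<integral>x. R x * H x \<partial>Pi_space {..<k}) + (\<integral>x. box_indicator \<beta> x * \<bar>H x - H2 x\<bar> \<partial>Pi_space {..<k})"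
  proof (rule Bochner_Integration.integral_add)
    show "integrable (Pi_space {..<k}) (\<lambda>x. R x * H x)" using H01 by (intro Ri) auto
    have HH: "\<bar>\<bar>H x - H2 x\<bar>\<bar> \<le> 1" if "x \<in> space (Pi_space {..<k})" for x using H01[OF that] by auto
    show "integrable (Pi_space {..<k}) (\<lambda>x. box_indicator \<beta> x * \<bar>H x - H2 x\<bar>)"
      by (rule integrable_box[OF _ HH]) measurable
  qed
  also have "\<dots> \<le> (\<integral>x. R x * H x \<partial>Pi_space {..<k}) + (\<delta> * \<alpha> ^ k / 4) * ?\<mu>"
    using \<beta>2 by (simp add: H_def H2_def)
  finally have "\<delta> * \<alpha> ^ k / 4 * ?\<mu> \<le> (\<integral>x. R x * H x \<partial>Pi_space {..<k})" by (simp add: algebra_simps)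
  moreover have "\<delta> * \<alpha> ^ k / 4 * \<rho> ^ k \<le> \<delta> * \<alpha> ^ k / 4 * ?\<mu>"
    using \<mu> pos by (intro mult_left_mono) auto
  moreover have "\<bar>(\<integral>x. R x * HU x \<partial>Pi_space {..<k}) - (\<integral>x. R x * H x \<partial>Pi_space {..<k})\<bar> \<le> real (card E) * \<epsilon>"
    unfolding R_def HU_def H_def
    by (rule counting_lemma[OF E(1,2) Um W]) (use W01 cut in \<open>auto simp: U_def\<close>)
  ultimately have big: "(real k)\<^sup>2 / N < (\<integral>x. R x * HU x \<partial>Pi_space {..<k})" using small by linarith
  \<comment> \<open>If every point with nonzero integrand were non-injective, the integrand would be
    dominated by the number of pairs of coordinates lying in a common part, and the mean of that
    number is at most k^2/N.\<close>
  have "\<exists>x. x \<in> space (Pi_space {..<k}) \<and> R x \<noteq> 0 \<and> HU x \<noteq> 0 \<and> inj_on (\<lambda>l. p (x l)) {..<k}"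
  proof (rule ccontr)
    assume none: "\<not> ?thesis"
    define D where "D = {(i, j). i < k \<and> j < k \<and> i < (j::nat)}"
    have Dsub: "D \<subseteq> {..<k} \<times> {..<k}" by (auto simp: D_def)
    then have fD: "finite D" by (rule finite_subset) simp
    have "card D \<le> card ({..<k} \<times> {..<k})" by (intro card_mono Dsub) simp
    then have cD: "real (card D) \<le> (real k)\<^sup>2" by (simp add: power2_eq_square flip: of_nat_mult)
    let ?I = "indicator {z. p (fst z) = p (snd z)} :: 'a \<times> 'a \<Rightarrow> real"
    have Im: "?I \<in> borel_measurable (M \<Otimes>\<^sub>M M)"
    proof -
      have "(\<lambda>z. (\<lambda>a b. of_bool (a = b) :: real) (p (fst z)) (p (snd z))) \<in> borel_measurable (M \<Otimes>\<^sub>M M)"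
        by (rule measurable_label_fun) (rule p_measurable)+
      also have "(\<lambda>z. (\<lambda>a b. of_bool (a = b) :: real) (p (fst z)) (p (snd z))) = ?I"
        by (auto simp: indicator_def)
      finally show ?thesis .
    qed
    have Ii: "integrable (Pi_space {..<k}) (\<lambda>x. ?I (x (fst d), x (snd d)))" if "d \<in> D" for d
    proof (rule P.integrable_bounded_real[where B=1])
      have "fst d \<in> {..<k}" "snd d \<in> {..<k}" using that Dsub by auto
      then have "(\<lambda>x. (x (fst d), x (snd d))) \<in> Pi_space {..<k} \<rightarrow>\<^sub>M M \<Otimes>\<^sub>M M" by measurable
      from measurable_compose[OF this Im]
      show "(\<lambda>x. ?I (x (fst d), x (snd d))) \<in> borel_measurable (Pi_space {..<k})" .
    qed (auto simp: indicator_def)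
    have "(\<integral>x. R x * HU x \<partial>Pi_space {..<k}) \<le> (\<integral>x. (\<Sum>d\<in>D. ?I (x (fst d), x (snd d))) \<partial>Pi_space {..<k})"
    proof (rule integral_mono)
      show "integrable (Pi_space {..<k}) (\<lambda>x. R x * HU x)" using H01 by (intro Ri) auto
      show "integrable (Pi_space {..<k}) (\<lambda>x. \<Sum>d\<in>D. ?I (x (fst d), x (snd d)))"
        by (intro Bochner_Integration.integrable_sum Ii)
      fix x assume x: "x \<in> space (Pi_space {..<k})"
      have nn: "0 \<le> (\<Sum>d\<in>D. ?I (x (fst d), x (snd d)))" by (intro sum_nonneg) auto
      show "R x * HU x \<le> (\<Sum>d\<in>D. ?I (x (fst d), x (snd d)))"
      proof (cases "R x * HU x = 0")
        case False
        then have "\<not> inj_on (\<lambda>l. p (x l)) {..<k}" using none x by auto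
        then obtain i j where ij: "i < k" "j < k" "i < j" "p (x i) = p (x j)"
          unfolding inj_on_def by (metis lessThan_iff linorder_neqE_nat)
        have "R x * HU x \<le> 1" using R01[of x] H01[OF x] by (intro mult_le_one) auto
        also have "1 = ?I (x (fst (i, j)), x (snd (i, j)))" using ij by simp
        also have "\<dots> \<le> (\<Sum>d\<in>D. ?I (x (fst d), x (snd d)))"
          using ij fD by (intro member_le_sum) (auto simp: D_def)
        finally show ?thesis .
      qed (use nn in linarith)
    qed
    also have "\<dots> = (\<Sum>d\<in>D. \<integral>x. ?I (x (fst d), x (snd d)) \<partial>Pi_space {..<k})"
      by (rule Bochner_Integration.integral_sum) (rule Ii)
    also have "\<dots> = (\<Sum>d\<in>D. 1 / real N)"
    proof (intro sum.cong refl)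
      fix d assume "d \<in> D"
      then have "(\<integral>x. ?I (x (fst d), x (snd d)) \<partial>Pi_space {..<k}) = (\<integral>z. ?I z \<partial>(M \<Otimes>\<^sub>M M))"
        by (intro integral_Pi_space_marginal[where B=1] Im) (auto simp: D_def indicator_def)
      then show "(\<integral>x. ?I (x (fst d), x (snd d)) \<partial>Pi_space {..<k}) = 1 / real N"
        by (simp only: prob_same_fibre)
    qed
    also have "\<dots> \<le> (real k)\<^sup>2 / N" using cD by (simp add: divide_right_mono)
    finally show False using big by simp
  qed
  then obtain x where x: "x \<in> space (Pi_space {..<k})" "R x \<noteq> 0" "HU x \<noteq> 0" "inj_on (\<lambda>l. p (x l)) {..<k}"
    by blast
  have xQ: "x l \<in> Q l" if "l < k" for l using R1[of x] x(2) that by auto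
  have edge: "EG (p (x i)) (p (x j))" if "(i, j) \<in> E" for i j
    using x(3) that E(1) by (auto simp: HU_def edge_prod_def U_def)
  show ?thesis
  proof (intro exI[of _ "\<lambda>l. p (x l)"] conjI)
    show "is_copy k EF N EG (\<lambda>l. p (x l))"
      unfolding is_copy_def
    proof (intro conjI allI impI x(4))
      show "(\<lambda>l. p (x l)) ` {..<k} \<subseteq> {..<N}"
        using p_less Pi_space_component[OF x(1)] by auto
      fix a b assume ab: "EF a b"
      then have ab': "a < k" "b < k" "a \<noteq> b" "EF b a" using EF unfolding fin_graph_def by blast+
      show "EG (p (x a)) (p (x b))"
      proof (cases "a < b")
        case True
        then show ?thesis using ab ab' by (intro edge) (simp add: E_def)
      next
        case False
        then have "EG (p (x b)) (p (x a))" using ab' by (intro edge) (simp add: E_def)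
        then show ?thesis using EG unfolding fin_graph_def by blast
      qed
    qed
    show "(\<lambda>l. p (x l)) ` {..<k} \<inter> S = {}" using xQ by (auto simp: Q_def)
    show "\<forall>l<k. cls (p (x l)) = \<beta> l" using xQ by (auto simp: Q_def)
  qed
qed

lemma sum_box_degree:
  assumes "x \<in> space (Pi_space {..<k})"
  shows "(\<Sum>l<k. indicator (cell c) (x l)) = real (card {l. l < k \<and> box_of x l = c})"
proof -
  have "(\<Sum>l<k. indicator (cell c) (x l) :: real) = (\<Sum>l<k. if box_of x l = c then 1 else 0)"
    using Pi_space_component[OF assms] by (intro sum.cong) (auto simp: box_of_def cell_def indicator_def)
  also have "\<dots> = real (card {l. l < k \<and> box_of x l = c})"
    by (simp add: sum.If_cases Int_def)
  finally show ?thesis .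
qed

text \<open>The demand of a box is the mass of \<open>t\<close> in it, and
  \<open>(1 - \<alpha>) * N\<close> times that many copies are requested; rounding down loses at
  most one per box, hence the term \<open>card boxes\<close>. The other subtracted terms bound the
  demand of unusable boxes: \<open>C * (2 / \<delta>)\<close> times the L1 error for boxes of low
  density, \<open>C * 4 / (\<delta> * \<alpha> ^ k)\<close> times the L1 error for boxes whose error
  is large relative to their measure, and \<rho> per class for boxes with a small cell.\<close>

lemma box_tiling:
  fixes W :: "'a \<Rightarrow> 'a \<Rightarrow> real" and w :: "'c \<Rightarrow> 'c \<Rightarrow> real" and t :: "(nat \<Rightarrow> 'a) \<Rightarrow> real"
    and \<alpha> \<delta> \<epsilon> \<eta> \<rho> C :: real
  assumes k: "k \<ge> 1" and EF: "fin_graph k EF" and EG: "fin_graph N EG"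
    and E_def: "E = {(i, j). i < j \<and> j < k \<and> EF i j}"
    and W: "case_prod W \<in> borel_measurable (M \<Otimes>\<^sub>M M)"
    and W01: "\<And>x y. x \<in> space M \<Longrightarrow> y \<in> space M \<Longrightarrow> 0 \<le> W x y \<and> W x y \<le> 1"
    and w01: "\<And>a b. 0 \<le> w a b \<and> w a b \<le> 1"
    and cut: "\<And>A B. A \<in> sets M \<Longrightarrow> B \<in> sets M \<Longrightarrow>
      \<bar>\<integral>z. indicator A (fst z) * indicator B (snd z) * (of_bool (EG (p (fst z)) (p (snd z))) - W (fst z) (snd z)) \<partial>(M \<Otimes>\<^sub>M M)\<bar> \<le> \<epsilon>"
    and L1: "(\<integral>z. \<bar>W (fst z) (snd z) - w (cls (p (fst z))) (cls (p (snd z)))\<bar> \<partial>(M \<Otimes>\<^sub>M M)) \<le> \<eta>"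
    and t[measurable]: "t \<in> borel_measurable (Pi_space {..<k})"
    and t0: "\<And>x. x \<in> space (Pi_space {..<k}) \<Longrightarrow> 0 \<le> t x"
    and tb: "\<And>x. x \<in> space (Pi_space {..<k}) \<Longrightarrow> t x \<le> C"
    and supp: "\<And>x. x \<in> space (Pi_space {..<k}) \<Longrightarrow> t x \<noteq> 0 \<Longrightarrow> \<delta> < edge_prod E (\<lambda>_. W) x"
    and deg: "\<And>x. x \<in> space M \<Longrightarrow>
      (\<Sum>l<k. \<integral>\<^sup>+ y. ennreal (t (y(l := x))) \<partial>Pi_space ({..<k} - {l})) \<le> 1"
    and pos: "0 < \<delta>" "0 < \<alpha>" "\<alpha> < 1" "0 < \<rho>" "0 < C" "0 \<le> \<eta>"
    and small: "real (card E) * \<epsilon> + (real k)\<^sup>2 / N < \<delta> * \<alpha> ^ k / 4 * \<rho> ^ k"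
  shows "(1 - \<alpha>) * N * ((\<integral>x. t x \<partial>Pi_space {..<k}) -
      (C * (2 / \<delta> + 4 / (\<delta> * \<alpha> ^ k)) * (real (card E) * \<eta>) + card K * \<rho>)) - card boxes
    \<le> til_graph k EF N EG"
proof -
  interpret P: prob_space "Pi_space {..<k}" by (rule prob_space_Pi_space)
  define H where "H = edge_prod E (\<lambda>_. W)"
  define H2 where "H2 = edge_prod E (\<lambda>_ a b. w (cls (p a)) (cls (p b)))"
  define h where "h \<beta> = (\<Prod>e\<in>E. w (\<beta> (fst e)) (\<beta> (snd e)))" for \<beta> :: "nat \<Rightarrow> 'c"
  define \<tau> where "\<tau> \<beta> = (\<integral>x. box_indicator \<beta> x * t x \<partial>Pi_space {..<k})" for \<beta>
  define err where "err \<beta> = (\<integral>x. box_indicator \<beta> x * \<bar>H x - H2 x\<bar> \<partial>Pi_space {..<k})" for \<beta>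
  define \<mu> where "\<mu> \<beta> = (\<Prod>l<k. prob (cell (\<beta> l)))" for \<beta>
  define \<eta>' where "\<eta>' = \<delta> * \<alpha> ^ k / 4"
  have \<eta>': "0 < \<eta>'" using pos by (simp add: \<eta>'_def)
  \<comment> \<open>The three conditions are the hypotheses of \<open>box_extension\<close> on
    \<beta>, and \<eta>' is its threshold for the relative error.\<close>
  define Good where "Good = {\<beta> \<in> boxes. \<delta> / 2 \<le> h \<beta> \<and> err \<beta> \<le> \<eta>' * \<mu> \<beta> \<and> (\<forall>l<k. \<rho> \<le> prob (cell (\<beta> l)))}"
  have E: "finite E" "E \<subseteq> {(i, j). i < j \<and> j < k}" "E \<subseteq> {..<k} \<times> {..<k}"
    unfolding E_def by (auto intro: finite_subset[of _ "{..<k} \<times> {..<k}"])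
  have wm: "(\<lambda>(a, b). w (cls (p a)) (cls (p b))) \<in> borel_measurable (M \<Otimes>\<^sub>M M)"
    using measurable_label_fun[OF p_measurable p_measurable, of "\<lambda>a b. w (cls a) (cls b)"]
    by (simp add: case_prod_beta')
  have Hm[measurable]: "H \<in> borel_measurable (Pi_space {..<k})" "H2 \<in> borel_measurable (Pi_space {..<k})"
    unfolding H_def H2_def by (intro edge_prod_measurable E W wm)+
  have H01: "0 \<le> H x \<and> H x \<le> 1" "0 \<le> H2 x \<and> H2 x \<le> 1" if "x \<in> space (Pi_space {..<k})" for x
    unfolding H_def H2_def using E(3) that by (intro edge_prod_01; use W01 w01 in simp)+
  have Db: "\<bar>\<bar>H x - H2 x\<bar>\<bar> \<le> 1" if "x \<in> space (Pi_space {..<k})" for x using H01[OF that] by auto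
  have Dm: "(\<lambda>x. \<bar>H x - H2 x\<bar>) \<in> borel_measurable (Pi_space {..<k})" by measurable
  have tB: "\<bar>t x\<bar> \<le> C" if "x \<in> space (Pi_space {..<k})" for x using t0[OF that] tb[OF that] by simp
  have \<tau>0: "0 \<le> \<tau> \<beta>" for \<beta>
    unfolding \<tau>_def using t0 box_indicator_01 by (intro Bochner_Integration.integral_nonneg) auto
  have err0: "0 \<le> err \<beta>" for \<beta>
    unfolding err_def using box_indicator_01 by (intro Bochner_Integration.integral_nonneg) auto
  have sum_\<tau>: "(\<Sum>\<beta>\<in>boxes. \<tau> \<beta>) = (\<integral>x. t x \<partial>Pi_space {..<k})"
    using sum_boxes[OF t tB, of "\<lambda>_. 1"] by (simp add: \<tau>_def)
  have sum_err: "(\<Sum>\<beta>\<in>boxes. err \<beta>) \<le> real (card E) * \<eta>"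
  proof -
    have "(\<Sum>\<beta>\<in>boxes. err \<beta>) = (\<integral>x. \<bar>H x - H2 x\<bar> \<partial>Pi_space {..<k})"
      using sum_boxes[OF Dm Db, of "\<lambda>_. 1"] by (simp add: err_def)
    also have "\<dots> \<le> real (card E) * \<eta>"
      unfolding H_def H2_def
      by (rule integral_abs_edge_prod_diff[OF E(1,2) W wm W01 _ L1]) (use w01 in auto)
    finally show ?thesis .
  qed
  have degree: "(\<Sum>\<beta>\<in>boxes. \<tau> \<beta> * real (card {l. l < k \<and> \<beta> l = c})) \<le> prob (cell c)" for c
  proof -
    have "(\<Sum>\<beta>\<in>boxes. \<tau> \<beta> * real (card {l. l < k \<and> \<beta> l = c})) =
      (\<integral>x. real (card {l. l < k \<and> box_of x l = c}) * t x \<partial>Pi_space {..<k})"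
      unfolding \<tau>_def by (rule sum_boxes[OF t tB])
    also have "\<dots> = (\<integral>x. (\<Sum>l<k. indicator (cell c) (x l) * t x) \<partial>Pi_space {..<k})"
      by (intro Bochner_Integration.integral_cong refl) (simp add: sum_box_degree[symmetric] sum_distrib_right)
    also have "\<dots> = (\<Sum>l<k. \<integral>x. indicator (cell c) (x l) * t x \<partial>Pi_space {..<k})"
    proof (rule Bochner_Integration.integral_sum)
      fix l assume "l \<in> {..<k}"
      then have "(\<lambda>x. indicator (cell c) (x l) * t x) \<in> borel_measurable (Pi_space {..<k})"
        by (intro borel_measurable_times t measurable_compose[OF measurable_component_singleton]) auto
      then show "integrable (Pi_space {..<k}) (\<lambda>x. indicator (cell c) (x l) * t x)"
        using tB pos by (intro P.integrable_bounded_real[where B=C]) (auto simp: indicator_def)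
    qed
    also have "\<dots> \<le> prob (cell c)" by (rule tiling_integral_le[OF t t0 tb deg]) auto
    finally show ?thesis .
  qed
  have \<tau>\<mu>: "\<tau> \<beta> \<le> C * \<mu> \<beta>" for \<beta>
  proof -
    have "\<tau> \<beta> \<le> (\<integral>x. box_indicator \<beta> x * C \<partial>Pi_space {..<k})"
      unfolding \<tau>_def using tb pos box_indicator_01
      by (intro integral_mono integrable_box[OF t tB] integrable_box[where B=C] mult_left_mono) auto
    also have "\<dots> = C * \<mu> \<beta>" by (simp add: integral_box_indicator \<mu>_def)
    finally show ?thesis .
  qed
  \<comment> \<open>On the support of \<open>t\<close> the density exceeds \<open>\<delta>\<close>, so boxes of small density only carry mass
    where \<open>H\<close> and \<open>H2\<close> differ by at least \<open>\<delta> / 2\<close>.\<close>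
  have \<tau>h: "\<tau> \<beta> \<le> C * (2 / \<delta>) * err \<beta>" if h: "h \<beta> < \<delta> / 2" and \<beta>: "\<beta> \<in> boxes" for \<beta>
  proof -
    have "\<tau> \<beta> \<le> (\<integral>x. box_indicator \<beta> x * (C * (2 / \<delta>) * \<bar>H x - H2 x\<bar>) \<partial>Pi_space {..<k})"
      unfolding \<tau>_def
    proof (rule integral_mono)
      show "integrable (Pi_space {..<k}) (\<lambda>x. box_indicator \<beta> x * t x)" by (rule integrable_box[OF t tB])
      show "integrable (Pi_space {..<k}) (\<lambda>x. box_indicator \<beta> x * (C * (2 / \<delta>) * \<bar>H x - H2 x\<bar>))"
        using integrable_box[OF Dm Db, of \<beta>] by (simp add: mult.left_commute)
      fix x assume x: "x \<in> space (Pi_space {..<k})"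
      show "box_indicator \<beta> x * t x \<le> box_indicator \<beta> x * (C * (2 / \<delta>) * \<bar>H x - H2 x\<bar>)"
      proof (cases "\<beta> = box_of x \<and> t x \<noteq> 0")
        case True
        then have "\<delta> < H x" using supp[OF x] by (simp add: H_def)
        moreover have "H2 x = h \<beta>"
          unfolding H2_def h_def edge_prod_def using True E(3) by (intro prod.cong) (auto simp: box_of_def)
        ultimately have "\<delta> / 2 \<le> \<bar>H x - H2 x\<bar>" using h by linarith
        then have "C * (2 / \<delta>) * (\<delta> / 2) \<le> C * (2 / \<delta>) * \<bar>H x - H2 x\<bar>" using pos by (intro mult_left_mono) auto
        then have "t x \<le> C * (2 / \<delta>) * \<bar>H x - H2 x\<bar>" using tb[OF x] pos by simp
        then show ?thesis using box_indicator_01 by (intro mult_left_mono) auto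
      next
        case False
        then have "box_indicator \<beta> x * t x = 0" using box_indicator_eq[OF x \<beta>] by auto
        moreover have "0 \<le> box_indicator \<beta> x * (C * (2 / \<delta>) * \<bar>H x - H2 x\<bar>)"
          using box_indicator_01[of \<beta> x] pos by simp
        ultimately show ?thesis by linarith
      qed
    qed
    also have "\<dots> = C * (2 / \<delta>) * err \<beta>" by (simp add: err_def mult.left_commute)
    finally show ?thesis .
  qed
  define small_cells where "small_cells = {c \<in> K. prob (cell c) < \<rho>}"
  \<comment> \<open>The number of coordinates of a box in small cells, at least 1 when the box has
    one. Weighting demands by this number brings them into the form of the degree
    constraint.\<close>
  let ?s = "\<lambda>\<beta>. \<Sum>c\<in>small_cells. real (card {l. l < k \<and> \<beta> l = c})"
  have fs: "finite small_cells" using finite_K by (simp add: small_cells_def)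
  \<comment> \<open>Each way of failing to be good is paid for by one summand; as all three are
    nonnegative, their sum covers every case.\<close>
  have bad: "\<tau> \<beta> \<le> C * (2 / \<delta>) * err \<beta> + (C / \<eta>') * err \<beta> + \<tau> \<beta> * ?s \<beta>" if \<beta>: "\<beta> \<in> boxes - Good" for \<beta>
  proof -
    have n: "0 \<le> C * (2 / \<delta>) * err \<beta>" "0 \<le> (C / \<eta>') * err \<beta>" "0 \<le> \<tau> \<beta> * ?s \<beta>"
      using err0[of \<beta>] \<tau>0[of \<beta>] pos \<eta>' by (auto intro!: mult_nonneg_nonneg sum_nonneg)
    consider "h \<beta> < \<delta> / 2" | "\<eta>' * \<mu> \<beta> < err \<beta>" | l where "l < k" "prob (cell (\<beta> l)) < \<rho>"
      using \<beta> unfolding Good_def by force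
    then show ?thesis
    proof cases
      case 1
      then show ?thesis using \<tau>h[of \<beta>] \<beta> n by auto
    next
      case 2
      then have "\<mu> \<beta> \<le> err \<beta> / \<eta>'" using \<eta>' by (simp add: field_simps)
      then have "C * \<mu> \<beta> \<le> C * (err \<beta> / \<eta>')" using pos by (intro mult_left_mono) auto
      then show ?thesis using \<tau>\<mu>[of \<beta>] n by simp
    next
      case 3
      have "\<beta> l \<in> small_cells" using 3 \<beta> by (auto simp: small_cells_def)
      moreover have "1 \<le> card {l'. l' < k \<and> \<beta> l' = \<beta> l}"
        using 3 by (auto simp: Suc_le_eq card_gt_0_iff)
      ultimately have "1 \<le> ?s \<beta>"
        using member_le_sum[of "\<beta> l" small_cells "\<lambda>c. real (card {l. l < k \<and> \<beta> l = c})"] fs by force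
      then have "\<tau> \<beta> * 1 \<le> \<tau> \<beta> * ?s \<beta>" using \<tau>0 by (intro mult_left_mono) auto
      then show ?thesis using n by linarith
    qed
  qed
  have "(\<Sum>\<beta>\<in>boxes - Good. \<tau> \<beta>) \<le>
    (\<Sum>\<beta>\<in>boxes - Good. C * (2 / \<delta>) * err \<beta> + (C / \<eta>') * err \<beta> + \<tau> \<beta> * ?s \<beta>)"
    by (rule sum_mono) (rule bad)
  also have "\<dots> \<le> (\<Sum>\<beta>\<in>boxes. C * (2 / \<delta>) * err \<beta> + (C / \<eta>') * err \<beta> + \<tau> \<beta> * ?s \<beta>)"
    using err0 \<tau>0 pos \<eta>' finite_boxes
    by (intro sum_mono2) (auto intro!: add_nonneg_nonneg mult_nonneg_nonneg sum_nonneg)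
  also have "\<dots> = C * (2 / \<delta> + 1 / \<eta>') * (\<Sum>\<beta>\<in>boxes. err \<beta>) + (\<Sum>\<beta>\<in>boxes. \<tau> \<beta> * ?s \<beta>)"
  proof -
    have "C * (2 / \<delta>) * err \<beta> + (C / \<eta>') * err \<beta> = C * (2 / \<delta> + 1 / \<eta>') * err \<beta>" for \<beta>
      by (simp add: distrib_left distrib_right)
    then show ?thesis by (simp only: sum.distrib sum_distrib_left)
  qed
  \<comment> \<open>Exchanging the sums turns the charge to each small cell into its degree, which
    is at most the measure of the cell and so at most \<rho>.\<close>
  also have "(\<Sum>\<beta>\<in>boxes. \<tau> \<beta> * ?s \<beta>) = (\<Sum>c\<in>small_cells. \<Sum>\<beta>\<in>boxes. \<tau> \<beta> * real (card {l. l < k \<and> \<beta> l = c}))"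
    by (subst sum.swap) (simp add: sum_distrib_left)
  also have "\<dots> \<le> (\<Sum>c\<in>small_cells. \<rho>)"
    using degree by (intro sum_mono) (force simp: small_cells_def intro: order.trans less_imp_le)
  also have "\<dots> \<le> card K * \<rho>"
    using finite_K pos by (auto simp: small_cells_def intro!: mult_right_mono card_mono)
  also have "C * (2 / \<delta> + 1 / \<eta>') * (\<Sum>\<beta>\<in>boxes. err \<beta>) \<le> C * (2 / \<delta> + 1 / \<eta>') * (real (card E) * \<eta>)"
    using sum_err pos \<eta>' by (intro mult_left_mono) auto
  finally have bad_sum: "(\<Sum>\<beta>\<in>boxes - Good. \<tau> \<beta>) \<le> C * (2 / \<delta> + 1 / \<eta>') * (real (card E) * \<eta>) + card K * \<rho>"
    by simp
  have GB: "Good \<subseteq> boxes" by (auto simp: Good_def)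
  then have fG: "finite Good" using finite_boxes by (rule finite_subset)
  have good_sum: "(\<integral>x. t x \<partial>Pi_space {..<k}) - (C * (2 / \<delta> + 1 / \<eta>') * (real (card E) * \<eta>) + card K * \<rho>) \<le> (\<Sum>\<beta>\<in>Good. \<tau> \<beta>)"
    using bad_sum sum.subset_diff[OF GB finite_boxes, of \<tau>] sum_\<tau> by linarith
  define m where "m \<beta> = nat \<lfloor>(1 - \<alpha>) * N * \<tau> \<beta>\<rfloor>" for \<beta>
  have m: "(1 - \<alpha>) * N * \<tau> \<beta> - 1 \<le> real (m \<beta>)" "real (m \<beta>) \<le> (1 - \<alpha>) * N * \<tau> \<beta>" for \<beta>
  proof -
    have "0 \<le> (1 - \<alpha>) * N * \<tau> \<beta>" using pos \<tau>0 by (intro mult_nonneg_nonneg) auto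
    then show "(1 - \<alpha>) * N * \<tau> \<beta> - 1 \<le> real (m \<beta>)" "real (m \<beta>) \<le> (1 - \<alpha>) * N * \<tau> \<beta>"
      unfolding m_def by linarith+
  qed
  obtain gs where gs: "set gs = Good" "distinct gs" using finite_distinct_list[OF fG] by blast
  define bs where "bs = concat (map (\<lambda>\<beta>. replicate (m \<beta>) \<beta>) gs)"
  have bsG: "set bs \<subseteq> Good" using gs by (auto simp: bs_def)
  have lenbs: "real (length bs) = (\<Sum>\<beta>\<in>Good. real (m \<beta>))"
  proof -
    have "real (length xs) = (\<Sum>_\<leftarrow>xs. 1)" for xs :: "(nat \<Rightarrow> 'c) list" by (induction xs) auto
    then have "real (length bs) = (\<Sum>_\<leftarrow>bs. 1)" .
    also have "\<dots> = (\<Sum>\<beta>\<in>Good. real (m \<beta>) * 1)"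
      unfolding bs_def gs(1)[symmetric] by (rule sum_list_concat_replicate[OF gs(2)])
    finally show ?thesis by simp
  qed
  have load: "(\<Sum>\<beta>\<leftarrow>bs. real (card {l. l < k \<and> \<beta> l = c})) \<le> (1 - \<alpha>) * N * prob (cell c)" for c
  proof -
    have "(\<Sum>\<beta>\<leftarrow>bs. real (card {l. l < k \<and> \<beta> l = c})) = (\<Sum>\<beta>\<in>Good. real (m \<beta>) * real (card {l. l < k \<and> \<beta> l = c}))"
      unfolding bs_def using sum_list_concat_replicate[OF gs(2)] gs(1) by simp
    also have "\<dots> \<le> (\<Sum>\<beta>\<in>Good. (1 - \<alpha>) * N * \<tau> \<beta> * real (card {l. l < k \<and> \<beta> l = c}))"
      by (intro sum_mono mult_right_mono m) auto
    also have "\<dots> \<le> (\<Sum>\<beta>\<in>boxes. (1 - \<alpha>) * N * \<tau> \<beta> * real (card {l. l < k \<and> \<beta> l = c}))"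
      using GB finite_boxes pos \<tau>0 by (intro sum_mono2 mult_nonneg_nonneg) auto
    also have "\<dots> = (1 - \<alpha>) * N * (\<Sum>\<beta>\<in>boxes. \<tau> \<beta> * real (card {l. l < k \<and> \<beta> l = c}))"
      by (simp add: sum_distrib_left mult.assoc)
    also have "\<dots> \<le> (1 - \<alpha>) * N * prob (cell c)" using degree pos by (intro mult_left_mono) auto
    finally show ?thesis .
  qed
  have ext: "\<exists>g. is_copy k EF N EG g \<and> g ` {..<k} \<inter> S = {} \<and> (\<forall>l<k. cls (g l) = \<beta> l)"
    if \<beta>: "\<beta> \<in> set bs" and S: "S \<subseteq> {..<N}" "\<And>c. real (card {v \<in> S. cls v = c}) \<le> (1 - \<alpha>) * N * prob (cell c)" for S \<beta>
  proof (rule box_extension[OF EF EG E_def W W01 w01 cut _ _ _ _ _ _ small S])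
    have "\<beta> \<in> Good" using \<beta> bsG by auto
    then show "\<delta> / 2 \<le> (\<Prod>e\<in>E. w (\<beta> (fst e)) (\<beta> (snd e)))"
      "(\<integral>x. box_indicator \<beta> x * \<bar>edge_prod E (\<lambda>_. W) x - edge_prod E (\<lambda>_ a b. w (cls (p a)) (cls (p b))) x\<bar> \<partial>Pi_space {..<k})
      \<le> (\<delta> * \<alpha> ^ k / 4) * (\<Prod>l<k. prob (cell (\<beta> l)))"
      "\<And>l. l < k \<Longrightarrow> \<rho> \<le> prob (cell (\<beta> l))"
      by (auto simp: Good_def h_def err_def \<mu>_def \<eta>'_def H_def H2_def)
  qed (use pos in auto)
  have "\<exists>f. (\<forall>i<length bs. is_copy k EF N EG (f i)) \<and>
    (\<forall>i<length bs. \<forall>j<length bs. i \<noteq> j \<longrightarrow> f i ` {..<k} \<inter> f j ` {..<k} = {}) \<and>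
    (\<forall>c. real (card {v \<in> (\<Union>i<length bs. f i ` {..<k}). cls v = c}) \<le> (\<Sum>\<beta>\<leftarrow>bs. real (card {l. l < k \<and> \<beta> l = c})))"
    by (rule greedy_embedding[where cap = "\<lambda>c. (1 - \<alpha>) * N * prob (cell c)"]) (rule ext load; assumption)+
  then obtain f where f: "\<forall>i<length bs. is_copy k EF N EG (f i)"
    "\<forall>i<length bs. \<forall>j<length bs. i \<noteq> j \<longrightarrow> f i ` {..<k} \<inter> f j ` {..<k} = {}"
    by (elim exE conjE)
  have "length bs \<le> til_graph k EF N EG"
    by (rule til_graph_geI[OF k, of _ _ _ _ f]) (use f in auto)
  then have "real (length bs) \<le> til_graph k EF N EG" by simp
  moreover have "(1 - \<alpha>) * N * (\<Sum>\<beta>\<in>Good. \<tau> \<beta>) - card boxes \<le> real (length bs)"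
  proof -
    have "(1 - \<alpha>) * N * (\<Sum>\<beta>\<in>Good. \<tau> \<beta>) - card Good = (\<Sum>\<beta>\<in>Good. (1 - \<alpha>) * N * \<tau> \<beta> - 1)"
      by (simp add: sum_subtractf sum_distrib_left)
    also have "\<dots> \<le> real (length bs)" unfolding lenbs by (intro sum_mono m)
    finally show ?thesis using card_mono[OF finite_boxes GB] by linarith
  qed
  moreover have inv: "1 / \<eta>' = 4 / (\<delta> * \<alpha> ^ k)" by (simp add: \<eta>'_def)
  have "(1 - \<alpha>) * N * ((\<integral>x. t x \<partial>Pi_space {..<k}) -
      (C * (2 / \<delta> + 4 / (\<delta> * \<alpha> ^ k)) * (real (card E) * \<eta>) + card K * \<rho>)) \<le> (1 - \<alpha>) * N * (\<Sum>\<beta>\<in>Good. \<tau> \<beta>)"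
    using good_sum pos unfolding inv by (intro mult_left_mono) auto
  ultimately show ?thesis by linarith
qed

end

section \<open>Lower semicontinuity\<close>

context prob_space
begin

text \<open>Four losses of a quarter of \<xi> each: scaling by 1 - \<alpha>, the L1 error multiplied
  by \<open>B\<close>, the small cells through \<rho>, and the rounding over all boxes. Neither
  \<epsilon> nor \<open>N0\<close> depends on the graph or its partition.\<close>

lemma large_graph_tiling:
  fixes W :: "'a \<Rightarrow> 'a \<Rightarrow> real" and t :: "(nat \<Rightarrow> 'a) \<Rightarrow> real"
    and \<delta> \<xi> C :: real
  assumes k: "k \<ge> 1" and EF: "fin_graph k EF"
    and E_def: "E = {(i, j). i < j \<and> j < k \<and> EF i j}"
    and W: "case_prod W \<in> borel_measurable (M \<Otimes>\<^sub>M M)"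
    and W01: "\<And>x y. x \<in> space M \<Longrightarrow> y \<in> space M \<Longrightarrow> 0 \<le> W x y \<and> W x y \<le> 1"
    and t: "t \<in> borel_measurable (Pi_space {..<k})"
    and t0: "\<And>x. x \<in> space (Pi_space {..<k}) \<Longrightarrow> 0 \<le> t x"
    and tb: "\<And>x. x \<in> space (Pi_space {..<k}) \<Longrightarrow> t x \<le> C"
    and supp: "\<And>x. x \<in> space (Pi_space {..<k}) \<Longrightarrow> t x \<noteq> 0 \<Longrightarrow> \<delta> < edge_prod E (\<lambda>_. W) x"
    and deg: "\<And>x. x \<in> space M \<Longrightarrow>
      (\<Sum>l<k. \<integral>\<^sup>+ y. ennreal (t (y(l := x))) \<partial>Pi_space ({..<k} - {l})) \<le> 1"
    and pos: "0 < \<delta>" "0 < C" "0 < \<xi>"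
  shows "\<exists>\<epsilon>>0. \<exists>N0. \<forall>p N EG. N0 \<le> N \<longrightarrow> equipartition M p N \<longrightarrow> fin_graph N EG \<longrightarrow>
      (\<forall>A\<in>sets M. \<forall>B\<in>sets M.
      \<bar>\<integral>z. indicator A (fst z) * indicator B (snd z) * (of_bool (EG (p (fst z)) (p (snd z))) - W (fst z) (snd z)) \<partial>(M \<Otimes>\<^sub>M M)\<bar> \<le> \<epsilon>) \<longrightarrow>
      ((\<integral>x. t x \<partial>Pi_space {..<k}) - \<xi>) * real N \<le> til_graph k EF N EG"
proof -
  interpret P: prob_space "Pi_space {..<k}" by (rule prob_space_Pi_space)
  let ?s = "\<integral>x. t x \<partial>Pi_space {..<k}"
  have s0: "0 \<le> ?s" using t0 by (intro Bochner_Integration.integral_nonneg) auto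
  \<comment> \<open>With this, scaling by 1 - \<alpha> loses at most \<alpha> in absolute
    terms.\<close>
  have s1: "?s \<le> 1"
  proof -
    have "(\<Sum>l<k. \<integral>x. indicator (space M) (x l) * t x \<partial>Pi_space {..<k}) \<le> prob (space M)"
      by (rule tiling_integral_le[OF t t0 tb deg]) auto
    also have "(\<Sum>l<k. \<integral>x. indicator (space M) (x l) * t x \<partial>Pi_space {..<k}) = (\<Sum>l<k. ?s)"
      using Pi_space_component by (intro sum.cong Bochner_Integration.integral_cong refl) (auto simp: indicator_def)
    finally have "real k * ?s \<le> 1" by (simp add: prob_space)
    moreover have "1 * ?s \<le> real k * ?s" using k s0 by (intro mult_right_mono) auto
    ultimately show ?thesis by linarith
  qed
  define \<alpha> where "\<alpha> = min (1 / 2) (\<xi> / 4)"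
  have \<alpha>: "0 < \<alpha>" "\<alpha> < 1" "\<alpha> \<le> \<xi> / 4" using pos by (auto simp: \<alpha>_def)
  define B where "B = C * (2 / \<delta> + 4 / (\<delta> * \<alpha> ^ k))"
  have B: "0 < B" using pos \<alpha> by (simp add: B_def add_pos_pos)
  \<comment> \<open>The \<open>+ 1\<close> here, and those in \<rho> and \<epsilon>, keep
    denominators positive when \<open>E\<close> or \<open>K\<close> is empty.\<close>
  define D where "D = B * card E + 1"
  have D: "0 < D" unfolding D_def using B by (intro add_nonneg_pos mult_nonneg_nonneg) auto
  define \<eta> where "\<eta> = \<xi> / (4 * D)"
  have \<eta>: "0 < \<eta>" using pos D by (simp add: \<eta>_def)
  have B\<eta>: "B * (real (card E) * \<eta>) \<le> \<xi> / 4"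
  proof -
    have "B * (real (card E) * \<eta>) \<le> D * \<eta>" using \<eta> by (simp add: D_def algebra_simps)
    also have "\<dots> = \<xi> / 4" using D by (simp add: \<eta>_def)
    finally show ?thesis .
  qed
  have "\<exists>(K :: nat list set) \<epsilon>. finite K \<and> 0 < \<epsilon> \<and>
    (\<forall>p N u. equipartition M p N \<longrightarrow> (\<forall>i j. 0 \<le> u i j \<and> u i j \<le> 1) \<longrightarrow>
      (\<forall>A\<in>sets M. \<forall>B\<in>sets M.
        \<bar>\<integral>z. indicator A (fst z) * indicator B (snd z) * (u (p (fst z)) (p (snd z)) - W (fst z) (snd z)) \<partial>(M \<Otimes>\<^sub>M M)\<bar> \<le> \<epsilon>) \<longrightarrow>
      (\<exists>cls w. (\<forall>v<N. cls v \<in> K) \<and> (\<forall>a b. 0 \<le> w a b \<and> w a b \<le> 1) \<and>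
        (\<integral>z. \<bar>W (fst z) (snd z) - w (cls (p (fst z))) (cls (p (snd z)))\<bar> \<partial>(M \<Otimes>\<^sub>M M)) \<le> \<eta>))"
    by (rule aligned_approximation[OF W _ \<eta>]) (rule W01)
  then obtain K :: "nat list set" and \<epsilon>1 where K: "finite K" "0 < \<epsilon>1" and ap:
    "(\<forall>p N u. equipartition M p N \<longrightarrow> (\<forall>i j. 0 \<le> u i j \<and> u i j \<le> 1) \<longrightarrow>
      (\<forall>A\<in>sets M. \<forall>B\<in>sets M.
        \<bar>\<integral>z. indicator A (fst z) * indicator B (snd z) * (u (p (fst z)) (p (snd z)) - W (fst z) (snd z)) \<partial>(M \<Otimes>\<^sub>M M)\<bar> \<le> \<epsilon>1) \<longrightarrow>
      (\<exists>cls w. (\<forall>v<N. cls v \<in> K) \<and> (\<forall>a b. 0 \<le> w a b \<and> w a b \<le> 1) \<and>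
        (\<integral>z. \<bar>W (fst z) (snd z) - w (cls (p (fst z))) (cls (p (snd z)))\<bar> \<partial>(M \<Otimes>\<^sub>M M)) \<le> \<eta>))"
    by (elim exE conjE)
  define \<rho> where "\<rho> = \<xi> / (4 * (card K + 1))"
  have \<rho>: "0 < \<rho>" using pos by (simp add: \<rho>_def add_nonneg_pos)
  have K\<rho>: "card K * \<rho> \<le> \<xi> / 4"
  proof -
    have "card K * \<rho> \<le> (card K + 1) * \<rho>" using \<rho> by (simp add: algebra_simps)
    also have "\<dots> = \<xi> / 4" unfolding \<rho>_def by (simp add: field_simps)
    finally show ?thesis .
  qed
  \<comment> \<open>The right-hand side of the smallness condition in \<open>box_tiling\<close>; the
    counting error and the degenerate copies get half of it each.\<close>
  define \<kappa> where "\<kappa> = \<delta> * \<alpha> ^ k / 4 * \<rho> ^ k"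
  have \<kappa>: "0 < \<kappa>" using pos \<alpha> \<rho> by (simp add: \<kappa>_def)
  define \<epsilon> where "\<epsilon> = min \<epsilon>1 (\<kappa> / (2 * (card E + 1)))"
  have \<epsilon>: "0 < \<epsilon>" "\<epsilon> \<le> \<epsilon>1" using K \<kappa> by (auto simp: \<epsilon>_def)
  have E\<epsilon>: "real (card E) * \<epsilon> \<le> \<kappa> / 2"
  proof -
    have "real (card E) * \<epsilon> \<le> (real (card E) + 1) * (\<kappa> / (2 * (card E + 1)))"
      using \<kappa> \<epsilon> by (intro mult_mono) (auto simp: \<epsilon>_def)
    also have "\<dots> = \<kappa> / 2" by (simp add: field_simps)
    finally show ?thesis .
  qed
  define cb where "cb = card (PiE {..<k} (\<lambda>_. K))"
  \<comment> \<open>The first term forces k^2/N below \<kappa>/2, the second forces the rounding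
    loss to be at most N \<xi>/4.\<close>
  obtain N0 :: nat where N0: "2 * (real k)\<^sup>2 / \<kappa> + 4 * real cb / \<xi> < N0" using reals_Archimedean2 by blast
  show ?thesis
  proof (intro exI[of _ \<epsilon>] exI[of _ N0] conjI \<epsilon>(1) allI impI)
    fix p :: "'a \<Rightarrow> nat" and N EG
    assume N: "N0 \<le> N" and eq: "equipartition M p N" and EG: "fin_graph N EG"
      and cut: "\<forall>A\<in>sets M. \<forall>B\<in>sets M.
      \<bar>\<integral>z. indicator A (fst z) * indicator B (snd z) * (of_bool (EG (p (fst z)) (p (snd z))) - W (fst z) (snd z)) \<partial>(M \<Otimes>\<^sub>M M)\<bar> \<le> \<epsilon>"
    have Nbig: "2 * (real k)\<^sup>2 / \<kappa> + 4 * real cb / \<xi> < N" using N0 N by linarith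
    have n1: "0 \<le> 2 * (real k)\<^sup>2 / \<kappa>" "0 \<le> 4 * real cb / \<xi>" using \<kappa> pos by auto
    have Np: "0 < real N" using Nbig n1 by linarith
    have "2 * (real k)\<^sup>2 / \<kappa> < N" using Nbig n1 by linarith
    then have kN: "(real k)\<^sup>2 / N < \<kappa> / 2" using \<kappa> Np by (simp add: field_simps)
    have "4 * real cb / \<xi> \<le> N" using Nbig n1 by linarith
    then have cbN: "real cb \<le> \<xi> / 4 * N" using pos by (simp add: field_simps)
    have "\<exists>cls w. (\<forall>v<N. cls v \<in> K) \<and> (\<forall>a b. 0 \<le> w a b \<and> w a b \<le> 1) \<and>
        (\<integral>z. \<bar>W (fst z) (snd z) - w (cls (p (fst z))) (cls (p (snd z)))\<bar> \<partial>(M \<Otimes>\<^sub>M M)) \<le> \<eta>"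
    proof (rule ap[rule_format, OF eq, where u="\<lambda>i j. of_bool (EG i j)"])
      fix A B assume "A \<in> sets M" "B \<in> sets M"
      then show "\<bar>\<integral>z. indicator A (fst z) * indicator B (snd z) * (of_bool (EG (p (fst z)) (p (snd z))) - W (fst z) (snd z)) \<partial>(M \<Otimes>\<^sub>M M)\<bar> \<le> \<epsilon>1"
        using cut \<epsilon>(2) by (meson order.trans)
    qed auto
    then obtain cls w where cw: "\<forall>v<N. cls v \<in> K" "\<forall>a b. 0 \<le> w a b \<and> w a b \<le> (1::real)"
      "(\<integral>z. \<bar>W (fst z) (snd z) - w (cls (p (fst z))) (cls (p (snd z)))\<bar> \<partial>(M \<Otimes>\<^sub>M M)) \<le> \<eta>"
      by (elim exE conjE)
    interpret classified_partition M p N cls K k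
      using eq K(1) cw(1) by (simp add: classified_partition_def classified_partition_axioms_def)
    let ?R = "B * (real (card E) * \<eta>) + card K * \<rho>"
    have "(1 - \<alpha>) * N * (?s - (C * (2 / \<delta> + 4 / (\<delta> * \<alpha> ^ k)) * (real (card E) * \<eta>) + card K * \<rho>)) - card boxes
      \<le> til_graph k EF N EG"
    proof (rule box_tiling[OF k EF EG E_def W W01 _ _ cw(3) t t0 tb supp deg pos(1) \<alpha>(1,2) \<rho> pos(2)])
      show "0 \<le> w a b \<and> w a b \<le> 1" for a b using cw(2) by blast
      show "\<bar>\<integral>z. indicator A (fst z) * indicator B (snd z) * (of_bool (EG (p (fst z)) (p (snd z))) - W (fst z) (snd z)) \<partial>(M \<Otimes>\<^sub>M M)\<bar> \<le> \<epsilon>"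
        if "A \<in> sets M" "B \<in> sets M" for A B using cut that by blast
      show "0 \<le> \<eta>" using \<eta> by simp
      show "real (card E) * \<epsilon> + (real k)\<^sup>2 / N < \<delta> * \<alpha> ^ k / 4 * \<rho> ^ k"
        using E\<epsilon> kN unfolding \<kappa>_def[symmetric] by linarith
    qed
    then have main: "(1 - \<alpha>) * N * (?s - ?R) - cb \<le> til_graph k EF N EG" by (simp add: B_def cb_def)
    have R: "0 \<le> ?R" "?R \<le> \<xi> / 2" using B\<eta> K\<rho> B \<eta> \<rho> by (auto intro!: add_nonneg_nonneg mult_nonneg_nonneg)
    have as: "\<alpha> * ?s \<le> \<alpha> * 1" "0 \<le> \<alpha> * ?R" using s1 \<alpha> R(1) by (intro mult_left_mono mult_nonneg_nonneg; simp)+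
    have "(1 - \<alpha>) * (?s - ?R) = ?s - \<alpha> * ?s - ?R + \<alpha> * ?R" by (simp add: algebra_simps)
    then have "?s - 3 * \<xi> / 4 \<le> (1 - \<alpha>) * (?s - ?R)" using as R \<alpha>(3) by linarith
    then have "(?s - 3 * \<xi> / 4) * N \<le> (1 - \<alpha>) * (?s - ?R) * N" by (rule mult_right_mono) simp
    then have "(?s - 3 * \<xi> / 4) * N - \<xi> / 4 * N \<le> til_graph k EF N EG"
      using main cbN by (simp add: mult_ac)
    then show "(?s - \<xi>) * real N \<le> til_graph k EF N EG" by (simp add: algebra_simps)
  qed
qed

section \<open>From cut distance to a relabelled equipartition\<close>

lemma cut_norm_bound:
  fixes V :: "'a \<Rightarrow> 'a \<Rightarrow> real"
  assumes V: "\<And>x y. x \<in> space M \<Longrightarrow> y \<in> space M \<Longrightarrow> \<bar>V x y\<bar> \<le> 1"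
    and AB: "A \<in> sets M" "B \<in> sets M"
  shows "\<bar>\<integral>z. indicator (A \<times> B) z * V (fst z) (snd z) \<partial>(M \<Otimes>\<^sub>M M)\<bar> \<le> cut_norm M V"
proof -
  interpret MM: prob_space "M \<Otimes>\<^sub>M M" by (rule prob_space_pair_self)
  let ?f = "\<lambda>AB. \<bar>\<integral>z. indicator (fst AB \<times> snd AB) z * V (fst z) (snd z) \<partial>(M \<Otimes>\<^sub>M M)\<bar>"
  have "?f AB \<le> 1" for AB
    using V by (intro MM.abs_integral_le_bound) (auto simp: space_pair_measure indicator_def)
  \<comment> \<open>A real supremum is an upper bound only for a bounded family; kernels bounded by
    1 provide that.\<close>
  then have "bdd_above (?f ` (sets M \<times> sets M))" by (intro bdd_aboveI[of _ 1]) auto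
  then have "?f (A, B) \<le> cut_norm M V"
    unfolding cut_norm_def using AB by (intro cSUP_upper) auto
  then show ?thesis by simp
qed

text \<open>Shows that the infimum in \<open>cut_dist\<close> ranges over a nonempty set, so that a
  cut distance below \<epsilon> yields an actual map with cut norm below \<epsilon>.\<close>

lemma invertible_mp_id: "invertible_mp M (\<lambda>x. x)"
proof -
  have i: "inv_into (space M) (\<lambda>x. x) x = x" if "x \<in> space M" for x
    using inv_into_f_f[of "\<lambda>x. x" "space M" x] that by simp
  have "inv_into (space M) (\<lambda>x. x) \<in> M \<rightarrow>\<^sub>M M"
    by (subst measurable_cong[OF i]) auto
  moreover have "distr M M (inv_into (space M) (\<lambda>x. x)) = distr M M (\<lambda>x. x)"
    by (intro distr_cong i refl)
  ultimately show ?thesis by (simp add: invertible_mp_def distr_id bij_betw_def inj_on_def)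
qed

text \<open>The map \<phi> is moved from \<open>W\<close> to the vertex partition: composing
  \<open>p\<close> with the inverse of \<phi> gives \<open>q\<close> with
  \<open>q (\<phi> x) = p x\<close>, and the integrals agree because \<phi> preserves the measure.
  Thus \<open>W\<close>, and with it the tiling, stays the same for all graphs of the
  sequence.\<close>

lemma cut_dist_equipartition:
  fixes \<epsilon> :: real
  assumes W: "graphon M W" and rep: "graphon_rep M N EG U" and d: "cut_dist M U W < \<epsilon>"
  shows "\<exists>p. equipartition M p N \<and> (\<forall>A\<in>sets M. \<forall>B\<in>sets M.
      \<bar>\<integral>z. indicator A (fst z) * indicator B (snd z) * (of_bool (EG (p (fst z)) (p (snd z))) - W (fst z) (snd z)) \<partial>(M \<Otimes>\<^sub>M M)\<bar> \<le> \<epsilon>)"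
proof -
  obtain p where p[measurable]: "p \<in> M \<rightarrow>\<^sub>M count_space UNIV" and pN: "\<And>x. x \<in> space M \<Longrightarrow> p x < N"
    and pf: "\<And>i. i < N \<Longrightarrow> prob (p -` {i} \<inter> space M) = 1 / N"
    and U: "\<And>x y. x \<in> space M \<Longrightarrow> y \<in> space M \<Longrightarrow> U x y = of_bool (EG (p x) (p y))"
    using rep unfolding graphon_rep_def by (auto simp: of_bool_def)
  have W': "case_prod W \<in> borel_measurable (M \<Otimes>\<^sub>M M)"
    and W01: "\<And>x y. x \<in> space M \<Longrightarrow> y \<in> space M \<Longrightarrow> 0 \<le> W x y \<and> W x y \<le> 1"
    using W by (auto simp: graphon_def)
  have "(\<lambda>\<phi>. cut_norm M (\<lambda>x y. U x y - W (\<phi> x) (\<phi> y))) ` {\<phi>. invertible_mp M \<phi>} \<noteq> {}"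
    using invertible_mp_id by blast
  from cInf_lessD[OF this d[unfolded cut_dist_def]]
  obtain \<phi> where \<phi>: "invertible_mp M \<phi>" and cn: "cut_norm M (\<lambda>x y. U x y - W (\<phi> x) (\<phi> y)) < \<epsilon>"
    by blast
  define \<psi> where "\<psi> = inv_into (space M) \<phi>"
  have bij: "bij_betw \<phi> (space M) (space M)" and \<phi>m[measurable]: "\<phi> \<in> M \<rightarrow>\<^sub>M M" and \<phi>d: "distr M M \<phi> = M"
    and \<psi>m[measurable]: "\<psi> \<in> M \<rightarrow>\<^sub>M M" and \<psi>d: "distr M M \<psi> = M"
    using \<phi> by (simp_all add: invertible_mp_def \<psi>_def)
  have \<psi>\<phi>: "\<psi> (\<phi> x) = x" if "x \<in> space M" for x
    using bij that by (simp add: \<psi>_def bij_betw_def inv_into_f_f)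
  have \<psi>s: "\<psi> x \<in> space M" if "x \<in> space M" for x using \<psi>m that by (rule measurable_space)
  have \<phi>s: "\<phi> x \<in> space M" if "x \<in> space M" for x using \<phi>m that by (rule measurable_space)
  define q where "q x = p (\<psi> x)" for x
  have qm[measurable]: "q \<in> M \<rightarrow>\<^sub>M count_space UNIV" unfolding q_def[abs_def] by measurable
  have q\<phi>: "q (\<phi> x) = p x" if "x \<in> space M" for x using \<psi>\<phi>[OF that] by (simp add: q_def)
  have eq: "equipartition M q N"
  proof (unfold_locales)
    show "q x < N" if "x \<in> space M" for x using pN \<psi>s[OF that] by (simp add: q_def)
    fix v assume v: "v < N"
    have s: "p -` {v} \<inter> space M \<in> sets M" by measurable
    have "measure (distr M M \<psi>) (p -` {v} \<inter> space M) = prob (\<psi> -` (p -` {v} \<inter> space M) \<inter> space M)"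
      by (rule measure_distr[OF \<psi>m s])
    also have "\<psi> -` (p -` {v} \<inter> space M) \<inter> space M = {x \<in> space M. q x = v}"
      using \<psi>s by (auto simp: q_def)
    finally show "prob {x \<in> space M. q x = v} = 1 / N" using pf[OF v] by (simp add: \<psi>d)
  qed (rule qm)
  have "\<bar>\<integral>z. indicator A (fst z) * indicator B (snd z) * (of_bool (EG (q (fst z)) (q (snd z))) - W (fst z) (snd z)) \<partial>(M \<Otimes>\<^sub>M M)\<bar> \<le> \<epsilon>"
    if A[measurable]: "A \<in> sets M" and B[measurable]: "B \<in> sets M" for A B
  proof -
    let ?g = "\<lambda>z. indicator A (fst z) * indicator B (snd z) * (of_bool (EG (q (fst z)) (q (snd z))) - W (fst z) (snd z))"
    let ?V = "\<lambda>x y. U x y - W (\<phi> x) (\<phi> y)"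
    have [measurable]: "(\<lambda>z. of_bool (EG (q (fst z)) (q (snd z))) :: real) \<in> borel_measurable (M \<Otimes>\<^sub>M M)"
      using measurable_label_fun[OF qm qm, of "\<lambda>a b. of_bool (EG a b)"] .
    have [measurable]: "(\<lambda>z. W (fst z) (snd z)) \<in> borel_measurable (M \<Otimes>\<^sub>M M)"
      using W' by (simp add: case_prod_beta')
    have g: "?g \<in> borel_measurable (M \<Otimes>\<^sub>M M)" by measurable
    have "M \<Otimes>\<^sub>M M = distr M M \<phi> \<Otimes>\<^sub>M distr M M \<phi>" by (simp add: \<phi>d)
    also have "\<dots> = distr (M \<Otimes>\<^sub>M M) (M \<Otimes>\<^sub>M M) (\<lambda>(x, y). (\<phi> x, \<phi> y))"
      by (rule pair_measure_distr) (simp_all add: \<phi>d sigma_finite_measure_axioms)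
    finally have MM: "M \<Otimes>\<^sub>M M = distr (M \<Otimes>\<^sub>M M) (M \<Otimes>\<^sub>M M) (\<lambda>(x, y). (\<phi> x, \<phi> y))" .
    have "(\<integral>z. ?g z \<partial>(M \<Otimes>\<^sub>M M)) = (\<integral>z. ?g z \<partial>distr (M \<Otimes>\<^sub>M M) (M \<Otimes>\<^sub>M M) (\<lambda>(x, y). (\<phi> x, \<phi> y)))"
      using MM by simp
    also have "\<dots> = (\<integral>z. ?g ((\<lambda>(x, y). (\<phi> x, \<phi> y)) z) \<partial>(M \<Otimes>\<^sub>M M))"
      by (rule integral_distr[OF _ g]) measurable
    \<comment> \<open>A test rectangle pulls back to the rectangle of the preimages, and the
      relabelled graph kernel pulls back to \<open>U\<close>.\<close>
    also have "\<dots> = (\<integral>z. indicator ((\<phi> -` A \<inter> space M) \<times> (\<phi> -` B \<inter> space M)) z * ?V (fst z) (snd z) \<partial>(M \<Otimes>\<^sub>M M))"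
      by (intro Bochner_Integration.integral_cong refl)
        (auto simp: space_pair_measure indicator_def q\<phi> U)
    finally have "\<bar>\<integral>z. ?g z \<partial>(M \<Otimes>\<^sub>M M)\<bar> =
      \<bar>\<integral>z. indicator ((\<phi> -` A \<inter> space M) \<times> (\<phi> -` B \<inter> space M)) z * ?V (fst z) (snd z) \<partial>(M \<Otimes>\<^sub>M M)\<bar>"
      by simp
    also have "\<dots> \<le> cut_norm M ?V"
    proof (rule cut_norm_bound)
      show "\<bar>?V x y\<bar> \<le> 1" if "x \<in> space M" "y \<in> space M" for x y
        using W01[OF \<phi>s[OF that(1)] \<phi>s[OF that(2)]] U[OF that] by (auto simp: abs_le_iff of_bool_def)
    qed measurable
    finally show ?thesis using cn by linarith
  qed
  then show ?thesis using eq by blast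
qed

end

theorem theorem3p4:
  fixes M :: "'a::polish_space measure"
    and W :: "'a \<Rightarrow> 'a \<Rightarrow> real"
    and k :: nat and EF :: "nat \<Rightarrow> nat \<Rightarrow> bool"
    and N :: "nat \<Rightarrow> nat" and EG :: "nat \<Rightarrow> nat \<Rightarrow> nat \<Rightarrow> bool"
  assumes "sets M = sets borel"
    and "prob_space M"
    and "atomless_measure M"
    and "graphon M W"
    and "k \<ge> 1" and "fin_graph k EF"
    and "\<And>n. fin_graph (N n) (EG n)"
    and "filterlim N at_top sequentially"
    and "\<exists>U. (\<forall>n. graphon_rep M (N n) (EG n) (U n)) \<and>
              (\<lambda>n. cut_dist M (U n) W) \<longlonglongrightarrow> 0"
  shows "Liminf sequentially
           (\<lambda>n. ennreal (real (til_graph k EF (N n) (EG n)) / real (N n)))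
         \<ge> til_graphon M k EF W"
proof -
  interpret prob_space M by fact
  define E where "E = {(i, j). i < j \<and> j < k \<and> EF i j}"
  have E: "finite E" "E \<subseteq> {..<k} \<times> {..<k}"
    unfolding E_def by (auto intro: finite_subset[of _ "{..<k} \<times> {..<k}"])
  have W: "case_prod W \<in> borel_measurable (M \<Otimes>\<^sub>M M)"
    and W01: "\<And>x y. x \<in> space M \<Longrightarrow> y \<in> space M \<Longrightarrow> 0 \<le> W x y \<and> W x y \<le> 1"
    using assms(4) by (auto simp: graphon_def)
  define H where "H = edge_prod E (\<lambda>_. W)"
  have tensor: "tensor_F k EF W = H"
    by (simp add: fun_eq_iff tensor_F_def H_def edge_prod_def E_def split_def)
  have Hm[measurable]: "H \<in> borel_measurable (Pi_space {..<k})"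
    unfolding H_def by (intro edge_prod_measurable E W)
  have H0: "0 \<le> H x" if "x \<in> space (Pi_space {..<k})" for x
    using edge_prod_01[OF E(2) that, of "\<lambda>_. W"] W01 unfolding H_def by simp
  obtain U where rep: "\<And>n. graphon_rep M (N n) (EG n) (U n)" and lim: "(\<lambda>n. cut_dist M (U n) W) \<longlonglongrightarrow> 0"
    using assms(9) by blast
  let ?L = "Liminf sequentially (\<lambda>n. ennreal (real (til_graph k EF (N n) (EG n)) / real (N n)))"
  \<comment> \<open>The case of bounded functions supported where the edge product exceeds some
    \<delta>; these satisfy the hypotheses of \<open>large_graph_tiling\<close>, whose loss \<xi> is
    arbitrary.\<close>
  have bounded: "ennreal (\<integral>x. s x \<partial>Pi_space {..<k}) \<le> ?L"
    if s: "s \<in> borel_measurable (Pi_space {..<k})" "\<And>x. x \<in> space (Pi_space {..<k}) \<Longrightarrow> 0 \<le> s x"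
      "\<And>x. x \<in> space (Pi_space {..<k}) \<Longrightarrow> s x \<le> C"
      "\<And>x. x \<in> space (Pi_space {..<k}) \<Longrightarrow> s x \<noteq> 0 \<Longrightarrow> \<delta> < H x"
      "\<And>x. x \<in> space M \<Longrightarrow> (\<Sum>l<k. \<integral>\<^sup>+ y. ennreal (s (y(l := x))) \<partial>Pi_space ({..<k} - {l})) \<le> 1"
      and pos: "0 < \<delta>" "0 < C" for s :: "(nat \<Rightarrow> 'a) \<Rightarrow> real" and C \<delta>
  proof (rule ennreal_le_epsilon)
    let ?s = "\<integral>x. s x \<partial>Pi_space {..<k}"
    fix \<xi> :: real assume \<xi>: "0 < \<xi>"
    obtain \<epsilon> N0 where \<epsilon>: "0 < \<epsilon>" and tiling: "\<forall>p N EG. N0 \<le> N \<longrightarrow> equipartition M p N \<longrightarrow> fin_graph N EG \<longrightarrow>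
      (\<forall>A\<in>sets M. \<forall>B\<in>sets M.
      \<bar>\<integral>z. indicator A (fst z) * indicator B (snd z) * (of_bool (EG (p (fst z)) (p (snd z))) - W (fst z) (snd z)) \<partial>(M \<Otimes>\<^sub>M M)\<bar> \<le> \<epsilon>) \<longrightarrow>
      (?s - \<xi>) * real N \<le> til_graph k EF N EG"
      using large_graph_tiling[OF assms(5,6) E_def W W01 s(1,2,3) s(4)[unfolded H_def] s(5) pos \<xi>] by blast
    have "\<forall>\<^sub>F n in sequentially. N0 \<le> N n" "\<forall>\<^sub>F n in sequentially. 1 \<le> N n"
      using assms(8) unfolding filterlim_at_top by blast+
    moreover have "\<forall>\<^sub>F n in sequentially. cut_dist M (U n) W < \<epsilon>"
      using order_tendstoD(2)[OF lim \<epsilon>] .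
    ultimately have "\<forall>\<^sub>F n in sequentially. ennreal (?s - \<xi>) \<le> ennreal (real (til_graph k EF (N n) (EG n)) / real (N n))"
    proof eventually_elim
      case (elim n)
      obtain p where "equipartition M p (N n)" "\<forall>A\<in>sets M. \<forall>B\<in>sets M.
        \<bar>\<integral>z. indicator A (fst z) * indicator B (snd z) * (of_bool (EG n (p (fst z)) (p (snd z))) - W (fst z) (snd z)) \<partial>(M \<Otimes>\<^sub>M M)\<bar> \<le> \<epsilon>"
        using cut_dist_equipartition[OF assms(4) rep elim(3)] by (elim exE conjE)
      then have "(?s - \<xi>) * real (N n) \<le> til_graph k EF (N n) (EG n)"
        using tiling elim(1) assms(7) by blast
      then show ?case using elim(2) by (intro ennreal_leI) (simp add: field_simps)
    qed
    then have le: "ennreal (?s - \<xi>) \<le> ?L" by (rule Liminf_bounded)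
    \<comment> \<open>\<open>ennreal\<close> sends negative reals to 0, so \<open>?s\<close> below
      \<xi> needs a case of its own.\<close>
    have "ennreal ?s \<le> ennreal (?s - \<xi>) + ennreal \<xi>"
    proof (cases "\<xi> \<le> ?s")
      case True
      then show ?thesis using \<xi> by (simp flip: ennreal_plus)
    next
      case False
      then have "ennreal ?s \<le> ennreal \<xi>" by (intro ennreal_leI) simp
      then show ?thesis by (simp add: add_increasing)
    qed
    also have "\<dots> \<le> ?L + ennreal \<xi>" using le by (rule add_right_mono)
    finally show "ennreal ?s \<le> ?L + ennreal \<xi>" .
  qed
  have "(\<integral>\<^sup>+ x. ennreal (t x) \<partial>Pi_space {..<k}) \<le> ?L" if tiling: "F_tiling M k EF W t" for t
  proof -
    have t[measurable]: "t \<in> borel_measurable (Pi_space {..<k})"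
      and t0: "\<And>x. x \<in> space (Pi_space {..<k}) \<Longrightarrow> 0 \<le> t x"
      and supp: "\<And>x. x \<in> space (Pi_space {..<k}) \<Longrightarrow> t x \<noteq> 0 \<Longrightarrow> H x \<noteq> 0"
      and deg: "\<And>x. x \<in> space M \<Longrightarrow> (\<Sum>l<k. \<integral>\<^sup>+ y. ennreal (t (y(l := x))) \<partial>Pi_space ({..<k} - {l})) \<le> 1"
      using tiling by (auto simp: F_tiling_def tensor)
    \<comment> \<open>One index drives both truncations: values are cut at j+1 and the support is
      restricted to density above 1/(j+1). Both relax as j grows, so the sequence increases and
      monotone convergence applies.\<close>
    define s where "s j x = (if 1 / real (Suc j) < H x then min (t x) (real (Suc j)) else 0)" for j x
    have sm[measurable]: "s j \<in> borel_measurable (Pi_space {..<k})" for j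
      unfolding s_def[abs_def] by measurable
    have s0: "0 \<le> s j x" "s j x \<le> real (Suc j)" "s j x \<le> t x" if "x \<in> space (Pi_space {..<k})" for j x
      using t0[OF that] by (auto simp: s_def)
    have le: "ennreal (\<integral>x. s j x \<partial>Pi_space {..<k}) \<le> ?L" for j
    proof (rule bounded[of "s j" "real (Suc j)" "1 / real (Suc j)"])
      show "1 / real (Suc j) < H x" if "s j x \<noteq> 0" for x
        using that by (auto simp: s_def split: if_splits)
      fix x assume x: "x \<in> space M"
      have "(\<Sum>l<k. \<integral>\<^sup>+ y. ennreal (s j (y(l := x))) \<partial>Pi_space ({..<k} - {l})) \<le>
        (\<Sum>l<k. \<integral>\<^sup>+ y. ennreal (t (y(l := x))) \<partial>Pi_space ({..<k} - {l}))"
        by (intro sum_mono nn_integral_mono ennreal_leI s0)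
          (use x in \<open>auto simp: space_PiM PiE_iff extensional_def\<close>)
      also have "\<dots> \<le> 1" by (rule deg[OF x])
      finally show "(\<Sum>l<k. \<integral>\<^sup>+ y. ennreal (s j (y(l := x))) \<partial>Pi_space ({..<k} - {l})) \<le> 1" .
    qed (use s0 in auto)
    have nn: "(\<integral>\<^sup>+ x. ennreal (s j x) \<partial>Pi_space {..<k}) = ennreal (\<integral>x. s j x \<partial>Pi_space {..<k})" for j
    proof (rule nn_integral_eq_integral)
      show "integrable (Pi_space {..<k}) (s j)"
        using s0 by (intro prob_space.integrable_bounded_real[OF prob_space_Pi_space, where B="real (Suc j)"]) auto
    qed (use s0 in auto)
    \<comment> \<open>The truncations see only points of positive density. Since \<open>H\<close> is
      nonnegative and \<open>t\<close> vanishes where \<open>H\<close> does, their limit has the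
      same integral as \<open>t\<close>.\<close>
    let ?t = "\<lambda>x. if 0 < H x then ennreal (t x) else 0"
    have "(\<lambda>j. \<integral>\<^sup>+ x. ennreal (s j x) \<partial>Pi_space {..<k}) \<longlonglongrightarrow> (\<integral>\<^sup>+ x. ?t x \<partial>Pi_space {..<k})"
    proof (rule nn_integral_LIMSEQ)
      show "incseq (\<lambda>j x. ennreal (s j x))"
      proof (intro incseq_SucI le_funI)
        fix j x
        have "1 / real (Suc (Suc j)) \<le> 1 / real (Suc j)" by (simp add: frac_le)
        then show "ennreal (s j x) \<le> ennreal (s (Suc j) x)"
          unfolding s_def by (auto intro!: ennreal_leI)
      qed
      show "(\<lambda>j. ennreal (s j x)) \<longlonglongrightarrow> ?t x" for x
      proof (cases "0 < H x")
        case True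
        obtain j0 where j0: "1 / real (Suc j0) < H x" using nat_approx_posE[OF True] by metis
        obtain j1 :: nat where j1: "t x < j1" using reals_Archimedean2 by blast
        have "s j x = t x" if "max j0 j1 \<le> j" for j
        proof -
          have "1 / real (Suc j) \<le> 1 / real (Suc j0)" using that by (intro frac_le) auto
          then show ?thesis using j0 j1 that by (simp add: s_def)
        qed
        then have "\<forall>\<^sub>F j in sequentially. ennreal (s j x) = ?t x"
          using True by (intro eventually_sequentiallyI[of "max j0 j1"]) simp
        then show ?thesis by (rule tendsto_eventually)
      next
        case False
        have "0 < 1 / real (Suc j)" for j by simp
        then have "s j x = 0" for j using False unfolding s_def by (smt (verit))
        then show ?thesis using False by simp
      qed
    qed measurable
    then have "(\<integral>\<^sup>+ x. ?t x \<partial>Pi_space {..<k}) \<le> ?L"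
      by (rule LIMSEQ_le_const2) (use le nn in auto)
    moreover have "(\<integral>\<^sup>+ x. ?t x \<partial>Pi_space {..<k}) = (\<integral>\<^sup>+ x. ennreal (t x) \<partial>Pi_space {..<k})"
      using supp H0 by (intro nn_integral_cong) (force simp: less_le)
    ultimately show ?thesis by simp
  qed
  then show ?thesis unfolding til_graphon_def by (intro SUP_least) auto
qed

end
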